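(* Let $L\ge 1$ and let $\gamma,\theta,\zeta,\mu_1,\dots,\mu_L$ be generic complex parameters. Let $\mathcal{Z}(\lambda_1,\dots,\lambda_L)=\langle\bar 0|\,\mathcal{B}(\lambda_1)\cdots\mathcal{B}(\lambda_L)\,|0\rangle$ be the partition function of the elliptic SOS model with domain-wall boundaries and one reflecting end (defined in the context). Then for generic $\lambda_0,\lambda_1,\dots,\lambda_L\in\mathbb{C}$, \[ \sum_{\nu=0}^{L} M_\nu(\lambda_0;\boldsymbol{\lambda})\,\mathcal{Z}(\lambda_0,\dots,\widehat{\lambda_\nu},\dots,\lambda_L)=0, \] where $\boldsymbol{\lambda}=(\lambda_1,\dots,\lambda_L)$, the caret means that $\lambda_\nu$ is omitted from the list $(\lambda_0,\lambda_1,\dots,\lambda_L)$, and \[ M_0(\lambda_0;\boldsymbol{\lambda})=\bar\Lambda_{\mathcal A}(\lambda_0)-\Lambda_{\mathcal A}(\lambda_0)\prod_{j=1}^{L}\frac{[\lambda_j-\lambda_0+\gamma,\,\lambda_j+\lambda_0]}{[\lambda_j-\lambda_0,\,\lambda_j+\lambda_0+\gamma]}, \] and for $1\le i\le L$ \[ \begin{aligned} M_i(\lambda_0;\boldsymbol{\lambda})={}&\frac{[2\lambda_i,\,\gamma,\,\theta+(L-1)\gamma+\lambda_i-\lambda_0]}{[2\lambda_i+\gamma,\,\lambda_i-\lambda_0,\,\theta+(L-1)\gamma]}\,\Lambda_{\mathcal A}(\lambda_i)\prod_{j\ne i}\frac{[\lambda_j-\lambda_i+\gamma,\,\lambda_j+\lambda_i]}{[\lambda_j-\lambda_i,\,\lambda_j+\lambda_i+\gamma]}\\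 &+\frac{[\gamma,\,\theta+(L-2)\gamma-\lambda_i-\lambda_0,\,\theta-(L-1)\gamma]}{[\lambda_i+\lambda_0+\gamma,\,\theta+(L-1)\gamma,\,\theta-L\gamma]}\,\Lambda_{\tilde{\mathcal D}}(\lambda_i)\prod_{j\ne i}\frac{[\lambda_i-\lambda_j+\gamma,\,\lambda_i+\lambda_j+2\gamma]}{[\lambda_i-\lambda_j,\,\lambda_i+\lambda_j+\gamma]}, \end{aligned} \] with products over $j\in\{1,\dots,L\}$, and \[ \begin{aligned} \Lambda_{\mathcal A}(\lambda)&=[\zeta+\lambda]\frac{[\theta+\zeta-\lambda]}{[\theta+\zeta+\lambda]}\prod_{j=1}^L[\lambda-\mu_j+\gamma,\,\lambda+\mu_j+\gamma],\\ \Lambda_{\tilde{\mathcal D}}(\lambda)&=[\zeta-\lambda-\gamma]\frac{[2\lambda,\,\theta+\zeta+\lambda+\gamma,\,\theta-L\gamma]}{[2\lambda+\gamma,\,\theta+\zeta+\lambda,\,\theta-(L-1)\gamma]}\prod_{j=1}^L[\lambda-\mu_j,\,\lambda+\mu_j],\\ \bar\Lambda_{\mathcal A}(\lambda)&=[\zeta-\lambda]\frac{[\gamma,\,\theta+(L-1)\gamma-2\lambda]}{[2\lambda+\gamma,\,\theta+(L-1)\gamma]}\prod_{j=1}^L[\lambda-\mu_j+\gamma,\,\lambda+\mu_j+\gamma]\\ &\quad+[\zeta+\lambda+\gamma]\frac{[2\lambda,\,\theta+\zeta-\lambda-\gamma,\,\theta+L\gamma]}{[2\lambda+\gamma,\,\theta+\zeta+\lambda,\,\theta+(L-1)\gamma]}\prod_{j=1}^L[\lambda-\mu_j,\,\lambda+\mu_j].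 \end{aligned} \]
   Context: Fix $\tau\in\mathbb{C}$ with $\operatorname{Im}\tau>0$ and let $f(\lambda)=\sum_{n\ge0}(-1)^n e^{\mathrm{i}n(n+1)\pi\tau}\sinh((2n+1)\lambda)$ (equivalently $f(\lambda)=-\tfrac{\mathrm{i}}{2}e^{-\mathrm{i}\pi\tau/4}\vartheta_1(\mathrm{i}\lambda|\tau)$). Write $[x]:=f(x)$ and $[x_1,x_2,\dots,x_k]:=f(x_1)f(x_2)\cdots f(x_k)$. Let $V=\mathbb{C}^2$ with basis $e_+,e_-$ and $h\in\mathrm{End}(V)$, $he_\pm=\pm e_\pm$. Define $R(\lambda,\theta)\in\mathrm{End}(V\otimes V)$ by its matrix in the ordered basis $(e_+\otimes e_+,e_+\otimes e_-,e_-\otimes e_+,e_-\otimes e_-)$: $R=\begin{pmatrix}a_+&0&0&0\\0&b_+&c_+&0\\0&c_-&b_-&0\\0&0&0&a_-\end{pmatrix}$, with $a_\pm(\lambda,\theta)=[\lambda+\gamma]$, $b_\pm(\lambda,\theta)=[\lambda][\theta\mp\gamma]/[\theta]$, $c_\pm(\lambda,\theta)=[\theta\mp\lambda][\gamma]/[\theta]$. Let $V_0\cong V$ (auxiliary space) and $W=V_1\otimes\cdots\otimes V_L$ with $V_j\cong V$; subscripts denote the tensor factors on which an operator acts, $h_i$ is $h$ acting on $V_i$, and a dynamical argument of the form $\theta-\gamma\sum_{i\in S}h_i$ means that $\theta$ is replaced by this operator (diagonal in the standard basis of the factors $V_i$, $i\in S$, which commute with the rest). $R_{0j}(\lambda,\cdot)$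 is $R$ acting on $V_0\otimes V_j$ and $R_{j0}$ is $R$ acting on $V_j\otimes V_0$ with $V_j$ as first leg. Define $T_0(\lambda,\theta)=R_{01}(\lambda-\mu_1,\theta-\gamma\sum_{i=2}^Lh_i)\,R_{02}(\lambda-\mu_2,\theta-\gamma\sum_{i=3}^Lh_i)\cdots R_{0L}(\lambda-\mu_L,\theta)$, $\bar T_0(\lambda,\theta)=R_{L0}(\lambda+\mu_L,\theta)\,R_{L-1,0}(\lambda+\mu_{L-1},\theta-\gamma h_L)\cdots R_{10}(\lambda+\mu_1,\theta-\gamma\sum_{i=2}^Lh_i)$. Let $K_0(\lambda,\theta)=\mathrm{diag}(k_+(\lambda,\theta),k_-(\lambda,\theta))$ on $V_0$ with $k_+=[\zeta+\lambda][\theta+\zeta-\lambda]/[\theta+\zeta+\lambda]$, $k_-=[\zeta-\lambda]$. Let $\mathcal{T}_0(\lambda)=T_0(\lambda,\theta)K_0(\lambda,\theta)\bar T_0(\lambda,\theta)\in\mathrm{End}(V_0\otimes W)$ and define $\mathcal{A}(\lambda),\mathcal{B}(\lambda),\mathcal{C}(\lambda),\mathcal{D}(\lambda)\in\mathrm{End}(W)$ by $\mathcal{T}_0(\lambda)(e_+\otimes w)=e_+\otimes\mathcal{A}(\lambda)w+e_-\otimes\mathcal{C}(\lambda)w$ and $\mathcal{T}_0(\lambda)(e_-\otimes w)=e_+\otimes\mathcal{B}(\lambda)w+e_-\otimes\mathcal{D}(\lambda)w$. Let $|0\rangle=e_+^{\otimes L}\in W$ and, for $v\in W$, let $\langle\bar0|v$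 denote the coefficient of $e_-^{\otimes L}$ in $v$. The partition function is $\mathcal{Z}(\lambda_1,\dots,\lambda_L)=\langle\bar0|\mathcal{B}(\lambda_1)\cdots\mathcal{B}(\lambda_L)|0\rangle$. *)

theory Defs
  imports "HOL-Analysis.Analysis"
begin

definition thf :: "complex \<Rightarrow> complex \<Rightarrow> complex" where
  "thf \<tau> x = (\<Sum>n. (-1) ^ n * exp (\<i> * of_nat (n * (n + 1)) * of_real pi * \<tau>)
                      * sinh (of_nat (2 * n + 1) * x))"

text \<open>Spin True = e_+, False = e_-. Rent tau g lam th o1 o2 i1 i2 is the matrix entry of
  R(lam,th) from input basis vector e_i1 (x) e_i2 to output e_o1 (x) e_o2.\<close>

definition Rent :: "complex \<Rightarrow> complex \<Rightarrow> complex \<Rightarrow> complex \<Rightarrow> bool \<Rightarrow> bool \<Rightarrow> bool \<Rightarrow> bool \<Rightarrow> complex" where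
  "Rent \<tau> \<gamma> lam th o1 o2 i1 i2 =
    (if (o1 \<and> o2 \<and> i1 \<and> i2) \<or> (\<not>o1 \<and> \<not>o2 \<and> \<not>i1 \<and> \<not>i2) then thf \<tau> (lam + \<gamma>)
     else if o1 \<and> \<not>o2 \<and> i1 \<and> \<not>i2 then thf \<tau> lam * thf \<tau> (th - \<gamma>) / thf \<tau> th
     else if o1 \<and> \<not>o2 \<and> \<not>i1 \<and> i2 then thf \<tau> (th - lam) * thf \<tau> \<gamma> / thf \<tau> th
     else if \<not>o1 \<and> o2 \<and> i1 \<and> \<not>i2 then thf \<tau> (th + lam) * thf \<tau> \<gamma> / thf \<tau> th
     else if \<not>o1 \<and> o2 \<and> \<not>i1 \<and> i2 then thf \<tau> lam * thf \<tau> (th + \<gamma>) / thf \<tau> th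
     else 0)"

text \<open>A basis state of V_0 (x) V_1 (x) ... (x) V_L is (a, xs) with a the auxiliary spin and
  xs a list of length L, xs ! (j-1) being the spin of site j. An operator is given by its
  matrix entries O out in.\<close>

type_synonym fop = "bool \<times> bool list \<Rightarrow> bool \<times> bool list \<Rightarrow> complex"

definition fstates :: "nat \<Rightarrow> (bool \<times> bool list) set" where
  "fstates L = UNIV \<times> {xs. length xs = L}"

definition opmul :: "nat \<Rightarrow> fop \<Rightarrow> fop \<Rightarrow> fop" where
  "opmul L O1 O2 = (\<lambda>out inp. \<Sum>mid\<in>fstates L. O1 out mid * O2 mid inp)"

definition opid :: fop where
  "opid = (\<lambda>out inp. if out = inp then 1 else 0)"

text \<open>Eigenvalue of sum_{i=j+1}^L h_i on the basis state xs (sites j+1..L are list indices j..L-1).\<close>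
definition spin_sum :: "bool list \<Rightarrow> nat \<Rightarrow> complex" where
  "spin_sum xs j = (\<Sum>k\<in>{j..<length xs}. if xs ! k then 1 else -1)"

definition R0j :: "nat \<Rightarrow> complex \<Rightarrow> complex \<Rightarrow> complex \<Rightarrow> complex \<Rightarrow> nat \<Rightarrow> fop" where
  "R0j L \<tau> \<gamma> lam th j = (\<lambda>(a, xs) (b, ys).
     if (\<forall>k<L. k \<noteq> j - 1 \<longrightarrow> xs ! k = ys ! k)
     then Rent \<tau> \<gamma> lam (th - \<gamma> * spin_sum ys j) a (xs ! (j - 1)) b (ys ! (j - 1))
     else 0)"

definition Rj0 :: "nat \<Rightarrow> complex \<Rightarrow> complex \<Rightarrow> complex \<Rightarrow> complex \<Rightarrow> nat \<Rightarrow> fop" where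
  "Rj0 L \<tau> \<gamma> lam th j = (\<lambda>(a, xs) (b, ys).
     if (\<forall>k<L. k \<noteq> j - 1 \<longrightarrow> xs ! k = ys ! k)
     then Rent \<tau> \<gamma> lam (th - \<gamma> * spin_sum ys j) (xs ! (j - 1)) a (ys ! (j - 1)) b
     else 0)"

definition Tmon :: "nat \<Rightarrow> complex \<Rightarrow> complex \<Rightarrow> (nat \<Rightarrow> complex) \<Rightarrow> complex \<Rightarrow> complex \<Rightarrow> fop" where
  "Tmon L \<tau> \<gamma> \<mu> lam th =
     foldr (opmul L) (map (\<lambda>j. R0j L \<tau> \<gamma> (lam - \<mu> j) th j) [1..<Suc L]) opid"

definition Tbar :: "nat \<Rightarrow> complex \<Rightarrow> complex \<Rightarrow> (nat \<Rightarrow> complex) \<Rightarrow> complex \<Rightarrow> complex \<Rightarrow> fop" where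
  "Tbar L \<tau> \<gamma> \<mu> lam th =
     foldr (opmul L) (map (\<lambda>j. Rj0 L \<tau> \<gamma> (lam + \<mu> j) th j) (rev [1..<Suc L])) opid"

definition Kop :: "complex \<Rightarrow> complex \<Rightarrow> complex \<Rightarrow> complex \<Rightarrow> fop" where
  "Kop \<tau> \<zeta> lam th = (\<lambda>(a, xs) (b, ys).
     if a = b \<and> xs = ys then
       (if a then thf \<tau> (\<zeta> + lam) * thf \<tau> (th + \<zeta> - lam) / thf \<tau> (th + \<zeta> + lam)
        else thf \<tau> (\<zeta> - lam))
     else 0)"

definition dmon :: "nat \<Rightarrow> complex \<Rightarrow> complex \<Rightarrow> complex \<Rightarrow> complex \<Rightarrow> (nat \<Rightarrow> complex) \<Rightarrow> complex \<Rightarrow> fop" where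
  "dmon L \<tau> \<gamma> \<theta> \<zeta> \<mu> lam =
     opmul L (Tmon L \<tau> \<gamma> \<mu> lam \<theta>) (opmul L (Kop \<tau> \<zeta> lam \<theta>) (Tbar L \<tau> \<gamma> \<mu> lam \<theta>))"

definition Bop :: "nat \<Rightarrow> complex \<Rightarrow> complex \<Rightarrow> complex \<Rightarrow> complex \<Rightarrow> (nat \<Rightarrow> complex) \<Rightarrow> complex
                   \<Rightarrow> bool list \<Rightarrow> bool list \<Rightarrow> complex" where
  "Bop L \<tau> \<gamma> \<theta> \<zeta> \<mu> lam xs ys = dmon L \<tau> \<gamma> \<theta> \<zeta> \<mu> lam (True, xs) (False, ys)"

definition wmul :: "nat \<Rightarrow> (bool list \<Rightarrow> bool list \<Rightarrow> complex) \<Rightarrow> (bool list \<Rightarrow> bool list \<Rightarrow> complex)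
                    \<Rightarrow> bool list \<Rightarrow> bool list \<Rightarrow> complex" where
  "wmul L B1 B2 = (\<lambda>xs ys. \<Sum>zs\<in>{zs. length zs = L}. B1 xs zs * B2 zs ys)"

definition wid :: "bool list \<Rightarrow> bool list \<Rightarrow> complex" where
  "wid = (\<lambda>xs ys. if xs = ys then 1 else 0)"

definition Zpf :: "nat \<Rightarrow> complex \<Rightarrow> complex \<Rightarrow> complex \<Rightarrow> complex \<Rightarrow> (nat \<Rightarrow> complex)
                   \<Rightarrow> complex list \<Rightarrow> complex" where
  "Zpf L \<tau> \<gamma> \<theta> \<zeta> \<mu> lams =
     foldr (wmul L) (map (Bop L \<tau> \<gamma> \<theta> \<zeta> \<mu>) lams) wid (replicate L False) (replicate L True)"

definition LamA :: "nat \<Rightarrow> complex \<Rightarrow> complex \<Rightarrow> complex \<Rightarrow> complex \<Rightarrow> (nat \<Rightarrow> complex) \<Rightarrow> complex \<Rightarrow> complex" where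
  "LamA L \<tau> \<gamma> \<theta> \<zeta> \<mu> l =
     thf \<tau> (\<zeta> + l) * thf \<tau> (\<theta> + \<zeta> - l) / thf \<tau> (\<theta> + \<zeta> + l)
     * (\<Prod>j\<in>{1..L}. thf \<tau> (l - \<mu> j + \<gamma>) * thf \<tau> (l + \<mu> j + \<gamma>))"

definition LamD :: "nat \<Rightarrow> complex \<Rightarrow> complex \<Rightarrow> complex \<Rightarrow> complex \<Rightarrow> (nat \<Rightarrow> complex) \<Rightarrow> complex \<Rightarrow> complex" where
  "LamD L \<tau> \<gamma> \<theta> \<zeta> \<mu> l =
     thf \<tau> (\<zeta> - l - \<gamma>)
     * (thf \<tau> (2 * l) * thf \<tau> (\<theta> + \<zeta> + l + \<gamma>) * thf \<tau> (\<theta> - of_nat L * \<gamma>))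
     / (thf \<tau> (2 * l + \<gamma>) * thf \<tau> (\<theta> + \<zeta> + l) * thf \<tau> (\<theta> - (of_nat L - 1) * \<gamma>))
     * (\<Prod>j\<in>{1..L}. thf \<tau> (l - \<mu> j) * thf \<tau> (l + \<mu> j))"

definition LamAbar :: "nat \<Rightarrow> complex \<Rightarrow> complex \<Rightarrow> complex \<Rightarrow> complex \<Rightarrow> (nat \<Rightarrow> complex) \<Rightarrow> complex \<Rightarrow> complex" where
  "LamAbar L \<tau> \<gamma> \<theta> \<zeta> \<mu> l =
     thf \<tau> (\<zeta> - l)
     * (thf \<tau> \<gamma> * thf \<tau> (\<theta> + (of_nat L - 1) * \<gamma> - 2 * l))
     / (thf \<tau> (2 * l + \<gamma>) * thf \<tau> (\<theta> + (of_nat L - 1) * \<gamma>))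
     * (\<Prod>j\<in>{1..L}. thf \<tau> (l - \<mu> j + \<gamma>) * thf \<tau> (l + \<mu> j + \<gamma>))
   + thf \<tau> (\<zeta> + l + \<gamma>)
     * (thf \<tau> (2 * l) * thf \<tau> (\<theta> + \<zeta> - l - \<gamma>) * thf \<tau> (\<theta> + of_nat L * \<gamma>))
     / (thf \<tau> (2 * l + \<gamma>) * thf \<tau> (\<theta> + \<zeta> + l) * thf \<tau> (\<theta> + (of_nat L - 1) * \<gamma>))
     * (\<Prod>j\<in>{1..L}. thf \<tau> (l - \<mu> j) * thf \<tau> (l + \<mu> j))"

definition Mcoef :: "nat \<Rightarrow> complex \<Rightarrow> complex \<Rightarrow> complex \<Rightarrow> complex \<Rightarrow> (nat \<Rightarrow> complex)
                     \<Rightarrow> (nat \<Rightarrow> complex) \<Rightarrow> nat \<Rightarrow> complex" where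
  "Mcoef L \<tau> \<gamma> \<theta> \<zeta> \<mu> lam \<nu> =
    (if \<nu> = 0 then
       LamAbar L \<tau> \<gamma> \<theta> \<zeta> \<mu> (lam 0)
       - LamA L \<tau> \<gamma> \<theta> \<zeta> \<mu> (lam 0)
         * (\<Prod>j\<in>{1..L}. thf \<tau> (lam j - lam 0 + \<gamma>) * thf \<tau> (lam j + lam 0)
                        / (thf \<tau> (lam j - lam 0) * thf \<tau> (lam j + lam 0 + \<gamma>)))
     else
       (thf \<tau> (2 * lam \<nu>) * thf \<tau> \<gamma> * thf \<tau> (\<theta> + (of_nat L - 1) * \<gamma> + lam \<nu> - lam 0))
       / (thf \<tau> (2 * lam \<nu> + \<gamma>) * thf \<tau> (lam \<nu> - lam 0) * thf \<tau> (\<theta> + (of_nat L - 1) * \<gamma>))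
       * LamA L \<tau> \<gamma> \<theta> \<zeta> \<mu> (lam \<nu>)
       * (\<Prod>j\<in>{1..L} - {\<nu>}. thf \<tau> (lam j - lam \<nu> + \<gamma>) * thf \<tau> (lam j + lam \<nu>)
                            / (thf \<tau> (lam j - lam \<nu>) * thf \<tau> (lam j + lam \<nu> + \<gamma>)))
     + (thf \<tau> \<gamma> * thf \<tau> (\<theta> + (of_nat L - 2) * \<gamma> - lam \<nu> - lam 0) * thf \<tau> (\<theta> - (of_nat L - 1) * \<gamma>))
       / (thf \<tau> (lam \<nu> + lam 0 + \<gamma>) * thf \<tau> (\<theta> + (of_nat L - 1) * \<gamma>) * thf \<tau> (\<theta> - of_nat L * \<gamma>))
       * LamD L \<tau> \<gamma> \<theta> \<zeta> \<mu> (lam \<nu>)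
       * (\<Prod>j\<in>{1..L} - {\<nu>}. thf \<tau> (lam \<nu> - lam j + \<gamma>) * thf \<tau> (lam \<nu> + lam j + 2 * \<gamma>)
                            / (thf \<tau> (lam \<nu> - lam j) * thf \<tau> (lam \<nu> + lam j + \<gamma>))))"

end

theory Submission
  imports Defs "HOL-Complex_Analysis.Complex_Analysis"
begin

text \<open>
  The relation is obtained by computing \<open>\<langle>\<bar>0| A(\<lambda>\<^sub>0) B(\<lambda>\<^sub>1) \<dots> B(\<lambda>\<^sub>L) |0\<rangle>\<close> in two ways. To the
  left, the all-down covector is an eigenvector of \<open>A\<close>. To the right, \<open>A\<close> is moved through the
  \<open>B\<close>'s with the dynamical reflection algebra. Instead of the operator \<open>D\<close> we use the crossing
  relation, which expresses \<open>D(\<lambda>)\<close> by \<open>A(\<lambda>)\<close> and \<open>A(-\<lambda>-\<gamma>)\<close> and gives \<open>B(-\<lambda>-\<gamma>) \<propto> B(\<lambda>)\<close>, so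
  that only the exchange relations of \<open>A\<close> with \<open>B\<close> and of \<open>B\<close> with \<open>B\<close> are needed; the
  coefficients of the unwanted terms are then controlled, one \<open>B\<close> at a time, by a single four-term
  theta identity.

  The reflection equation is proved by adding one site after the other with the dynamical
  Yang-Baxter equation, and every scalar identity on the way is a consequence of the oddness of the
  theta function and of the three-term identity. Some of these steps divide by factors which the
  hypotheses allow to vanish, so the relation is first proved for generic parameters and then
  extended by continuity along a line of parameters.
\<close>

section \<open>The theta function\<close>

lemma summable_exp_quadratic:
  fixes a b :: real
  assumes "a < 0"
  shows "summable (\<lambda>n. exp (a * real n ^ 2 + b * real n))"
proof -
  obtain N :: nat where N: "- (b + 1) / (2 * a) < real N"
    using reals_Archimedean2 by blast
  show ?thesis
  proof (rule summable_ratio_test)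
    show "exp (- 1) < (1::real)" by simp
  next
    fix n assume "N \<le> n"
    then have "2 * a * real n \<le> - (b + 1)"
      using N assms by (smt (verit) divide_less_eq mult.commute mult_left_mono of_nat_mono)
    then have "a * real (Suc n) ^ 2 + b * real (Suc n) \<le> - 1 + (a * real n ^ 2 + b * real n)"
      using assms by (simp add: power2_eq_square algebra_simps)
    then show "norm (exp (a * real (Suc n) ^ 2 + b * real (Suc n)))
        \<le> exp (- 1) * norm (exp (a * real n ^ 2 + b * real n))"
      by (simp flip: exp_add)
  qed
qed

lemma range_int_Un_range_neg: "range int \<union> range (\<lambda>n. - int n - 1) = UNIV"
proof -
  have "k \<in> range int \<union> range (\<lambda>n. - int n - 1)" for k
  proof (cases "k \<ge> 0")
    case True
    then show ?thesis by (metis UnI1 rangeI nonneg_int_cases)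
  next
    case False
    then have "k = - int (nat (- k - 1)) - 1" by simp
    then show ?thesis by blast
  qed
  then show ?thesis by blast
qed

lemma summable_on_int_exp_quadratic:
  fixes a b c :: complex
  assumes "Re a < 0"
  shows "(\<lambda>n. exp (a * of_int (n\<^sup>2) + b * of_int n + c)) summable_on UNIV"
proof -
  let ?g = "\<lambda>n::int. exp (a * of_int (n\<^sup>2) + b * of_int n + c)"
  have "summable (\<lambda>n. norm (?g (int n)))"
    using summable_mult[OF summable_exp_quadratic[OF assms, of "Re b"], of "exp (Re c)"]
    by (simp add: add_ac flip: exp_add)
  then have "?g summable_on range int"
    by (subst summable_on_reindex) (auto simp: o_def intro: norm_summable_imp_summable_on)
  moreover have "summable (\<lambda>n. norm (?g (- int n - 1)))"
    using summable_mult[OF summable_exp_quadratic[OF assms, of "2 * Re a - Re b"],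
        of "exp (Re a - Re b + Re c)"]
    by (simp add: power2_eq_square algebra_simps flip: exp_add)
  then have "?g summable_on range (\<lambda>n. - int n - 1)"
    by (subst summable_on_reindex)
      (auto simp: o_def inj_on_def intro: norm_summable_imp_summable_on)
  ultimately show ?thesis
    using summable_on_Un_disjoint[of ?g "range int" "range (\<lambda>n. - int n - 1)"]
    unfolding range_int_Un_range_neg by fastforce
qed

lemma has_sum_int_imp_sums:
  fixes g :: "int \<Rightarrow> complex"
  assumes "(g has_sum S) UNIV"
  shows "(\<lambda>n. g (int n) + g (- int n - 1)) sums S"
proof -
  have summable: "g summable_on A" for A
    using assms summable_on_subset_banach by (metis has_sum_imp_summable subset_UNIV)
  define P where "P = infsum g (range int)"
  define M where "M = infsum g (range (\<lambda>n. - int n - 1))"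
  have nonneg: "(g has_sum P) (range int)" and neg: "(g has_sum M) (range (\<lambda>n. - int n - 1))"
    unfolding P_def M_def using summable by (rule has_sum_infsum)+
  have "(g has_sum (P + M)) UNIV"
    using has_sum_Un_disjoint[OF nonneg neg] unfolding range_int_Un_range_neg by fastforce
  then have "S = P + M" using assms has_sum_unique by blast
  moreover have "(\<lambda>n. g (int n)) sums P" "(\<lambda>n. g (- int n - 1)) sums M"
    using nonneg neg by (auto simp: has_sum_reindex inj_on_def o_def intro: has_sum_imp_sums)
  ultimately show ?thesis by (simp add: sums_add)
qed

lemma has_sum_mult_Times:
  fixes f :: "'a \<Rightarrow> complex" and g :: "'b \<Rightarrow> complex"
  assumes sum_f: "(f has_sum a) A" and sum_g: "(g has_sum b) B"
  shows "((\<lambda>(x, y). f x * g y) has_sum (a * b)) (A \<times> B)"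
proof (rule has_sum_SigmaI)
  show "((\<lambda>y. case (x, y) of (x, y) \<Rightarrow> f x * g y) has_sum f x * b) B" for x
    using has_sum_cmult_right[OF sum_g] by simp
  show "((\<lambda>x. f x * b) has_sum a * b) A"
    using has_sum_cmult_left[OF sum_f] by simp
  have "(\<lambda>x. norm (f x)) summable_on A" "(\<lambda>y. norm (g y)) summable_on B"
    using sum_f sum_g
    by (auto simp flip: summable_on_iff_abs_summable_on_complex simp: summable_on_def)
  then have "(\<lambda>z. norm (case z of (x, y) \<Rightarrow> f x * g y)) summable_on A \<times> B"
    unfolding Infinite_Sum.abs_summable_on_Sigma_iff
    by (auto simp: norm_mult abs_mult infsum_cmult_right'
        intro!: summable_on_cmult_right summable_on_cmult_left)
  then show "(\<lambda>(x, y). f x * g y) summable_on A \<times> B"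
    using summable_on_iff_abs_summable_on_complex by blast
qed

definition thf_term :: "complex \<Rightarrow> complex \<Rightarrow> int \<Rightarrow> complex" where
  "thf_term \<tau> x n = (if even n then 1 else - 1) *
     exp (\<i> * of_int (n * (n + 1)) * of_real pi * \<tau> + of_int (2 * n + 1) * x) / 2"

lemma thf_term_summable_on:
  assumes "Im \<tau> > 0"
  shows "thf_term \<tau> x summable_on A"
proof -
  define g :: "int \<Rightarrow> complex" where
    "g n = exp (\<i> * of_real pi * \<tau> * of_int (n\<^sup>2) + (\<i> * of_real pi * \<tau> + 2 * x) * of_int n + x)"
      for n
  have "g summable_on UNIV"
    unfolding g_def using assms by (intro summable_on_int_exp_quadratic) simp
  then have "(\<lambda>n. g n * (1 / 2)) summable_on UNIV"
    by (rule summable_on_cmult_left)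
  moreover have "norm (thf_term \<tau> x n) = norm (g n * (1 / 2))" for n
    by (simp add: thf_term_def g_def norm_mult norm_divide algebra_simps power2_eq_square)
  ultimately have "thf_term \<tau> x summable_on UNIV"
    unfolding summable_on_iff_abs_summable_on_complex by (simp only:)
  then show ?thesis using summable_on_subset_banach by blast
qed

lemma thf_term_pair:
  "thf_term \<tau> x (int n) + thf_term \<tau> x (- int n - 1) =
     (-1) ^ n * exp (\<i> * of_nat (n * (n + 1)) * of_real pi * \<tau>) * sinh (of_nat (2 * n + 1) * x)"
proof -
  define E where "E = \<i> * of_nat (n * (n + 1)) * of_real pi * \<tau>"
  define y where "y = of_nat (2 * n + 1) * x"
  have "thf_term \<tau> x (int n) = (-1) ^ n * exp (E + y) / 2"
    by (simp add: thf_term_def E_def y_def algebra_simps)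
  moreover have "thf_term \<tau> x (- int n - 1) = - ((-1) ^ n * exp (E - y) / 2)"
    by (simp add: thf_term_def E_def y_def algebra_simps)
  ultimately show ?thesis
    unfolding E_def[symmetric] y_def[symmetric]
    by (simp add: sinh_field_def exp_add exp_diff exp_minus divide_simps) (simp add: algebra_simps)
qed

lemma thf_has_sum:
  assumes "Im \<tau> > 0"
  shows "(thf_term \<tau> x has_sum thf \<tau> x) UNIV"
proof -
  have "(thf_term \<tau> x has_sum infsum (thf_term \<tau> x) UNIV) UNIV"
    using thf_term_summable_on[OF assms] by (rule has_sum_infsum)
  moreover from has_sum_int_imp_sums[OF this] have "infsum (thf_term \<tau> x) UNIV = thf \<tau> x"
    by (simp add: thf_term_pair thf_def sums_iff)
  ultimately show ?thesis by simp
qed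

lemma thf_minus:
  assumes "Im \<tau> > 0"
  shows "thf \<tau> (- x) = - thf \<tau> x"
proof -
  have "(\<lambda>n. (-1) ^ n * exp (\<i> * of_nat (n * (n + 1)) * of_real pi * \<tau>) *
        sinh (of_nat (2 * n + 1) * x))
      sums thf \<tau> x"
    using has_sum_int_imp_sums[OF thf_has_sum[OF assms]] by (simp add: thf_term_pair)
  from sums_minus[OF this] show ?thesis
    by (simp add: thf_def sums_iff)
qed

definition gauss_term :: "complex \<Rightarrow> complex \<Rightarrow> int \<Rightarrow> complex" where
  "gauss_term \<tau> x s = exp (\<i> * of_int (s\<^sup>2) * of_real pi * \<tau> / 2 + 2 * of_int s * x)"

lemma gauss_term_summable_on:
  assumes "Im \<tau> > 0"
  shows "gauss_term \<tau> x summable_on A"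
proof -
  have "(\<lambda>s. exp (\<i> * of_real pi * \<tau> / 2 * of_int (s\<^sup>2) + 2 * x * of_int s + 0)) summable_on UNIV"
    using assms by (intro summable_on_int_exp_quadratic) simp
  then have "gauss_term \<tau> x summable_on UNIV"
    by (simp add: gauss_term_def[abs_def] mult_ac)
  then show ?thesis using summable_on_subset_banach by blast
qed

lemma thf_term_mult:
  "thf_term \<tau> (x + y) m * thf_term \<tau> (x - y) n =
     (if even (m + n + 1) then - 1 else 1) * (exp (- \<i> * of_real pi * \<tau> / 2) / 4)
       * (gauss_term \<tau> x (m + n + 1) * gauss_term \<tau> y (m - n))"
proof -
  let ?exponent = "\<lambda>n x. \<i> * of_int (n * (n + 1)) * of_real pi * \<tau> + of_int (2 * n + 1) * x"
  have "?exponent m (x + y) + ?exponent n (x - y) =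
    - \<i> * of_real pi * \<tau> / 2 +
      ((\<i> * of_int ((m + n + 1)\<^sup>2) * of_real pi * \<tau> / 2 + 2 * of_int (m + n + 1) * x) +
       (\<i> * of_int ((m - n)\<^sup>2) * of_real pi * \<tau> / 2 + 2 * of_int (m - n) * y))"
    by (simp add: field_simps power2_eq_square)
  then have "exp (?exponent m (x + y)) * exp (?exponent n (x - y)) =
      exp (- \<i> * of_real pi * \<tau> / 2) * (gauss_term \<tau> x (m + n + 1) * gauss_term \<tau> y (m - n))"
    unfolding gauss_term_def exp_add[symmetric] by (rule arg_cong)
  then show ?thesis by (simp add: thf_term_def)
qed

lemma bij_betw_sum_diff_opposite_parity:
  "bij_betw (\<lambda>(m, n). (m + n + 1, m - n)) UNIV
     ({s :: int. even s} \<times> {d. odd d} \<union> {s. odd s} \<times> {d. even d})"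
    (is "bij_betw ?h UNIV ?A")
proof (rule bij_betwI)
  let ?k = "\<lambda>(s, d). ((s + d - 1) div 2, (s - d - 1) div 2 :: int)"
  show "?h \<in> UNIV \<rightarrow> ?A" by auto
  show "?k \<in> ?A \<rightarrow> UNIV" by simp
  show "?k (?h z) = z" for z by (cases z) auto
  show "?h (?k z) = z" if "z \<in> ?A" for z
  proof -
    obtain s d where z_eq: "z = (s, d)" by (cases z)
    have "even (s + d - 1)" "even (s - d - 1)" using that z_eq by auto
    then obtain i j where "s + d - 1 = 2 * i" "s - d - 1 = 2 * j" by (elim evenE)
    then show ?thesis unfolding z_eq by auto
  qed
qed

text \<open>
  In the double series of the product put \<open>s = m + n + 1\<close> and \<open>d = m - n\<close>, which have opposite
  parities; the summand then factorises.
\<close>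

lemma thf_add_mult_thf_diff:
  assumes "Im \<tau> > 0"
  obtains c and E D :: "complex \<Rightarrow> complex" where
    "\<And>x y. thf \<tau> (x + y) * thf \<tau> (x - y) = c * (D x * E y - E x * D y)"
proof
  define E where "E x = infsum (gauss_term \<tau> x) {s. even s}" for x
  define D where "D x = infsum (gauss_term \<tau> x) {s. odd s}" for x
  define c where "c = exp (- \<i> * of_real pi * \<tau> / 2) / 4"
  have even: "(gauss_term \<tau> x has_sum E x) {s. even s}" for x
    unfolding E_def using gauss_term_summable_on[OF assms] by (rule has_sum_infsum)
  have odd: "(gauss_term \<tau> x has_sum D x) {s. odd s}" for x
    unfolding D_def using gauss_term_summable_on[OF assms] by (rule has_sum_infsum)
  show "thf \<tau> (x + y) * thf \<tau> (x - y) = c * (D x * E y - E x * D y)" for x y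
  proof -
    let ?h = "\<lambda>(m, n). (m + n + 1, m - n :: int)"
    let ?A = "{s :: int. even s} \<times> {d :: int. odd d}"
      and ?B = "{s :: int. odd s} \<times> {d :: int. even d}"
    let ?G = "\<lambda>(s, d). (if even s then - 1 else 1) * c * (gauss_term \<tau> x s * gauss_term \<tau> y d)"
    have "((\<lambda>(m, n). thf_term \<tau> (x + y) m * thf_term \<tau> (x - y) n) has_sum
        thf \<tau> (x + y) * thf \<tau> (x - y)) (UNIV \<times> UNIV)"
      by (intro has_sum_mult_Times thf_has_sum assms)
    then have "((\<lambda>z. ?G (?h z)) has_sum thf \<tau> (x + y) * thf \<tau> (x - y)) UNIV"
      unfolding thf_term_mult c_def[symmetric] by (simp add: case_prod_unfold)
    then have "(?G has_sum thf \<tau> (x + y) * thf \<tau> (x - y)) (?A \<union> ?B)"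
      unfolding has_sum_reindex_bij_betw[OF bij_betw_sum_diff_opposite_parity] .
    moreover have even_odd: "(?G has_sum - c * (E x * D y)) ?A"
      by (rule has_sum_cong[THEN iffD1, OF _
        has_sum_cmult_right[OF has_sum_mult_Times[OF even odd]]])
        auto
    moreover have odd_even: "(?G has_sum c * (D x * E y)) ?B"
      by (rule has_sum_cong[THEN iffD1, OF _
        has_sum_cmult_right[OF has_sum_mult_Times[OF odd even]]])
        auto
    ultimately have "thf \<tau> (x + y) * thf \<tau> (x - y) = - c * (E x * D y) + c * (D x * E y)"
      using has_sum_Un_disjoint[OF even_odd odd_even] has_sum_unique by fastforce
    then show ?thesis by (simp add: algebra_simps)
  qed
qed

lemma thf_three_term:
  assumes "Im \<tau> > 0"
  shows "thf \<tau> (x + y) * thf \<tau> (x - y) * (thf \<tau> (z + w) * thf \<tau> (z - w))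
       - thf \<tau> (x + z) * thf \<tau> (x - z) * (thf \<tau> (y + w) * thf \<tau> (y - w))
       + thf \<tau> (x + w) * thf \<tau> (x - w) * (thf \<tau> (y + z) * thf \<tau> (y - z)) = 0"
proof -
  obtain c E D where
    split: "\<And>x y. thf \<tau> (x + y) * thf \<tau> (x - y) = c * (D x * E y - E x * D y)"
    using thf_add_mult_thf_diff[OF assms] by metis
  show ?thesis unfolding split by (simp add: algebra_simps)
qed

lemma norm_sinh_le: "norm (sinh z) \<le> exp (norm z)" for z :: complex
proof -
  have "norm (exp z - exp (- z)) \<le> norm (exp z) + norm (exp (- z))"
    by (rule norm_triangle_ineq4)
  also have "\<dots> \<le> exp (norm z) + exp (norm z)"
    using norm_exp[of z] norm_exp[of "- z"] by (intro add_mono) (simp_all del: norm_exp_eq_Re)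
  finally show ?thesis by (simp add: sinh_field_def norm_divide)
qed

lemma thf_holomorphic_on:
  assumes "Im \<tau> > 0"
  shows "thf \<tau> holomorphic_on UNIV"
proof (rule holomorphic_uniform_sequence)
  let ?t = "\<lambda>n x. (-1) ^ n * exp (\<i> * of_nat (n * (n + 1)) * of_real pi * \<tau>)
                      * sinh (of_nat (2 * n + 1) * x)"
  show "(\<lambda>x. \<Sum>i<n. ?t i x) holomorphic_on UNIV" for n
    unfolding sinh_field_def by (intro holomorphic_intros) auto
  fix x0 :: complex
  define r where "r = norm x0 + 1"
  define M where
      "M n = exp r * exp (- (pi * Im \<tau>) * real n ^ 2 + (2 * r - pi * Im \<tau>) * real n)" for n
  have "uniform_limit (cball x0 1) (\<lambda>n x. \<Sum>i<n. ?t i x) (\<lambda>x. \<Sum>i. ?t i x) sequentially"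
  proof (rule Weierstrass_m_test)
    show "summable M"
      unfolding M_def using assms by (intro summable_mult summable_exp_quadratic) simp
    fix n x assume "x \<in> cball x0 1"
    then have "norm x \<le> r"
      using norm_triangle_sub[of x x0] by (simp add: r_def dist_norm norm_minus_commute)
    then have "norm (of_nat (2 * n + 1) * x) \<le> real (2 * n + 1) * r"
      unfolding norm_mult norm_of_nat by (intro mult_left_mono) auto
    then have "norm (sinh (of_nat (2 * n + 1) * x)) \<le> exp (real (2 * n + 1) * r)"
      using norm_sinh_le order_trans exp_le_cancel_iff by blast
    moreover have "norm ((-1) ^ n * exp (\<i> * of_nat (n * (n + 1)) * of_real pi * \<tau>)) =
        exp (- (pi * Im \<tau>) * real (n * (n + 1)))"
      by (simp add: norm_mult norm_power algebra_simps)
    ultimately have "norm (?t n x) \<le>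
        exp (- (pi * Im \<tau>) * real (n * (n + 1))) * exp (real (2 * n + 1) * r)"
      by (simp only: norm_mult[of _ "sinh _"]) (rule mult_left_mono, auto)
    also have "\<dots> = M n"
      unfolding M_def by (simp add: power2_eq_square algebra_simps flip: exp_add)
    finally show "norm (?t n x) \<le> M n" .
  qed
  then show "\<exists>d>0. cball x0 d \<subseteq> UNIV \<and>
      uniform_limit (cball x0 d) (\<lambda>n x. \<Sum>i<n. ?t i x) (thf \<tau>) sequentially"
    by (intro exI[of _ 1]) (auto simp: thf_def[abs_def])
qed auto

section \<open>Spins and kets\<close>

definition h :: "bool \<Rightarrow> int" where "h a = (if a then 1 else - 1)"

lemma h_simps [simp]: "h True = 1" "h False = - 1" "h (\<not> a) = - h a"
  by (simp_all add: h_def)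

text \<open>
  The two-dimensional tensor factors are called legs and numbered by natural numbers; the chain
  consists of the legs in a list, and further legs serve as auxiliary spaces. A ket assigns a
  coefficient to every spin configuration.
\<close>

type_synonym ket = "(nat \<Rightarrow> bool) \<Rightarrow> complex"

definition wt :: "nat set \<Rightarrow> (nat \<Rightarrow> bool) \<Rightarrow> int" where
  "wt S \<sigma> = (\<Sum>k\<in>S. h (\<sigma> k))"

lemma wt_insert [simp]: "finite S \<Longrightarrow> k \<notin> S \<Longrightarrow> wt (insert k S) \<sigma> = h (\<sigma> k) + wt S \<sigma>"
  by (simp add: wt_def)

lemma wt_upd [simp]: "k \<notin> S \<Longrightarrow> wt S (\<sigma>(k := b)) = wt S \<sigma>"
  unfolding wt_def by (intro sum.cong) auto

lemma wt_empty [simp]: "wt {} \<sigma> = 0"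
  by (simp add: wt_def)

lemma abs_wt_le: "\<bar>wt S \<sigma>\<bar> \<le> int (card S)"
proof -
  have "\<bar>wt S \<sigma>\<bar> \<le> (\<Sum>k\<in>S. \<bar>h (\<sigma> k)\<bar>)" unfolding wt_def by (rule sum_abs)
  also have "\<dots> = int (card S)" by (simp add: h_def if_distrib[of abs] cong: if_cong)
  finally show ?thesis .
qed

text \<open>A function of this kind commutes with every weight-preserving operator on the legs in \<open>A\<close>.\<close>

definition conserved :: "nat set \<Rightarrow> ket \<Rightarrow> bool" where
  "conserved A F \<longleftrightarrow> (\<forall>\<sigma> \<sigma>'. (\<forall>k. k \<notin> A \<longrightarrow> \<sigma> k = \<sigma>' k) \<longrightarrow> wt A \<sigma> = wt A \<sigma>' \<longrightarrow> F \<sigma> = F \<sigma>')"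

definition swap_legs :: "nat \<Rightarrow> nat \<Rightarrow> (nat \<Rightarrow> bool) \<Rightarrow> nat \<Rightarrow> bool" where
  "swap_legs a b \<sigma> = \<sigma>(a := \<sigma> b, b := \<sigma> a)"

lemma swap_legs_swap_legs [simp]: "swap_legs a b (swap_legs a b \<sigma>) = \<sigma>"
  by (auto simp: swap_legs_def fun_eq_iff)

section \<open>The dynamical R-matrix\<close>

locale sos =
  fixes \<tau> \<gamma> \<theta> \<zeta> :: complex and \<mu> :: "nat \<Rightarrow> complex"
  assumes Im_pos: "Im \<tau> > 0"
begin

abbreviation f :: "complex \<Rightarrow> complex" where "f \<equiv> thf \<tau>"

lemmas f_cong = arg_cong[where f = f]

lemma f_minus [simp]: "f (- x) = - f x"
  using thf_minus[OF Im_pos] .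

lemma f_cong_minus: "x = - y \<Longrightarrow> f x = - f y"
  by simp

text \<open>
  The right-hand sides are free so that an instance can be written with the arguments in any form
  and sign.
\<close>

lemma three_term:
  assumes half_sum: "A + B + C + D = 2 * S"
    and "f A = a" "f B = b" "f C = c" "f D = d"
    and "f S = p1" "f (A + B - S) = p2" "f (A + C - S) = p3" "f (A + D - S) = p4"
    and "f (S - A) = q1" "f (S - B) = q2" "f (S - C) = q3" "f (S - D) = q4"
  shows "a * b * c * d = p1 * p2 * p3 * p4 + q1 * q2 * q3 * q4"
proof -
  have D_eq: "D = 2 * S - A - B - C" using half_sum by algebra
  have flipped: "f (A - S) = - q1"
    using f_cong_minus[of "A - S" "S - A"] assms by simp
  have halves: "(A + B) / 2 + (A - B) / 2 = A" "(A + B) / 2 - (A - B) / 2 = B"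
    "(C + D) / 2 + (C - D) / 2 = C" "(C + D) / 2 - (C - D) / 2 = D"
    "(A + B) / 2 + (C + D) / 2 = S" "(A + B) / 2 - (C + D) / 2 = A + B - S"
    "(A - B) / 2 + (C - D) / 2 = A + C - S" "(A - B) / 2 - (C - D) / 2 = A + D - S"
    "(A + B) / 2 + (C - D) / 2 = S - D" "(A + B) / 2 - (C - D) / 2 = S - C"
    "(A - B) / 2 + (C + D) / 2 = S - B" "(A - B) / 2 - (C + D) / 2 = A - S"
    unfolding D_eq by (simp_all add: field_simps)
  show ?thesis
    using thf_three_term[OF Im_pos, of "(A + B) / 2" "(A - B) / 2" "(C + D) / 2" "(C - D) / 2"]
    unfolding halves assms(2-) flipped by (simp add: algebra_simps)
qed

definition wa :: "complex \<Rightarrow> complex" where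
  "wa x = f (x + \<gamma>)"

definition wb :: "bool \<Rightarrow> complex \<Rightarrow> complex \<Rightarrow> complex" where
  "wb s x t = f x * f (t - of_int (h s) * \<gamma>) / f t"

definition wc :: "bool \<Rightarrow> complex \<Rightarrow> complex \<Rightarrow> complex" where
  "wc s x t = f (t - of_int (h s) * x) * f \<gamma> / f t"

lemma weights:
  "wa x = f (x + \<gamma>)"
  "wb True x t = f x * f (t - \<gamma>) / f t" "wb False x t = f x * f (t + \<gamma>) / f t"
  "wc True x t = f (t - x) * f \<gamma> / f t" "wc False x t = f (t + x) * f \<gamma> / f t"
  by (simp_all add: wa_def wb_def wc_def)

lemma weights_uminus: "wb (\<not> s) x (- t) = wb s x t" "wc (\<not> s) x (- t) = wc s x t"
proof -
  have "f (- t + of_int (h s) * y) = - f (t - of_int (h s) * y)" for y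
    by (rule f_cong_minus) simp
  then show "wb (\<not> s) x (- t) = wb s x t" "wc (\<not> s) x (- t) = wc s x t"
    by (simp_all add: wb_def wc_def)
qed

abbreviation R :: "complex \<Rightarrow> complex \<Rightarrow> bool \<Rightarrow> bool \<Rightarrow> bool \<Rightarrow> bool \<Rightarrow> complex" where
  "R \<equiv> Rent \<tau> \<gamma>"

lemma R_entries:
  "R x t a a a a = wa x"
  "R x t True False True False = wb True x t" "R x t False True False True = wb False x t"
  "R x t True False False True = wc True x t" "R x t False True True False = wc False x t"
  by (cases a) (simp_all add: Rent_def weights)

lemma R_ice: "h a + h b \<noteq> h c + h d \<Longrightarrow> R x t a b c d = 0"
  by (cases a; cases b; cases c; cases d) (simp_all add: Rent_def)

lemma R_flip: "R x (- t) (\<not> a) (\<not> b) (\<not> c) (\<not> d) = R x t a b c d"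
  using weights_uminus[of True x t] weights_uminus[of False x t]
  by (cases a; cases b; cases c; cases d) (simp_all add: R_entries R_ice)

text \<open>
  In the names of the scalar identities \<open>p\<close> and \<open>m\<close> stand for the spins of the outgoing and of the
  incoming legs.
\<close>

lemma ybe_ppm_ppm:
  assumes "f t \<noteq> 0" "f (t - \<gamma>) \<noteq> 0"
  shows "wa u * wb True (u + v) t * wb True v (t - \<gamma>) =
    wb True v t * wb True (u + v) (t - \<gamma>) * wa u"
  using assms by (simp add: weights divide_simps)

lemma ybe_ppm_pmp:
  assumes "f t \<noteq> 0" "f (t - \<gamma>) \<noteq> 0"
  shows "wa u * wb True (u + v) t * wc True v (t - \<gamma>) =
    wc True v t * wa (u + v) * wb True u t
      + wb True v t * wc True (u + v) (t - \<gamma>) * wc False u t"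
proof -
  have "f (u + \<gamma>) * f (u + v) * f (t - \<gamma> - v) * f t
      = f (t + u) * - f (t - \<gamma> - (u + v)) * - f v * f \<gamma>
      + f (t - \<gamma>) * f (t - v) * f (u + v + \<gamma>) * f u"
    by (intro three_term[of "u + \<gamma>" "u + v" "t - \<gamma> - v" "t" "t + u"] f_cong f_cong_minus)
      (simp_all add: algebra_simps)
  then show ?thesis using assms by (simp add: weights divide_simps) algebra
qed

lemma ybe_ppm_mpp:
  assumes "f t \<noteq> 0" "f (t - \<gamma>) \<noteq> 0"
  shows "wa u * wc True (u + v) t * wa v =
    wc True v t * wa (u + v) * wc True u t
      + wb True v t * wc True (u + v) (t - \<gamma>) * wb False u t"
proof -
  have "f (v + \<gamma>) * f (u + \<gamma>) * f (t - (u + v)) * f t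
      = f (t + \<gamma>) * - f (t - \<gamma> - (u + v)) * - f u * f v
      + f (t - v) * f (t - u) * f (u + v + \<gamma>) * f \<gamma>"
    by (intro three_term[of "v + \<gamma>" "u + \<gamma>" "t - (u + v)" "t" "t + \<gamma>"] f_cong f_cong_minus)
      (simp_all add: algebra_simps)
  then show ?thesis using assms by (simp add: weights divide_simps) algebra
qed

lemma ybe_pmp_ppm:
  assumes "f t \<noteq> 0" "f (t - \<gamma>) \<noteq> 0"
  shows "wc True u (t - \<gamma>) * wc False (u + v) t * wb True v (t - \<gamma>)
      + wb True u (t - \<gamma>) * wa (u + v) * wc False v (t - \<gamma>) =
    wc False v t * wb True (u + v) (t - \<gamma>) * wa u"
proof -
  have "f \<gamma> * f v * f (t - \<gamma> - u) * f (t + (u + v))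
      = f (t + v) * - f (t - \<gamma>) * - f (u + v) * f (u + \<gamma>)
      + f (t - \<gamma> + v) * f t * f (u + v + \<gamma>) * - f u"
    by (intro three_term[of "\<gamma>" "v" "t - \<gamma> - u" "t + (u + v)" "t + v"] f_cong f_cong_minus)
      (simp_all add: algebra_simps)
  then show ?thesis using assms by (simp add: weights divide_simps) algebra
qed

lemma ybe_pmp_pmp:
  assumes "f t \<noteq> 0" "f (t - \<gamma>) \<noteq> 0"
  shows "wc True u (t - \<gamma>) * wc False (u + v) t * wc True v (t - \<gamma>)
      + wb True u (t - \<gamma>) * wa (u + v) * wb False v (t - \<gamma>) =
    wb False v t * wa (u + v) * wb True u t
      + wc False v t * wc True (u + v) (t - \<gamma>) * wc False u t"
proof -
  have "f (t - \<gamma> - u) * f (t - \<gamma> - v) * f t * f (t + (u + v))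
      = f (2 * t - \<gamma>) * - f (u + v + \<gamma>) * - f u * f v
      + f (t + u) * f (t + v) * f (t - \<gamma>) * f (t - \<gamma> - (u + v))"
    by (intro three_term[of "t - \<gamma> - u" "t - \<gamma> - v" "t" "t + (u + v)" "2 * t - \<gamma>"]
      f_cong f_cong_minus)
      (simp_all add: algebra_simps)
  moreover have "f (t - \<gamma> - \<gamma>) * f t * f t * f t
      = f (2 * t - \<gamma>) * - f \<gamma> * - f \<gamma> * - f \<gamma>
      + f (t + \<gamma>) * f (t - \<gamma>) * f (t - \<gamma>) * f (t - \<gamma>)"
    by (intro three_term[of "t - \<gamma> - \<gamma>" "t" "t" "t" "2 * t - \<gamma>"] f_cong f_cong_minus)
      (simp_all add: algebra_simps)
  ultimately show ?thesis using assms by (simp add: weights divide_simps) algebra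
qed

lemma ybe_pmp_mpp:
  assumes "f t \<noteq> 0" "f (t - \<gamma>) \<noteq> 0"
  shows "wc True u (t - \<gamma>) * wb False (u + v) t * wa v =
    wb False v t * wa (u + v) * wc True u t
      + wc False v t * wc True (u + v) (t - \<gamma>) * wb False u t"
proof -
  have "f (v + \<gamma>) * f (u + v) * f (t - \<gamma> - u) * f t
      = f (t + v) * - f (t - \<gamma> - (u + v)) * - f u * f \<gamma>
      + f (t - \<gamma>) * f (t - u) * f (u + v + \<gamma>) * f v"
    by (intro three_term[of "v + \<gamma>" "u + v" "t - \<gamma> - u" "t" "t + v"] f_cong f_cong_minus)
      (simp_all add: algebra_simps)
  then show ?thesis using assms by (simp add: weights divide_simps) algebra
qed

lemma ybe_mpp_ppm:
  assumes "f t \<noteq> 0" "f (t - \<gamma>) \<noteq> 0"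
  shows "wb False u (t - \<gamma>) * wc False (u + v) t * wb True v (t - \<gamma>)
      + wc False u (t - \<gamma>) * wa (u + v) * wc False v (t - \<gamma>) =
    wa v * wc False (u + v) (t - \<gamma>) * wa u"
proof -
  have "f v * f u * f (t - \<gamma> - \<gamma>) * f (t + (u + v))
      = f (t - \<gamma> + (u + v)) * - f (t - \<gamma>) * - f (u + \<gamma>) * f (v + \<gamma>)
      + f (t - \<gamma> + u) * f (t - \<gamma> + v) * f (u + v + \<gamma>) * - f \<gamma>"
    by (intro three_term[of "v" "u" "t - \<gamma> - \<gamma>" "t + (u + v)" "t - \<gamma> + (u + v)"]
      f_cong f_cong_minus)
      (simp_all add: algebra_simps)
  then show ?thesis using assms by (simp add: weights divide_simps) algebra
qed

lemma ybe_mpp_pmp: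
  assumes "f t \<noteq> 0" "f (t - \<gamma>) \<noteq> 0"
  shows "wb False u (t - \<gamma>) * wc False (u + v) t * wc True v (t - \<gamma>)
      + wc False u (t - \<gamma>) * wa (u + v) * wb False v (t - \<gamma>) =
    wa v * wb False (u + v) (t - \<gamma>) * wc False u t"
proof -
  have "f \<gamma> * f u * f (t - \<gamma> - v) * f (t + (u + v))
      = f (t + u) * - f (t - \<gamma>) * - f (u + v) * f (v + \<gamma>)
      + f (t - \<gamma> + u) * f t * f (u + v + \<gamma>) * - f v"
    by (intro three_term[of "\<gamma>" "u" "t - \<gamma> - v" "t + (u + v)" "t + u"] f_cong f_cong_minus)
      (simp_all add: algebra_simps)
  then show ?thesis using assms by (simp add: weights divide_simps) algebra
qed

lemma ybe_mpp_mpp: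
  assumes "f t \<noteq> 0" "f (t - \<gamma>) \<noteq> 0"
  shows "wb False u (t - \<gamma>) * wb False (u + v) t * wa v =
    wa v * wb False (u + v) (t - \<gamma>) * wb False u t"
  using assms by (simp add: weights divide_simps)

definition ybe_lhs where
  "ybe_lhs u v t a b c a' b' c' =
    (\<Sum>p\<in>UNIV. \<Sum>q\<in>UNIV. \<Sum>r\<in>UNIV. R u (t - \<gamma> * of_int (h c)) a b p q * R (u + v) t p c a' r *
       R v (t - \<gamma> * of_int (h a')) q r b' c')"

definition ybe_rhs where
  "ybe_rhs u v t a b c a' b' c' =
    (\<Sum>q\<in>UNIV. \<Sum>r\<in>UNIV. \<Sum>p\<in>UNIV. R v t b c q r * R (u + v) (t - \<gamma> * of_int (h q)) a r p c' *
       R u t p q a' b')"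

lemma dynamical_ybe_pos:
  assumes "f t \<noteq> 0" "f (t - \<gamma>) \<noteq> 0" and "h a + h b + h c > 0"
  shows "ybe_lhs u v t a b c a' b' c' = ybe_rhs u v t a b c a' b' c'"
  unfolding ybe_lhs_def ybe_rhs_def using assms(3)
  by (cases a; cases b; cases c; cases a'; cases b'; cases c')
    (simp_all add: UNIV_bool R_entries R_ice ybe_ppm_ppm[OF assms(1,2)] ybe_ppm_pmp[OF assms(1,2)]
      ybe_ppm_mpp[OF assms(1,2)] ybe_pmp_ppm[OF assms(1,2)] ybe_pmp_pmp[OF assms(1,2)]
      ybe_pmp_mpp[OF assms(1,2)] ybe_mpp_ppm[OF assms(1,2)] ybe_mpp_pmp[OF assms(1,2)]
      ybe_mpp_mpp[OF assms(1,2)])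

lemma ybe_flip:
  "ybe_lhs u v (- t) (\<not> a) (\<not> b) (\<not> c) (\<not> a') (\<not> b') (\<not> c') = ybe_lhs u v t a b c a' b' c'"
  "ybe_rhs u v (- t) (\<not> a) (\<not> b) (\<not> c) (\<not> a') (\<not> b') (\<not> c') = ybe_rhs u v t a b c a' b' c'"
proof -
  have sum_Not: "(\<Sum>p\<in>UNIV. F p) = (\<Sum>p\<in>UNIV. F (\<not> p))" for F :: "bool \<Rightarrow> complex"
    by (simp add: UNIV_bool)
  have R_flip_shifted: "R x (- t - \<gamma> * of_int (h (\<not> p))) (\<not> a) (\<not> b) (\<not> c) (\<not> d) =
      R x (t - \<gamma> * of_int (h p)) a b c d" for x p a b c d
    using R_flip[of x "t - \<gamma> * of_int (h p)"] by (simp add: algebra_simps)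
  show "ybe_lhs u v (- t) (\<not> a) (\<not> b) (\<not> c) (\<not> a') (\<not> b') (\<not> c') = ybe_lhs u v t a b c a' b' c'"
    unfolding ybe_lhs_def by (subst (1 2 3) sum_Not) (simp only: R_flip R_flip_shifted)
  show "ybe_rhs u v (- t) (\<not> a) (\<not> b) (\<not> c) (\<not> a') (\<not> b') (\<not> c') = ybe_rhs u v t a b c a' b' c'"
    unfolding ybe_rhs_def by (subst (1 2 3) sum_Not) (simp only: R_flip R_flip_shifted)
qed

theorem dynamical_ybe:
  assumes "f t \<noteq> 0" "f (t - \<gamma>) \<noteq> 0" "f (t + \<gamma>) \<noteq> 0"
  shows "ybe_lhs u v t a b c a' b' c' = ybe_rhs u v t a b c a' b' c'"
proof (cases "h a + h b + h c > 0")
  case True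
  then show ?thesis using dynamical_ybe_pos assms by blast
next
  case False
  then have "h (\<not> a) + h (\<not> b) + h (\<not> c) > 0"
    by (cases a; cases b; cases c) simp_all
  moreover have "f (- t) \<noteq> 0" "f (- t - \<gamma>) \<noteq> 0"
    using assms f_cong_minus[of "- t - \<gamma>" "t + \<gamma>"] by auto
  ultimately show ?thesis
    using dynamical_ybe_pos[of "- t" "\<not> a" "\<not> b" "\<not> c" u v "\<not> a'" "\<not> b'" "\<not> c'"]
    unfolding ybe_flip by blast
qed

lemma unitarity_bb_cc:
  assumes "f t \<noteq> 0"
  shows "wb s x t * wb (\<not> s) (- x) t + wc s x t * wc s (- x) t = f (\<gamma> + x) * f (\<gamma> - x)"
proof -
  have "f x * f x * f (t - \<gamma>) * f (t + \<gamma>)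
      = f (t + x) * - f (t - x) * - f \<gamma> * f \<gamma> + f t * f t * f (\<gamma> + x) * f (x - \<gamma>)"
    by (intro three_term[of x x "t - \<gamma>" "t + \<gamma>" "t + x"] f_cong f_cong_minus)
      (simp_all add: algebra_simps)
  moreover have "f (x - \<gamma>) = - f (\<gamma> - x)"
    by (rule f_cong_minus) simp
  ultimately show ?thesis using assms by (cases s; simp add: weights divide_simps; algebra)
qed

lemma R_unitary:
  assumes "f t \<noteq> 0"
  shows "(\<Sum>p\<in>UNIV. \<Sum>q\<in>UNIV. R x t a b p q * R (- x) t q p b' a') =
    (if a' = a \<and> b' = b then f (\<gamma> + x) * f (\<gamma> - x) else 0)"
proof -
  have "wa x * wa (- x) = f (\<gamma> + x) * f (\<gamma> - x)"
    by (simp add: wa_def algebra_simps)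
  moreover have "wc s x t * wb s (- x) t + wb s x t * wc (\<not> s) (- x) t = 0" for s
    by (simp add: wb_def wc_def algebra_simps)
  note this[of True] this[of False]
  ultimately show ?thesis
    using unitarity_bb_cc[OF assms, of True x] unitarity_bb_cc[OF assms, of False x]
    by (cases a; cases b; cases a'; cases b') (simp_all add: UNIV_bool R_entries R_ice add.commute)
qed

section \<open>The double-row monodromy matrix and the reflection equation\<close>

text \<open>
  The entries of the boundary matrix multiplied by \<open>[\<theta> + \<zeta> + \<lambda>]\<close>, which makes them entire and
  compatible with crossing.
\<close>

definition K_weight :: "complex \<Rightarrow> complex \<Rightarrow> bool \<Rightarrow> complex \<Rightarrow> complex" where
  "K_weight t z s x = f (z + of_int (h s) * x) * f (t + z - of_int (h s) * x)"

lemma K_weight_simps: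
  "K_weight t z True x = f (z + x) * f (t + z - x)"
  "K_weight t z False x = f (z - x) * f (t + z + x)"
  by (simp_all add: K_weight_def)

lemma K_weight_uminus: "K_weight (- t) (- z) (\<not> s) x = K_weight t z s x"
proof -
  have "f (- z - of_int (h s) * x) = - f (z + of_int (h s) * x)"
    "f (- t - z + of_int (h s) * x) = - f (t + z - of_int (h s) * x)"
    by (auto intro!: f_cong_minus)
  then show ?thesis by (simp add: K_weight_def)
qed

abbreviation K :: "bool \<Rightarrow> complex \<Rightarrow> complex" where
  "K \<equiv> K_weight \<theta> \<zeta>"

lemma reflection_pm_mp:
  assumes "f t \<noteq> 0"
  shows "wb True (x - y) t * K_weight t z True x * wc False (x + y) t * K_weight t z True y
      + wc True (x - y) t * K_weight t z False x * wb True (x + y) t * K_weight t z True y =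
    K_weight t z False y * (wb True (x + y) t * K_weight t z True x * wc False (x - y) t
      + wc True (x + y) t * K_weight t z False x * wb True (x - y) t)"
proof -
  have "f (x - y) * f (z + y) * f (t + (x + y)) * f (t + z - y)
      = f (t + z + x) * - f t * - f (z - x) * - f (2 * y)
      + f (t + z + y) * f (t + (x - y)) * f (z - y) * f (x + y)"
    by (intro three_term[of "x - y" "z + y" "t + (x + y)" "t + z - y" "t + z + x"]
      f_cong f_cong_minus)
      (simp_all add: algebra_simps)
  moreover have "f (x + y) * f (z + y) * f (t - (x - y)) * f (t + z - y)
      = f (t + z + y) * - f (t - (x + y)) * - f (z - y) * f (x - y)
      + f (t + z - x) * f t * f (z + x) * f (2 * y)"
    by (intro three_term[of "x + y" "z + y" "t - (x - y)" "t + z - y" "t + z + y"]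
      f_cong f_cong_minus)
      (simp_all add: algebra_simps)
  ultimately show ?thesis
    using assms by (simp add: weights K_weight_simps divide_simps) algebra
qed

lemma reflection_exchange:
  assumes "f t \<noteq> 0"
  shows "wb s (x - y) t * K_weight t z s x * wc (\<not> s) (x + y) t * K_weight t z s y
      + wc s (x - y) t * K_weight t z (\<not> s) x * wb s (x + y) t * K_weight t z s y =
    K_weight t z (\<not> s) y * (wb s (x + y) t * K_weight t z s x * wc (\<not> s) (x - y) t
      + wc s (x + y) t * K_weight t z (\<not> s) x * wb s (x - y) t)"
proof (cases s)
  case True
  then show ?thesis using reflection_pm_mp[OF assms] by simp
next
  case False
  have "f (- t) \<noteq> 0" using assms by simp
  from reflection_pm_mp[OF this, of x y "- z"] show ?thesis
    using False weights_uminus[of False _ t] weights_uminus[of True _ t]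
      K_weight_uminus[of t z False] K_weight_uminus[of t z True] by simp
qed

lemma boundary_reflection:
  assumes "f \<theta> \<noteq> 0"
  shows "(\<Sum>p\<in>UNIV. \<Sum>q\<in>UNIV. R (x - y) \<theta> a b p q * K p x * R (x + y) \<theta> q p d c * K d y) =
    (\<Sum>p\<in>UNIV. \<Sum>q\<in>UNIV. K b y * R (x + y) \<theta> a b p q * K p x * R (x - y) \<theta> q p d c)"
proof -
  have "wb s (x - y) \<theta> * wb (\<not> s) (x + y) \<theta> = wb s (x + y) \<theta> * wb (\<not> s) (x - y) \<theta>" for s
    by (simp add: wb_def)
  note this[of True] this[of False]
  then show ?thesis
    using reflection_exchange[OF assms, of True x y \<zeta>] reflection_exchange[OF assms, of False x y \<zeta>]
    by (cases a; cases b; cases c; cases d)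
      (simp_all add: UNIV_bool R_entries R_ice algebra_simps)
qed

abbreviation dyn :: "nat set \<Rightarrow> (nat \<Rightarrow> bool) \<Rightarrow> complex" where
  "dyn S \<sigma> \<equiv> \<theta> - \<gamma> * of_int (wt S \<sigma>)"

definition nonsingular :: "nat \<Rightarrow> bool" where
  "nonsingular n \<longleftrightarrow> (\<forall>k. \<bar>k\<bar> \<le> int n \<longrightarrow> f (\<theta> + of_int k * \<gamma>) \<noteq> 0)"

lemma nonsingular_mono: "nonsingular n \<Longrightarrow> m \<le> n \<Longrightarrow> nonsingular m"
  by (simp add: nonsingular_def)

lemma nonsingular_dyn:
  assumes "nonsingular n" "int (card S) + \<bar>k\<bar> \<le> int n" "t = dyn S \<sigma> + of_int k * \<gamma>"
  shows "f t \<noteq> 0"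
proof -
  have "t = \<theta> + of_int (k - wt S \<sigma>) * \<gamma>" using assms(3) by (simp add: algebra_simps)
  moreover have "\<bar>k - wt S \<sigma>\<bar> \<le> int n" using assms(2) abs_wt_le[of S \<sigma>] by simp
  ultimately show ?thesis using assms(1) unfolding nonsingular_def by blast
qed

text \<open>The legs in \<open>S\<close> shift the dynamical parameter.\<close>

definition R_leg :: "nat \<Rightarrow> nat \<Rightarrow> nat set \<Rightarrow> complex \<Rightarrow> ket \<Rightarrow> ket" where
  "R_leg i j S x \<Psi> \<sigma> = (\<Sum>p\<in>UNIV. \<Sum>q\<in>UNIV. R x (dyn S \<sigma>) (\<sigma> i) (\<sigma> j) p q * \<Psi> (\<sigma>(i := p, j := q)))"

lemma R_leg_ybe:
  assumes "finite S" "nonsingular (Suc (card S))"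
    and distinct: "i \<noteq> j" "i \<noteq> k" "j \<noteq> k" and "i \<notin> S" "j \<notin> S" "k \<notin> S"
  shows "R_leg i j (insert k S) u (R_leg i k S (u + v) (R_leg j k (insert i S) v \<Psi>)) =
         R_leg j k S v (R_leg i k (insert j S) (u + v) (R_leg i j S u \<Psi>))"
proof (intro ext)
  fix \<sigma>
  define t where "t = dyn S \<sigma>"
  define X where "X a b c = \<Psi> (\<sigma>(i := a, j := b, k := c))" for a b c
  have updates: "\<sigma>(k := c, i := a, j := b) = \<sigma>(i := a, j := b, k := c)" for a b c
    using distinct by (auto simp: fun_eq_iff)
  have shift: "\<theta> - \<gamma> * (of_int (h a) + of_int (wt S \<sigma>)) = t - \<gamma> * of_int (h a)" for a
    by (simp add: t_def algebra_simps)
  have nonzero: "f t \<noteq> 0" "f (t - \<gamma>) \<noteq> 0" "f (t + \<gamma>) \<noteq> 0"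
    using nonsingular_dyn[OF assms(2), of S 0 t \<sigma>]
      nonsingular_dyn[OF assms(2), of S "- 1" "t - \<gamma>" \<sigma>]
      nonsingular_dyn[OF assms(2), of S 1 "t + \<gamma>" \<sigma>] by (simp_all add: t_def)
  have "R_leg i j (insert k S) u (R_leg i k S (u + v) (R_leg j k (insert i S) v \<Psi>)) \<sigma> =
    (\<Sum>p\<in>UNIV. \<Sum>q\<in>UNIV. R u (t - \<gamma> * of_int (h (\<sigma> k))) (\<sigma> i) (\<sigma> j) p q *
       (\<Sum>a\<in>UNIV. \<Sum>r\<in>UNIV. R (u + v) t p (\<sigma> k) a r *
         (\<Sum>b\<in>UNIV. \<Sum>c\<in>UNIV. R v (t - \<gamma> * of_int (h a)) q r b c * X a b c)))"
    using assms by (simp add: R_leg_def updates X_def shift flip: t_def)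
  also have "\<dots> = (\<Sum>a\<in>UNIV. \<Sum>b\<in>UNIV. \<Sum>c\<in>UNIV. ybe_lhs u v t (\<sigma> i) (\<sigma> j) (\<sigma> k) a b c * X a b c)"
    unfolding ybe_lhs_def sum_distrib_left sum_distrib_right sum.cartesian_product
    by (rule sum.reindex_bij_witness[where i = "\<lambda>(a, b, c, p, q, r). (p, q, a, r, b, c)"
          and j = "\<lambda>(p, q, a, r, b, c). (a, b, c, p, q, r)"]) (auto simp: mult.assoc)
  also have "\<dots> = (\<Sum>a\<in>UNIV. \<Sum>b\<in>UNIV. \<Sum>c\<in>UNIV. ybe_rhs u v t (\<sigma> i) (\<sigma> j) (\<sigma> k) a b c * X a b c)"
    unfolding dynamical_ybe[OF nonzero] ..
  also have "\<dots> = (\<Sum>q\<in>UNIV. \<Sum>r\<in>UNIV. R v t (\<sigma> j) (\<sigma> k) q r *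
       (\<Sum>p\<in>UNIV. \<Sum>c\<in>UNIV. R (u + v) (t - \<gamma> * of_int (h q)) (\<sigma> i) r p c *
         (\<Sum>a\<in>UNIV. \<Sum>b\<in>UNIV. R u t p q a b * X a b c)))"
    unfolding ybe_rhs_def sum_distrib_left sum_distrib_right sum.cartesian_product
    by (rule sum.reindex_bij_witness[where i = "\<lambda>(q, r, p, c, a, b). (a, b, c, q, r, p)"
          and j = "\<lambda>(a, b, c, q, r, p). (q, r, p, c, a, b)"]) (auto simp: mult.assoc)
  also have "\<dots> = R_leg j k S v (R_leg i k (insert j S) (u + v) (R_leg i j S u \<Psi>)) \<sigma>"
    using assms by (simp add: R_leg_def updates X_def shift flip: t_def)
  finally show "R_leg i j (insert k S) u (R_leg i k S (u + v) (R_leg j k (insert i S) v \<Psi>)) \<sigma> =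
         R_leg j k S v (R_leg i k (insert j S) (u + v) (R_leg i j S u \<Psi>)) \<sigma>" .
qed

lemma R_leg_unitary:
  assumes "nonsingular (card S)" "i \<noteq> j" "i \<notin> S" "j \<notin> S"
  shows "R_leg i j S x (R_leg j i S (- x) \<Psi>) = (\<lambda>\<sigma>. f (\<gamma> + x) * f (\<gamma> - x) * \<Psi> \<sigma>)"
proof (intro ext)
  fix \<sigma>
  define t where "t = dyn S \<sigma>"
  define X where "X a b = \<Psi> (\<sigma>(i := a, j := b))" for a b
  have updates: "\<sigma>(j := b, i := a) = \<sigma>(i := a, j := b)" for a b
    using assms by (auto simp: fun_eq_iff)
  have nonzero: "f t \<noteq> 0"
    using nonsingular_dyn[OF assms(1), of S 0 t \<sigma>] by (simp add: t_def)
  have "R_leg i j S x (R_leg j i S (- x) \<Psi>) \<sigma> =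
      (\<Sum>p\<in>UNIV. \<Sum>q\<in>UNIV. R x t (\<sigma> i) (\<sigma> j) p q * (\<Sum>b\<in>UNIV. \<Sum>a\<in>UNIV. R (- x) t q p b a * X a b))"
    using assms by (simp add: R_leg_def updates X_def flip: t_def)
  also have "\<dots> = (\<Sum>a\<in>UNIV. \<Sum>b\<in>UNIV.
      (\<Sum>p\<in>UNIV. \<Sum>q\<in>UNIV. R x t (\<sigma> i) (\<sigma> j) p q * R (- x) t q p b a) * X a b)"
    by (simp add: UNIV_bool distrib_left distrib_right mult.assoc add_ac)
  also have "\<dots> = f (\<gamma> + x) * f (\<gamma> - x) * X (\<sigma> i) (\<sigma> j)"
    unfolding R_unitary[OF nonzero] by (cases "\<sigma> i"; cases "\<sigma> j") (simp_all add: UNIV_bool)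
  finally show "R_leg i j S x (R_leg j i S (- x) \<Psi>) \<sigma> = f (\<gamma> + x) * f (\<gamma> - x) * \<Psi> \<sigma>"
    by (simp add: X_def)
qed

lemma R_leg_add: "R_leg i j S x (\<lambda>\<sigma>. \<Psi> \<sigma> + \<Phi> \<sigma>) = (\<lambda>\<sigma>. R_leg i j S x \<Psi> \<sigma> + R_leg i j S x \<Phi> \<sigma>)"
  by (intro ext) (simp add: R_leg_def distrib_left sum.distrib)

lemma R_leg_cmult: "R_leg i j S x (\<lambda>\<sigma>. c * \<Psi> \<sigma>) = (\<lambda>\<sigma>. c * R_leg i j S x \<Psi> \<sigma>)"
  by (intro ext) (simp add: R_leg_def sum_distrib_left mult.left_commute)

lemma R_leg_ybe_inverted:
  assumes "finite S" "nonsingular (Suc (card S))"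
    and "i \<noteq> j" "i \<noteq> k" "j \<noteq> k" "i \<notin> S" "j \<notin> S" "k \<notin> S"
    and "f (\<gamma> + u) \<noteq> 0" "f (\<gamma> - u) \<noteq> 0"
  shows "R_leg k i S u (R_leg j i (insert k S) (u + v) (R_leg j k S v \<Psi>)) =
         R_leg j k (insert i S) v (R_leg j i S (u + v) (R_leg k i (insert j S) u \<Psi>))"
    (is "?lhs = ?rhs")
proof -
  let ?\<Phi> = "R_leg k i (insert j S) u \<Psi>" and ?c = "f (\<gamma> + u) * f (\<gamma> - u)"
  have unitary: "R_leg i k (insert j S) (- u) ?\<Phi> = (\<lambda>\<sigma>. ?c * \<Psi> \<sigma>)"
    using assms R_leg_unitary[of "insert j S" i k "- u" \<Psi>] by (simp add: mult.commute)
  have "R_leg j i (insert k S) (u + v)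
      (R_leg j k S (u + v + - u) (R_leg i k (insert j S) (- u) ?\<Phi>)) =
      R_leg i k S (- u) (R_leg j k (insert i S) (u + v + - u) (R_leg j i S (u + v) ?\<Phi>))"
    using assms by (intro R_leg_ybe) auto
  then have "(\<lambda>\<sigma>. ?c * R_leg j i (insert k S) (u + v) (R_leg j k S v \<Psi>) \<sigma>) = R_leg i k S (- u) ?rhs"
    unfolding unitary by (simp add: R_leg_cmult)
  then have "R_leg k i S u (\<lambda>\<sigma>. ?c * R_leg j i (insert k S) (u + v) (R_leg j k S v \<Psi>) \<sigma>) =
      R_leg k i S u (R_leg i k S (- u) ?rhs)"
    by (rule arg_cong)
  moreover have "R_leg k i S u (R_leg i k S (- u) ?rhs) = (\<lambda>\<sigma>. ?c * ?rhs \<sigma>)"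
    using assms by (intro R_leg_unitary) (auto intro: nonsingular_mono)
  ultimately show ?thesis
    using assms by (simp add: R_leg_cmult fun_eq_iff)
qed

lemma R_leg_conserved:
  assumes conserved: "conserved A F" and legs: "finite A" "i \<in> A" "j \<in> A" "i \<noteq> j"
  shows "R_leg i j S x (\<lambda>\<sigma>. F \<sigma> * \<Psi> \<sigma>) = (\<lambda>\<sigma>. F \<sigma> * R_leg i j S x \<Psi> \<sigma>)"
proof (intro ext)
  fix \<sigma>
  define B where "B = A - {i, j}"
  have A_eq: "A = insert i (insert j B)" "finite B" "i \<notin> B" "j \<notin> B"
    using legs by (auto simp: B_def)
  have "R x t (\<sigma> i) (\<sigma> j) p q * (F (\<sigma>(i := p, j := q)) * y) = F \<sigma> * (R x t (\<sigma> i) (\<sigma> j) p q * y)"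
      for t p q y
  proof (cases "h (\<sigma> i) + h (\<sigma> j) = h p + h q")
    case True
    then have "wt A (\<sigma>(i := p, j := q)) = wt A \<sigma>"
      using legs(4) A_eq by simp
    then have "F (\<sigma>(i := p, j := q)) = F \<sigma>"
      using conserved legs unfolding conserved_def by (metis fun_upd_other)
    then show ?thesis by simp
  qed (simp add: R_ice)
  then show "R_leg i j S x (\<lambda>\<sigma>. F \<sigma> * \<Psi> \<sigma>) \<sigma> = F \<sigma> * R_leg i j S x \<Psi> \<sigma>"
    by (simp only: R_leg_def sum_distrib_left)
qed

lemma R_leg_upd:
  assumes "k \<noteq> i" "k \<noteq> j" "k \<notin> S"
  shows "R_leg i j S x (\<lambda>\<sigma>. \<Psi> (\<sigma>(k := b))) = (\<lambda>\<sigma>. R_leg i j S x \<Psi> (\<sigma>(k := b)))"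
  using assms by (intro ext) (simp add: R_leg_def fun_upd_twist)

fun mon :: "nat list \<Rightarrow> nat \<Rightarrow> complex \<Rightarrow> ket \<Rightarrow> ket" where
  "mon [] a x \<Psi> = (\<lambda>\<sigma>. K (\<sigma> a) x * \<Psi> \<sigma>)"
| "mon (j # js) a x \<Psi> = R_leg a j (set js) (x - \<mu> j) (mon js a x (R_leg j a (set js) (x + \<mu> j) \<Psi>))"

lemma mon_add: "mon js a x (\<lambda>\<sigma>. \<Psi> \<sigma> + \<Phi> \<sigma>) = (\<lambda>\<sigma>. mon js a x \<Psi> \<sigma> + mon js a x \<Phi> \<sigma>)"
  by (induction js arbitrary: \<Psi> \<Phi>) (simp_all add: R_leg_add distrib_left)

lemma mon_conserved:
  assumes "conserved A F" "finite A" "insert a (set js) \<subseteq> A" "a \<notin> set js"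
  shows "mon js a x (\<lambda>\<sigma>. F \<sigma> * \<Psi> \<sigma>) = (\<lambda>\<sigma>. F \<sigma> * mon js a x \<Psi> \<sigma>)"
  using assms
proof (induction js arbitrary: \<Psi>)
  case Nil
  then show ?case by (simp add: mult.left_commute)
next
  case (Cons j js)
  then show ?case by (simp add: R_leg_conserved[OF Cons.prems(1)])
qed

lemma mon_upd:
  assumes "k \<noteq> a" "k \<notin> set js"
  shows "mon js a x (\<lambda>\<sigma>. \<Psi> (\<sigma>(k := b))) = (\<lambda>\<sigma>. mon js a x \<Psi> (\<sigma>(k := b)))"
  using assms by (induction js arbitrary: \<Psi>) (simp_all add: R_leg_upd)

lemma mon_R_leg_commute:
  assumes "a \<notin> set js" "j \<notin> insert a (set js)" "k \<notin> insert a (set js)"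
  shows "mon js a x (R_leg j k (insert a (set js)) y \<Psi>) =
      R_leg j k (insert a (set js)) y (mon js a x \<Psi>)"
proof -
  define F where "F p q \<sigma> = R y (dyn (insert a (set js)) \<sigma>) (\<sigma> j) (\<sigma> k) p q" for p q \<sigma>
  have conserved: "conserved (insert a (set js)) (F p q)" for p q
    using assms by (auto simp: conserved_def F_def)
  have "mon js a x (\<lambda>\<sigma>. \<Sum>p\<in>UNIV. \<Sum>q\<in>UNIV. F p q \<sigma> * \<Psi> (\<sigma>(j := p, k := q))) =
      (\<lambda>\<sigma>. \<Sum>p\<in>UNIV. \<Sum>q\<in>UNIV. F p q \<sigma> * mon js a x \<Psi> (\<sigma>(j := p, k := q)))"
    using assms mon_upd[of j a js x "\<lambda>\<sigma>. \<Psi> (\<sigma>(k := q))" for q] mon_upd[of k a js x \<Psi>]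
    by (simp add: UNIV_bool mon_add mon_conserved[OF conserved])
  then show ?thesis by (simp add: R_leg_def[abs_def] F_def)
qed

definition invertible_at :: "nat list \<Rightarrow> complex \<Rightarrow> bool" where
  "invertible_at js x \<longleftrightarrow> (\<forall>j\<in>set js. f (\<gamma> + (x + \<mu> j)) \<noteq> 0 \<and> f (\<gamma> - (x + \<mu> j)) \<noteq> 0)"

definition refl_lhs :: "nat list \<Rightarrow> nat \<Rightarrow> nat \<Rightarrow> complex \<Rightarrow> complex \<Rightarrow> ket \<Rightarrow> ket" where
  "refl_lhs js a b x y \<Psi> =
    R_leg a b (set js) (x - y) (mon js a x (R_leg b a (set js) (x + y) (mon js b y \<Psi>)))"

definition refl_rhs :: "nat list \<Rightarrow> nat \<Rightarrow> nat \<Rightarrow> complex \<Rightarrow> complex \<Rightarrow> ket \<Rightarrow> ket" where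
  "refl_rhs js a b x y \<Psi> =
    mon js b y (R_leg a b (set js) (x + y) (mon js a x (R_leg b a (set js) (x - y) \<Psi>)))"

lemma reflection_equation_Nil:
  assumes "f \<theta> \<noteq> 0" "a \<noteq> b"
  shows "refl_lhs [] a b x y \<Psi> = refl_rhs [] a b x y \<Psi>"
proof (intro ext)
  fix \<sigma>
  define X where "X c d = \<Psi> (\<sigma>(a := c, b := d))" for c d
  have updates: "\<sigma>(b := d, a := c) = \<sigma>(a := c, b := d)" for c d
    using assms(2) by (auto simp: fun_eq_iff)
  have "refl_lhs [] a b x y \<Psi> \<sigma> = (\<Sum>c\<in>UNIV. \<Sum>d\<in>UNIV. (\<Sum>p\<in>UNIV. \<Sum>q\<in>UNIV.
      R (x - y) \<theta> (\<sigma> a) (\<sigma> b) p q * K p x * R (x + y) \<theta> q p d c * K d y) * X c d)"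
    using assms(2) by (simp add: refl_lhs_def R_leg_def updates X_def UNIV_bool algebra_simps)
  also have "\<dots> = (\<Sum>c\<in>UNIV. \<Sum>d\<in>UNIV. (\<Sum>p\<in>UNIV. \<Sum>q\<in>UNIV.
      K (\<sigma> b) y * R (x + y) \<theta> (\<sigma> a) (\<sigma> b) p q * K p x * R (x - y) \<theta> q p d c) * X c d)"
    unfolding boundary_reflection[OF assms(1)] ..
  also have "\<dots> = refl_rhs [] a b x y \<Psi> \<sigma>"
    using assms(2) by (simp add: refl_rhs_def R_leg_def updates X_def UNIV_bool algebra_simps)
  finally show "refl_lhs [] a b x y \<Psi> \<sigma> = refl_rhs [] a b x y \<Psi> \<sigma>" .
qed

lemma reflection_equation_Cons:
  assumes "nonsingular (Suc (card (set js)))"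
    and "j \<notin> set js" "a \<notin> set js" "b \<notin> set js" "a \<noteq> b" "a \<noteq> j" "b \<noteq> j"
    and "f (\<gamma> + (x + \<mu> j)) \<noteq> 0" "f (\<gamma> - (x + \<mu> j)) \<noteq> 0"
    and "f (\<gamma> + (y + \<mu> j)) \<noteq> 0" "f (\<gamma> - (y + \<mu> j)) \<noteq> 0"
    and shorter_chain: "\<And>\<Phi>. refl_lhs js a b x y \<Phi> = refl_rhs js a b x y \<Phi>"
  shows "refl_lhs (j # js) a b x y \<Psi> = refl_rhs (j # js) a b x y \<Psi>"
proof -
  let ?m = "\<mu> j" and ?S = "set js"
  have "refl_lhs (j # js) a b x y \<Psi> =
    R_leg a b (insert j ?S) (x - y) (R_leg a j ?S (x - ?m) (mon js a x (R_leg j a ?S (x + ?m)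
      (R_leg b a (insert j ?S) (x + y)
        (R_leg b j ?S (y - ?m) (mon js b y (R_leg j b ?S (y + ?m) \<Psi>)))))))"
    by (simp add: refl_lhs_def)
  also have "\<dots> = R_leg a b (insert j ?S) (x - y) (R_leg a j ?S (x - ?m) (mon js a x
      (R_leg b j (insert a ?S) (y - ?m) (R_leg b a ?S (x + y) (R_leg j a (insert b ?S) (x + ?m)
        (mon js b y (R_leg j b ?S (y + ?m) \<Psi>)))))))"
    using R_leg_ybe_inverted[of ?S a b j "x + ?m" "y - ?m"] assms by simp
  also have "\<dots> =
      R_leg a b (insert j ?S) (x - y) (R_leg a j ?S (x - ?m) (R_leg b j (insert a ?S) (y - ?m)
      (mon js a x (R_leg b a ?S (x + y) (mon js b y
        (R_leg j a (insert b ?S) (x + ?m) (R_leg j b ?S (y + ?m) \<Psi>)))))))"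
    using assms by (simp add: mon_R_leg_commute)
  also have "\<dots> = R_leg b j ?S (y - ?m) (R_leg a j (insert b ?S) (x - ?m) (refl_lhs js a b x y
        (R_leg j a (insert b ?S) (x + ?m) (R_leg j b ?S (y + ?m) \<Psi>))))"
    using R_leg_ybe[of ?S a b j "x - y" "y - ?m"] assms by (simp add: refl_lhs_def)
  also have "\<dots> = R_leg b j ?S (y - ?m) (R_leg a j (insert b ?S) (x - ?m) (mon js b y
      (R_leg a b ?S (x + y) (mon js a x (R_leg b a ?S (x - y)
        (R_leg j a (insert b ?S) (x + ?m) (R_leg j b ?S (y + ?m) \<Psi>)))))))"
    unfolding shorter_chain refl_rhs_def ..
  also have "\<dots> = R_leg b j ?S (y - ?m) (R_leg a j (insert b ?S) (x - ?m) (mon js b y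
      (R_leg a b ?S (x + y) (mon js a x (R_leg j b (insert a ?S) (y + ?m)
        (R_leg j a ?S (x + ?m) (R_leg b a (insert j ?S) (x - y) \<Psi>)))))))"
    using R_leg_ybe[of ?S j b a "y + ?m" "x - y"] assms by (simp add: add.commute)
  also have "\<dots> = R_leg b j ?S (y - ?m) (mon js b y (R_leg a j (insert b ?S) (x - ?m)
      (R_leg a b ?S (x + y) (R_leg j b (insert a ?S) (y + ?m)
        (mon js a x (R_leg j a ?S (x + ?m) (R_leg b a (insert j ?S) (x - y) \<Psi>)))))))"
    using assms by (simp add: mon_R_leg_commute)
  also have "\<dots> = R_leg b j ?S (y - ?m) (mon js b y (R_leg j b ?S (y + ?m)
      (R_leg a b (insert j ?S) (x + y) (R_leg a j ?S (x - ?m)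
        (mon js a x (R_leg j a ?S (x + ?m) (R_leg b a (insert j ?S) (x - y) \<Psi>)))))))"
    using R_leg_ybe_inverted[of ?S b a j "y + ?m" "x - ?m"] assms by (simp add: add.commute)
  also have "\<dots> = refl_rhs (j # js) a b x y \<Psi>"
    by (simp add: refl_rhs_def)
  finally show ?thesis .
qed

theorem reflection_equation:
  assumes "nonsingular (length js)" "distinct (a # b # js)" "invertible_at js x"
    "invertible_at js y"
  shows "refl_lhs js a b x y \<Psi> = refl_rhs js a b x y \<Psi>"
  using assms
proof (induction js arbitrary: \<Psi>)
  case Nil
  then show ?case by (intro reflection_equation_Nil) (auto simp: nonsingular_def)
next
  case (Cons j js)
  then have "nonsingular (length js)"
    by (auto intro: nonsingular_mono)
  with Cons show ?case
    by (intro reflection_equation_Cons) (auto simp: distinct_card invertible_at_def)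
qed

section \<open>The dynamical reflection algebra\<close>

lemma mon_zero: "mon js a x (\<lambda>\<sigma>. 0) = (\<lambda>\<sigma>. 0)"
  using mon_add[of js a x "\<lambda>\<sigma>. 0" "\<lambda>\<sigma>. 0"] by (simp add: fun_eq_iff)

definition block :: "nat list \<Rightarrow> nat \<Rightarrow> bool \<Rightarrow> bool \<Rightarrow> complex \<Rightarrow> ket \<Rightarrow> ket" where
  "block js a p q x \<Phi> \<sigma> = mon js a x (\<lambda>\<sigma>'. if \<sigma>' a = q then \<Phi> (\<sigma>'(a := \<sigma> a)) else 0) (\<sigma>(a := p))"

lemma block_add:
  "block js a p q x (\<lambda>\<sigma>. \<Phi> \<sigma> + \<Xi> \<sigma>) = (\<lambda>\<sigma>. block js a p q x \<Phi> \<sigma> + block js a p q x \<Xi> \<sigma>)"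
proof (intro ext)
  fix \<sigma>
  have "(\<lambda>\<sigma>'. if \<sigma>' a = q then \<Phi> (\<sigma>'(a := \<sigma> a)) + \<Xi> (\<sigma>'(a := \<sigma> a)) else 0) =
      (\<lambda>\<sigma>'. (if \<sigma>' a = q then \<Phi> (\<sigma>'(a := \<sigma> a)) else 0) +
        (if \<sigma>' a = q then \<Xi> (\<sigma>'(a := \<sigma> a)) else 0))"
    by auto
  then show "block js a p q x (\<lambda>\<sigma>. \<Phi> \<sigma> + \<Xi> \<sigma>) \<sigma> = block js a p q x \<Phi> \<sigma> + block js a p q x \<Xi> \<sigma>"
    unfolding block_def by (simp only: mon_add)
qed

lemma block_zero: "block js a p q x (\<lambda>\<sigma>. 0) = (\<lambda>\<sigma>. 0)"
  by (intro ext) (simp add: block_def mon_zero cong: if_cong)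

lemma block_sum:
  "block js a p q x (\<lambda>\<sigma>. \<Sum>i\<in>I. \<Phi> i \<sigma>) = (\<lambda>\<sigma>. \<Sum>i\<in>I. block js a p q x (\<Phi> i) \<sigma>)"
  by (induction I rule: infinite_finite_induct) (simp_all add: block_zero block_add)

lemma block_dyn:
  assumes "a \<notin> set js"
  shows "block js a p q x (\<lambda>\<sigma>. F (dyn (set js) \<sigma>) * \<Phi> \<sigma>) \<sigma> =
    F (dyn (set js) \<sigma> - \<gamma> * of_int (h p - h q)) * block js a p q x \<Phi> \<sigma>"
proof -
  define G where "G \<sigma> = F (\<theta> - \<gamma> * of_int (wt (insert a (set js)) \<sigma> - h q))" for \<sigma>
  have conserved: "conserved (insert a (set js)) G"
    unfolding conserved_def G_def by metis
  have "(\<lambda>\<sigma>'. if \<sigma>' a = q then F (dyn (set js) (\<sigma>'(a := \<sigma> a))) * \<Phi> (\<sigma>'(a := \<sigma> a)) else 0) =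
      (\<lambda>\<sigma>'. G \<sigma>' * (if \<sigma>' a = q then \<Phi> (\<sigma>'(a := \<sigma> a)) else 0))"
    using assms by (auto simp: G_def)
  then have "block js a p q x (\<lambda>\<sigma>. F (dyn (set js) \<sigma>) * \<Phi> \<sigma>) \<sigma> =
      G (\<sigma>(a := p)) * block js a p q x \<Phi> \<sigma>"
    unfolding block_def
    by (simp only: mon_conserved[OF conserved _ _ assms] finite_insert finite_set order_refl)
  then show ?thesis using assms by (simp add: G_def algebra_simps)
qed

lemma block_R:
  assumes "a \<notin> set js"
  shows "block js a p q x (\<lambda>\<sigma>. R y (dyn (set js) \<sigma> - s) b c b' c' * \<Phi> \<sigma>) \<sigma> =
      R y (dyn (set js) \<sigma> - \<gamma> * of_int (h p - h q) - s) b c b' c' * block js a p q x \<Phi> \<sigma>"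
    and "block js a p q x (\<lambda>\<sigma>. R y (dyn (set js) \<sigma>) b c b' c' * \<Phi> \<sigma>) \<sigma> =
      R y (dyn (set js) \<sigma> - \<gamma> * of_int (h p - h q)) b c b' c' * block js a p q x \<Phi> \<sigma>"
  using block_dyn[OF assms, where F = "\<lambda>t. R y (t - s) b c b' c'"]
    block_dyn[OF assms, where F = "\<lambda>t. R y t b c b' c'"] by simp_all

lemma block_cmult:
  "a \<notin> set js \<Longrightarrow> block js a p q x (\<lambda>\<sigma>. c * \<Phi> \<sigma>) = (\<lambda>\<sigma>. c * block js a p q x \<Phi> \<sigma>)"
  using block_dyn[where F = "\<lambda>_. c"] by (intro ext) simp

lemma block_diff:
  "a \<notin> set js \<Longrightarrow> block js a p q x (\<lambda>\<sigma>. \<Phi> \<sigma> - \<Xi> \<sigma>) =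
      (\<lambda>\<sigma>. block js a p q x \<Phi> \<sigma> - block js a p q x \<Xi> \<sigma>)"
  using block_add[of js a p q x \<Phi> "\<lambda>\<sigma>. - 1 * \<Xi> \<sigma>"] block_cmult[of a js p q x "- 1" \<Xi>] by simp

lemma block_upd:
  assumes "k \<notin> set js"
  shows "block js a p q x (\<lambda>\<sigma>. \<Phi> (\<sigma>(k := v))) = (\<lambda>\<sigma>. block js a p q x \<Phi> (\<sigma>(k := v)))"
proof (intro ext)
  fix \<sigma>
  show "block js a p q x (\<lambda>\<sigma>. \<Phi> (\<sigma>(k := v))) \<sigma> = block js a p q x \<Phi> (\<sigma>(k := v))"
  proof (cases "k = a")
    case True
    then show ?thesis by (simp add: block_def cong: if_cong)
  next
    case False
    define \<Xi> where "\<Xi> \<sigma>' = (if \<sigma>' a = q then \<Phi> (\<sigma>'(a := \<sigma> a)) else 0)" for \<sigma>'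
    have "block js a p q x \<Phi> (\<sigma>(k := v)) = mon js a x \<Xi> (\<sigma>(a := p, k := v))"
      using False by (simp add: block_def \<Xi>_def[abs_def] fun_upd_twist cong: if_cong)
    also have "\<dots> = mon js a x (\<lambda>\<sigma>'. \<Xi> (\<sigma>'(k := v))) (\<sigma>(a := p))"
      using mon_upd[OF False assms] by simp
    also have "\<dots> = block js a p q x (\<lambda>\<sigma>. \<Phi> (\<sigma>(k := v))) \<sigma>"
      using False by (simp add: block_def \<Xi>_def fun_upd_twist cong: if_cong)
    finally show ?thesis by simp
  qed
qed

lemma block_upd_upd:
  assumes "a \<notin> set js" "b \<notin> set js"
  shows "block js a p q x (\<lambda>\<sigma>. \<Phi> (\<sigma>(a := v, b := w))) =
      (\<lambda>\<sigma>. block js a p q x \<Phi> (\<sigma>(a := v, b := w)))"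
  using block_upd[OF assms(1), of a p q x "\<lambda>\<sigma>. \<Phi> (\<sigma>(b := w))" v]
    block_upd[OF assms(2), of a p q x \<Phi> w] by simp

lemma mon_block:
  "mon js a x \<Psi> (\<sigma>(a := p)) = (\<Sum>q\<in>UNIV. block js a p q x (\<lambda>\<sigma>. \<Psi> (\<sigma>(a := q))) \<sigma>)"
proof -
  define \<Xi> where "\<Xi> q \<sigma>' = (if \<sigma>' a = q then \<Psi> (\<sigma>'(a := \<sigma> a, a := q)) else 0)" for q \<sigma>'
  have "\<Psi> = (\<lambda>\<sigma>'. \<Xi> True \<sigma>' + \<Xi> False \<sigma>')"
    by (intro ext) (auto simp: \<Xi>_def fun_upd_idem)
  then have "mon js a x \<Psi> (\<sigma>(a := p)) =
      mon js a x (\<Xi> True) (\<sigma>(a := p)) + mon js a x (\<Xi> False) (\<sigma>(a := p))"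
    by (simp add: mon_add)
  then show ?thesis by (simp add: block_def UNIV_bool \<Xi>_def[abs_def])
qed

lemma R_leg_swap_legs:
  assumes "j \<notin> {a, b}" "a \<notin> S" "b \<notin> S"
  shows "R_leg b j S x \<Psi> \<sigma> = R_leg a j S x (\<lambda>\<sigma>. \<Psi> (swap_legs a b \<sigma>)) (swap_legs a b \<sigma>)"
    and "R_leg j b S x \<Psi> \<sigma> = R_leg j a S x (\<lambda>\<sigma>. \<Psi> (swap_legs a b \<sigma>)) (swap_legs a b \<sigma>)"
proof -
  have "swap_legs a b ((swap_legs a b \<sigma>)(a := p, j := q)) = \<sigma>(b := p, j := q)"
    "swap_legs a b ((swap_legs a b \<sigma>)(j := q, a := p)) = \<sigma>(j := q, b := p)" for p q
    using assms by (auto simp: swap_legs_def fun_eq_iff)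
  moreover have "wt S (swap_legs a b \<sigma>) = wt S \<sigma>" "swap_legs a b \<sigma> a = \<sigma> b"
      "swap_legs a b \<sigma> j = \<sigma> j"
    using assms by (simp_all add: swap_legs_def)
  ultimately show "R_leg b j S x \<Psi> \<sigma> = R_leg a j S x (\<lambda>\<sigma>. \<Psi> (swap_legs a b \<sigma>)) (swap_legs a b \<sigma>)"
    "R_leg j b S x \<Psi> \<sigma> = R_leg j a S x (\<lambda>\<sigma>. \<Psi> (swap_legs a b \<sigma>)) (swap_legs a b \<sigma>)"
    by (simp_all add: R_leg_def)
qed

lemma mon_swap_legs:
  assumes "a \<notin> set js" "b \<notin> set js"
  shows "mon js b x \<Psi> \<sigma> = mon js a x (\<lambda>\<sigma>. \<Psi> (swap_legs a b \<sigma>)) (swap_legs a b \<sigma>)"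
  using assms
proof (induction js arbitrary: \<Psi> \<sigma>)
  case Nil
  have "swap_legs a b \<sigma> a = \<sigma> b" by (simp add: swap_legs_def)
  then show ?case by simp
next
  case (Cons j js)
  then show ?case
    by (simp add: R_leg_swap_legs[of j a b "set js"])
qed

lemma block_leg_irrelevant:
  assumes "a \<notin> set js" "b \<notin> set js"
  shows "block js b p q x \<Phi> = block js a p q x \<Phi>"
proof (intro ext)
  fix \<sigma>
  show "block js b p q x \<Phi> \<sigma> = block js a p q x \<Phi> \<sigma>"
  proof (cases "a = b")
    case False
    define \<Xi> where "\<Xi> \<sigma>' = (if \<sigma>' a = q then \<Phi> (\<sigma>'(a := \<sigma> a, b := \<sigma> b)) else 0)" for \<sigma>'
    have spectator: "mon js a x \<Psi> (\<sigma>(a := p, b := v)) =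
        mon js a x (\<lambda>\<sigma>'. \<Psi> (\<sigma>'(b := v))) (\<sigma>(a := p))"
      for \<Psi> v
      using mon_upd[of b a js x \<Psi> v] assms False by simp
    have "block js b p q x \<Phi> \<sigma> = mon js a x (\<lambda>\<sigma>'. if swap_legs a b \<sigma>' b = q
        then \<Phi> ((swap_legs a b \<sigma>')(b := \<sigma> b)) else 0) (\<sigma>(a := p, b := \<sigma> a))"
      unfolding block_def mon_swap_legs[OF assms] by (simp add: swap_legs_def fun_upd_twist False)
    also have "\<dots> = mon js a x \<Xi> (\<sigma>(a := p))"
      unfolding spectator using False
      by (simp add: \<Xi>_def[abs_def] swap_legs_def fun_upd_twist cong: if_cong)
    also have "\<dots> = mon js a x (\<lambda>\<sigma>'. if \<sigma>' a = q then \<Phi> (\<sigma>'(a := \<sigma> a)) else 0) (\<sigma>(a := p, b := \<sigma> b))"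
      unfolding spectator using False by (simp add: \<Xi>_def[abs_def] fun_upd_twist cong: if_cong)
    also have "\<dots> = block js a p q x \<Phi> \<sigma>"
      using False by (simp add: block_def fun_upd_idem)
    finally show ?thesis .
  qed simp
qed

lemma R_leg_two_legs:
  assumes "a \<noteq> b" "a \<notin> S" "b \<notin> S"
  shows "R_leg a b S x \<Psi> (\<sigma>(a := p, b := q)) =
      (\<Sum>c\<in>UNIV. \<Sum>d\<in>UNIV. R x (dyn S \<sigma>) p q c d * \<Psi> (\<sigma>(a := c, b := d)))"
    and "R_leg b a S x \<Psi> (\<sigma>(a := p, b := q)) =
      (\<Sum>d\<in>UNIV. \<Sum>c\<in>UNIV. R x (dyn S \<sigma>) q p d c * \<Psi> (\<sigma>(a := c, b := d)))"
  using assms by (simp_all add: R_leg_def fun_upd_twist)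

lemma mon_two_legs:
  assumes "a \<noteq> b" "a \<notin> set js" "b \<notin> set js"
  shows "mon js a x \<Psi> (\<sigma>(a := p, b := q)) =
      (\<Sum>c\<in>UNIV. block js a p c x (\<lambda>\<sigma>. \<Psi> (\<sigma>(a := c, b := q))) \<sigma>)"
    and "mon js b x \<Psi> (\<sigma>(a := p, b := q)) =
      (\<Sum>d\<in>UNIV. block js a q d x (\<lambda>\<sigma>. \<Psi> (\<sigma>(a := p, b := d))) \<sigma>)"
  using assms mon_block[of js b x \<Psi> "\<sigma>(a := p)" q] mon_block[of js a x \<Psi> "\<sigma>(b := q)" p]
    block_upd[of a js b q _ x "\<lambda>\<sigma>. \<Psi> (\<sigma>(b := d))" for d]
    block_upd[of b js a p _ x "\<lambda>\<sigma>. \<Psi> (\<sigma>(a := c))" for c]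
  by (simp_all add: block_leg_irrelevant[of a js b] fun_upd_twist)

theorem reflection_algebra:
  assumes "nonsingular (length js)" "distinct js" "a \<notin> set js" "invertible_at js x"
    "invertible_at js y"
    and "t = dyn (set js) \<sigma>"
  shows "(\<Sum>c\<in>UNIV. \<Sum>d\<in>UNIV. \<Sum>c'\<in>UNIV. \<Sum>d'\<in>UNIV.
      R (x - y) t p q c d * R (x + y) (t - \<gamma> * of_int (h c - h c')) d c' d' i *
      block js a c c' x (block js a d' j y \<Phi>) \<sigma>) =
    (\<Sum>d\<in>UNIV. \<Sum>c\<in>UNIV. \<Sum>d'\<in>UNIV. \<Sum>c'\<in>UNIV.
      R (x + y) (t - \<gamma> * of_int (h q - h d)) p d c d' *
      R (x - y) (t - \<gamma> * of_int (h q - h d) - \<gamma> * of_int (h c - h c')) d' c' j i *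
      block js a q d y (block js a c c' x \<Phi>) \<sigma>)" (is "?lhs = ?rhs")
proof -
  obtain b where "b \<notin> insert a (set js)"
    using ex_new_if_finite[of "insert a (set js)"] by auto
  then have legs: "a \<noteq> b" "a \<notin> set js" "b \<notin> set js" using assms by auto
  define \<Psi> where "\<Psi> \<tau> = (if \<tau> a = i \<and> \<tau> b = j then \<Phi> (\<tau>(a := \<sigma> a, b := \<sigma> b)) else 0)" for \<tau>
  define \<Phi>' where "\<Phi>' \<tau> = \<Phi> (\<tau>(a := \<sigma> a, b := \<sigma> b))" for \<tau>
  have \<Psi>_entry: "block js a r s z (\<lambda>\<tau>. \<Psi> (\<tau>(a := c, b := d))) =
      (\<lambda>\<tau>. if c = i \<and> d = j then block js a r s z \<Phi>' \<tau> else 0)" for r s z c d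
  proof -
    have "\<tau>(a := c, b := d, a := \<sigma> a, b := \<sigma> b) = \<tau>(a := \<sigma> a, b := \<sigma> b)" for \<tau>
      using legs by (auto simp: fun_eq_iff)
    then show ?thesis
      using legs by (cases "c = i \<and> d = j") (auto simp: \<Psi>_def \<Phi>'_def[abs_def] block_zero)
  qed
  have "refl_lhs js a b x y \<Psi> (\<sigma>(a := p, b := q)) = (\<Sum>c\<in>UNIV. \<Sum>d\<in>UNIV. \<Sum>c'\<in>UNIV. \<Sum>d'\<in>UNIV.
      R (x - y) t p q c d * R (x + y) (t - \<gamma> * of_int (h c - h c')) d c' d' i *
      block js a c c' x (block js a d' j y \<Phi>') \<sigma>)"
    unfolding refl_lhs_def assms(6) using legs
    by (simp add: R_leg_two_legs mon_two_legs block_sum block_R sum_distrib_left mult.assoc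
      del: of_int_diff)
      (cases i; cases j; simp add: \<Psi>_entry block_zero UNIV_bool)
  moreover have "refl_rhs js a b x y \<Psi> (\<sigma>(a := p, b := q)) = (\<Sum>d\<in>UNIV. \<Sum>c\<in>UNIV. \<Sum>d'\<in>UNIV. \<Sum>c'\<in>UNIV.
      R (x + y) (t - \<gamma> * of_int (h q - h d)) p d c d' *
      R (x - y) (t - \<gamma> * of_int (h q - h d) - \<gamma> * of_int (h c - h c')) d' c' j i *
      block js a q d y (block js a c c' x \<Phi>') \<sigma>)"
    unfolding refl_rhs_def assms(6) using legs
    by (simp add: R_leg_two_legs mon_two_legs block_sum block_R sum_distrib_left mult.assoc
      del: of_int_diff)
      (cases i; cases j; simp add: \<Psi>_entry block_zero UNIV_bool)
  moreover have "block js a r s z (block js a r' s' z' \<Phi>') \<sigma> =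
      block js a r s z (block js a r' s' z' \<Phi>) \<sigma>"
    for r s z r' s' z'
    using legs by (simp add: \<Phi>'_def[abs_def] block_upd_upd)
  ultimately show ?thesis
    using reflection_equation[of js a b x y \<Psi>] assms legs by simp
qed

section \<open>Crossing\<close>

lemma block_Nil: "block [] a p q x \<Phi> \<sigma> = (if p = q then K p x * \<Phi> \<sigma> else 0)"
  by (simp add: block_def)

definition dress :: "complex \<Rightarrow> complex \<Rightarrow> complex \<Rightarrow> (bool \<Rightarrow> bool \<Rightarrow> bool \<Rightarrow> complex) \<Rightarrow>
    bool \<Rightarrow> bool \<Rightarrow> bool \<Rightarrow> complex" where
  "dress x m t Y s p q = (\<Sum>c\<in>UNIV. \<Sum>u\<in>UNIV. \<Sum>d\<in>UNIV. \<Sum>y\<in>UNIV.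
     R (x - m) t p s c u * R (x + m) (t - \<gamma> * of_int (h c - h d)) u d y q * Y c d y)"

lemma block_Cons:
  assumes "distinct (a # j # js)"
  shows "block (j # js) a p q x \<Phi> \<sigma> =
    dress x (\<mu> j) (dyn (set js) \<sigma>) (\<lambda>c d y. block js a c d x (\<lambda>\<sigma>. \<Phi> (\<sigma>(j := y))) \<sigma>) (\<sigma> j) p q"
proof -
  let ?S = "set js"
  define \<Psi> where "\<Psi> \<sigma>' = (if \<sigma>' a = q then \<Phi> (\<sigma>'(a := \<sigma> a)) else 0)" for \<sigma>'
  have legs: "a \<noteq> j" "a \<notin> ?S" "j \<notin> ?S" using assms by auto
  have spectator: "block js a c d x (\<lambda>\<sigma>'. \<Phi> (\<sigma>'(j := y, a := \<sigma> a))) \<sigma> =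
      block js a c d x (\<lambda>\<sigma>'. \<Phi> (\<sigma>'(j := y))) \<sigma>" for c d y
    using block_upd[of a js a c d x "\<lambda>\<sigma>'. \<Phi> (\<sigma>'(j := y))" "\<sigma> a"] legs by (simp add: fun_upd_twist)
  have "block (j # js) a p q x \<Phi> \<sigma> = R_leg a j ?S (x - \<mu> j)
      (mon js a x (R_leg j a ?S (x + \<mu> j) \<Psi>)) (\<sigma>(a := p, j := \<sigma> j))"
    using legs by (simp add: block_def \<Psi>_def[abs_def] fun_upd_idem)
  also have "\<dots> = (\<Sum>c\<in>UNIV. \<Sum>u\<in>UNIV. R (x - \<mu> j) (dyn ?S \<sigma>) p (\<sigma> j) c u *
      (\<Sum>d\<in>UNIV. block js a c d x (\<lambda>\<sigma>. \<Sum>y\<in>UNIV. \<Sum>b\<in>UNIV.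
        R (x + \<mu> j) (dyn ?S \<sigma>) u d y b * \<Psi> (\<sigma>(a := b, j := y))) \<sigma>))"
    using legs by (simp add: R_leg_two_legs mon_two_legs)
  also have "\<dots> = (\<Sum>c\<in>UNIV. \<Sum>u\<in>UNIV. R (x - \<mu> j) (dyn ?S \<sigma>) p (\<sigma> j) c u *
      (\<Sum>d\<in>UNIV. \<Sum>y\<in>UNIV. R (x + \<mu> j) (dyn ?S \<sigma> - \<gamma> * of_int (h c - h d)) u d y q *
        block js a c d x (\<lambda>\<sigma>'. \<Phi> (\<sigma>'(j := y, a := \<sigma> a))) \<sigma>))"
    using legs
    by (cases q) (simp_all add: \<Psi>_def fun_upd_twist UNIV_bool block_R block_add block_zero
      cong: if_cong)
  also have "\<dots> =
      dress x (\<mu> j) (dyn ?S \<sigma>) (\<lambda>c d y. block js a c d x (\<lambda>\<sigma>. \<Phi> (\<sigma>(j := y))) \<sigma>) (\<sigma> j) p q"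
    unfolding spectator by (simp add: dress_def sum_distrib_left mult.assoc)
  finally show ?thesis .
qed

definition crossed :: "complex \<Rightarrow> complex \<Rightarrow> (bool \<Rightarrow> bool \<Rightarrow> complex) \<Rightarrow> bool \<Rightarrow> bool \<Rightarrow> complex" where
  "crossed x t X p q = (if p = q
     then wb (\<not> p) (2 * x + \<gamma>) t * X (\<not> p) (\<not> p) - wc (\<not> p) (2 * x + \<gamma>) t * X p p
     else - wa (2 * x + \<gamma>) * X p q)"

lemma K_crossing_up:
  assumes "f t \<noteq> 0"
  shows "f (2 * x) * K_weight t z True (- x - \<gamma>) =
    wb False (2 * x + \<gamma>) t * K_weight t z False x - wc False (2 * x + \<gamma>) t * K_weight t z True x"
proof -
  have "f (2 * x) * f (z + (- x - \<gamma>)) * f t * f (t + z - (- x - \<gamma>))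
      = f (t + z + x) * - f (t + \<gamma>) * - f (z - x) * f (2 * x + \<gamma>)
      + f (t + z - x) * f (t + (2 * x + \<gamma>)) * f (z + x) * - f \<gamma>"
    by (intro three_term[of "2 * x" "z + (- x - \<gamma>)" t "t + z - (- x - \<gamma>)" "t + z + x"]
        f_cong f_cong_minus) (simp_all add: algebra_simps)
  then show ?thesis using assms by (simp add: weights K_weight_simps divide_simps) algebra
qed

lemma K_crossing:
  assumes "f t \<noteq> 0"
  shows "f (2 * x) * K_weight t z s (- x - \<gamma>) =
    wb (\<not> s) (2 * x + \<gamma>) t * K_weight t z (\<not> s) x - wc (\<not> s) (2 * x + \<gamma>) t * K_weight t z s x"
proof (cases s)
  case True
  then show ?thesis using K_crossing_up[OF assms] by simp
next
  case False
  have "f (- t) \<noteq> 0" using assms by simp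
  from K_crossing_up[OF this, of x "- z"] show ?thesis
    using False weights_uminus[of True _ t] K_weight_uminus[of t z False]
      K_weight_uminus[of t z True]
    by simp
qed

lemma weights_crossed:
  "wb s (- x - \<gamma>) t = - wb s (x + \<gamma>) t" "wc s (- x - \<gamma>) t = wc (\<not> s) (x + \<gamma>) t"
proof -
  have "f (- x - \<gamma>) = - f (x + \<gamma>)"
    by (rule f_cong_minus) simp
  then show "wb s (- x - \<gamma>) t = - wb s (x + \<gamma>) t"
    by (simp add: wb_def)
  show "wc s (- x - \<gamma>) t = wc (\<not> s) (x + \<gamma>) t"
    by (cases s) (simp_all add: wc_def algebra_simps)
qed

lemma cross_pp_pp:
  assumes "f t \<noteq> 0" "f (t - \<gamma>) \<noteq> 0"
  shows "- (wa (- x - \<gamma>) * wa (- y - \<gamma>) * wc False (x + y + \<gamma>) t) =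
    wb False (x + y + \<gamma>) (t - \<gamma>) * wc False y t * wc False x t
      - wc False (x + y + \<gamma>) (t - \<gamma>) * wa y * wa x"
proof -
  have "f y * f x * f (t - \<gamma>) * f (t + (x + y + \<gamma>))
      = f (t - \<gamma> + (x + y + \<gamma>)) * - f t * - f (x + \<gamma>) * f (y + \<gamma>)
      + f (t + x) * f (t + y) * f (x + y + \<gamma>) * - f \<gamma>"
    by (intro three_term[of "y" "x" "t - \<gamma>" "t + (x + y + \<gamma>)" "t - \<gamma> + (x + y + \<gamma>)"]
      f_cong f_cong_minus)
      (simp_all add: algebra_simps)
  then show ?thesis using assms by (simp add: weights weights_crossed divide_simps) algebra
qed

lemma cross_pp_mm:
  assumes "f t \<noteq> 0" "f (t - \<gamma>) \<noteq> 0"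
  shows "wa (- x - \<gamma>) * wa (- y - \<gamma>) * wb False (x + y + \<gamma>) t =
      wb False (x + y + \<gamma>) (t - \<gamma>) * wb False y t * wb True x t"
  using assms by (simp add: weights weights_crossed divide_simps)

lemma cross_pp_pm:
  assumes "f t \<noteq> 0" "f (t - \<gamma>) \<noteq> 0" "f (t - 2 * \<gamma>) \<noteq> 0"
  shows "- (wa (- x - \<gamma>) * wc True (- y - \<gamma>) (t - 2 * \<gamma>) * wa (x + y + \<gamma>)) =
    wb False (x + y + \<gamma>) (t - \<gamma>) * wc False y t * wa x
      - wc False (x + y + \<gamma>) (t - \<gamma>) * wa y * wc True x (t - 2 * \<gamma>)"
proof -
  have "f x * f (x + y + \<gamma> + \<gamma>) * f (t - \<gamma>) * f (t - 2 * \<gamma> + (y + \<gamma>))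
      = f (t - \<gamma> + (x + y + \<gamma>)) * - f (t - 2 * \<gamma> - x) * - f (y + \<gamma>) * - f \<gamma>
      + f (t + y) * f (t - 2 * \<gamma>) * f (x + y + \<gamma>) * f (x + \<gamma>)"
    by (intro three_term[of "x" "x + y + \<gamma> + \<gamma>" "t - \<gamma>" "t - 2 * \<gamma> + (y + \<gamma>)" "t - \<gamma> + (x + y + \<gamma>)"]
      f_cong f_cong_minus)
      (simp_all add: algebra_simps)
  then show ?thesis using assms by (simp add: weights weights_crossed divide_simps) algebra
qed

lemma cross_pm_pm: "wa (- x - \<gamma>) * wb True (- y - \<gamma>) t = wa y * wb True x t"
  by (simp add: weights weights_crossed)

lemma cross_mp_mp: "wb False (- x - \<gamma>) t * wa (- y - \<gamma>) = wb False y t * wa x"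
  by (simp add: weights weights_crossed)

lemma cross_mp_pp:
  assumes "f t \<noteq> 0"
  shows "wb False (- x - \<gamma>) t * wc True (- y - \<gamma>) t * wb True (x + y + \<gamma>) t
      - wc False (- x - \<gamma>) t * wb False (- y - \<gamma>) t * wc False (x + y + \<gamma>) t =
    - (wa (x + y + \<gamma>) * wc False y t * wb False x t)"
proof -
  have "f (t + (y + \<gamma>)) * f (t - \<gamma>) * f (x + \<gamma>) * f (x + y + \<gamma>)
      = f (t + (x + y + \<gamma>)) * f (t - (x + \<gamma>)) * f \<gamma> * f (y + \<gamma>)
        + f x * f (x + y + \<gamma> + \<gamma>) * f (t + y) * f t"
    by (intro three_term[of "t + (y + \<gamma>)" "t - \<gamma>" "x + \<gamma>" "x + y + \<gamma>" "t + (x + y + \<gamma>)"]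
      f_cong f_cong_minus)
      (simp_all add: algebra_simps)
  then show ?thesis using assms by (simp add: weights weights_crossed divide_simps) algebra
qed

lemma cross_mp_mm:
  assumes "f t \<noteq> 0"
  shows "wc False (- x - \<gamma>) t * wb False (- y - \<gamma>) t * wb False (x + y + \<gamma>) t
      - wb False (- x - \<gamma>) t * wc True (- y - \<gamma>) t * wc True (x + y + \<gamma>) t =
    - (wa (x + y + \<gamma>) * wb False y t * wc True x t)"
proof -
  have "f (t + (y + \<gamma>)) * f (t - (x + y + \<gamma>)) * f \<gamma> * f (x + \<gamma>)
      = f (t + \<gamma>) * f (t - (x + \<gamma>)) * f (y + \<gamma>) * f (x + y + \<gamma>)
        + - f y * f (x + y + \<gamma> + \<gamma>) * f t * f (t - x)"
    by (intro three_term[of "t + (y + \<gamma>)" "t - (x + y + \<gamma>)" "\<gamma>" "x + \<gamma>" "t + \<gamma>"]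
      f_cong f_cong_minus)
      (simp_all add: algebra_simps)
  then show ?thesis using assms by (simp add: weights weights_crossed divide_simps) algebra
qed

lemma cross_mm_pp:
  assumes "f t \<noteq> 0" "f (t - \<gamma>) \<noteq> 0"
  shows "wb False (- x - \<gamma>) t * wb True (- y - \<gamma>) t * wb True (x + y + \<gamma>) t
      - wc False (- x - \<gamma>) t * wc False (- y - \<gamma>) t * wc False (x + y + \<gamma>) t =
    wb True (x + y + \<gamma>) (t - \<gamma>) * wa y * wa x
      - wc True (x + y + \<gamma>) (t - \<gamma>) * wc False y t * wc False x t"
proof -
  have "f (t + \<gamma>) * f (t - \<gamma>) * f (t - \<gamma>) * f (t - \<gamma>)
      = f (2 * t - \<gamma>) * f \<gamma> * f \<gamma> * f \<gamma> + f (t - \<gamma> - \<gamma>) * f t * f t * f t"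
    by (intro three_term[of "t + \<gamma>" "t - \<gamma>" "t - \<gamma>" "t - \<gamma>" "2 * t - \<gamma>"] f_cong f_cong_minus)
      (simp_all add: algebra_simps)
  moreover have "f (t + (x + y + \<gamma>)) * f (t - \<gamma>) * f (t - (y + \<gamma>)) * f (t - (x + \<gamma>))
      = f (2 * t - \<gamma>) * f (x + y + \<gamma>) * f (x + \<gamma>) * f (y + \<gamma>)
        + f (t - \<gamma> - (x + y + \<gamma>)) * f t * f (t + y) * f (t + x)"
    by (intro three_term[of "t + (x + y + \<gamma>)" "t - \<gamma>" "t - (y + \<gamma>)" "t - (x + \<gamma>)" "2 * t - \<gamma>"]
      f_cong f_cong_minus)
      (simp_all add: algebra_simps)
  ultimately show ?thesis using assms by (simp add: weights weights_crossed divide_simps) algebra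
qed

lemma cross_mm_mm:
  assumes "f t \<noteq> 0" "f (t - \<gamma>) \<noteq> 0"
  shows "wc False (- x - \<gamma>) t * wc False (- y - \<gamma>) t * wb False (x + y + \<gamma>) t
      - wb False (- x - \<gamma>) t * wb True (- y - \<gamma>) t * wc True (x + y + \<gamma>) t =
    - (wc True (x + y + \<gamma>) (t - \<gamma>) * wb False y t * wb True x t)"
proof -
  have "f (t - \<gamma>) * f (t - (x + y + \<gamma>)) * f (x + \<gamma>) * f (y + \<gamma>)
      = f t * f (t - \<gamma> - (x + y + \<gamma>)) * f x * f y
        + f \<gamma> * f (x + y + \<gamma>) * f (t - (x + \<gamma>)) * f (t - (y + \<gamma>))"
    by (intro three_term[of "t - \<gamma>" "t - (x + y + \<gamma>)" "x + \<gamma>" "y + \<gamma>" "t"] f_cong f_cong_minus)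
      (simp_all add: algebra_simps)
  then show ?thesis using assms by (simp add: weights weights_crossed divide_simps) algebra
qed

lemma cross_mm_pm:
  assumes "f t \<noteq> 0" "f (t - \<gamma>) \<noteq> 0" "f (t - 2 * \<gamma>) \<noteq> 0"
  shows "- (wc False (- x - \<gamma>) t * wa (- y - \<gamma>) * wa (x + y + \<gamma>)) =
    wb True (x + y + \<gamma>) (t - \<gamma>) * wa y * wc True x (t - 2 * \<gamma>)
      - wc True (x + y + \<gamma>) (t - \<gamma>) * wc False y t * wa x"
proof -
  have "f (t - \<gamma>) * f (t - (x + \<gamma>)) * f y * f (x + y + \<gamma> + \<gamma>)
      = f (t + y) * f (t - \<gamma> - (x + y + \<gamma>)) * - f \<gamma> * f (x + \<gamma>)
        + f (y + \<gamma>) * f (x + y + \<gamma>) * f t * f (t - 2 * \<gamma> - x)"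
    by (intro three_term[of "t - \<gamma>" "t - (x + \<gamma>)" "y" "x + y + \<gamma> + \<gamma>" "t + y"] f_cong f_cong_minus)
      (simp_all add: algebra_simps)
  then show ?thesis using assms by (simp add: weights weights_crossed divide_simps) algebra
qed

lemma dress_crossed_up:
  assumes "f t \<noteq> 0" "f (t - \<gamma>) \<noteq> 0" "f (t - 2 * \<gamma>) \<noteq> 0"
  shows "dress (- x - \<gamma>) m t (\<lambda>c d y. crossed x t (\<lambda>c d. Y c d y) c d) True p q =
    crossed x (t - \<gamma>) (dress x m t Y True) p q"
proof -
  define y z where "y = x + m" and "z = x - m"
  then have arguments: "x + m = y" "x - m = z" "- x - \<gamma> - m = - y - \<gamma>" "- x - \<gamma> + m = - z - \<gamma>"
    "2 * x + \<gamma> = y + z + \<gamma>"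
    by simp_all
  note entries = dress_def crossed_def arguments UNIV_bool R_entries R_ice mult.commute[of \<gamma> 2]
  show ?thesis
  proof (cases p; cases q)
    assume "p" "q"
    then show ?thesis
      using cross_pp_pp[OF assms(1,2), of y z] cross_pp_mm[OF assms(1,2), of y z]
        cross_pp_pm[OF assms, of y z]
      by (simp add: entries) algebra
  next
    assume "p" "\<not> q"
    then show ?thesis
      using cross_pm_pm[of y z "t - 2 * \<gamma>"] by (simp add: entries)
  next
    assume "\<not> p" "q"
    then show ?thesis
      using cross_mp_mp[of y t z] cross_mp_pp[OF assms(1), of y z]
        cross_mp_mm[OF assms(1), of y z]
      by (simp add: entries) algebra
  next
    assume "\<not> p" "\<not> q"
    then show ?thesis
      using cross_mm_pp[OF assms(1,2), of y z]
        cross_mm_mm[OF assms(1,2), of y z] cross_mm_pm[OF assms, of y z]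
      by (simp add: entries) algebra
  qed
qed

lemma dress_flip:
  "dress x m (- t) (\<lambda>c d y. Y (\<not> c) (\<not> d) (\<not> y)) (\<not> s) (\<not> p) (\<not> q) = dress x m t Y s p q"
proof -
  have sum_Not: "(\<Sum>b\<in>UNIV. F b) = (\<Sum>b\<in>UNIV. F (\<not> b))" for F :: "bool \<Rightarrow> complex"
    by (simp add: UNIV_bool)
  have "R z (- t - \<gamma> * of_int (h (\<not> c) - h (\<not> d))) (\<not> a) (\<not> b) (\<not> a') (\<not> b') =
      R z (t - \<gamma> * of_int (h c - h d)) a b a' b'" for z c d a b a' b'
    using R_flip[of z "t - \<gamma> * of_int (h c - h d)"] by (simp add: algebra_simps)
  then show ?thesis
    unfolding dress_def by (subst (1 2 3 4) sum_Not) (simp only: R_flip not_not)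
qed

lemma crossed_flip: "crossed x (- t) (\<lambda>c d. X (\<not> c) (\<not> d)) (\<not> p) (\<not> q) = crossed x t X p q"
  using weights_uminus[of True _ t] weights_uminus[of False _ t]
  by (cases p; cases q) (simp_all add: crossed_def)

lemma dress_crossed:
  assumes "f t \<noteq> 0" "f (t - \<gamma>) \<noteq> 0" "f (t + \<gamma>) \<noteq> 0" "f (t - 2 * \<gamma>) \<noteq> 0" "f (t + 2 * \<gamma>) \<noteq> 0"
  shows "dress (- x - \<gamma>) m t (\<lambda>c d y. crossed x t (\<lambda>c d. Y c d y) c d) s p q =
    crossed x (t - \<gamma> * of_int (h s)) (dress x m t Y s) p q"
proof (cases s)
  case True
  then show ?thesis using dress_crossed_up[OF assms(1,2,4)] by simp
next
  case False
  define Y' where "Y' c d y = Y (\<not> c) (\<not> d) (\<not> y)" for c d y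
  have "f (- t) \<noteq> 0" "f (- t - \<gamma>) \<noteq> 0" "f (- t - 2 * \<gamma>) \<noteq> 0"
    using assms f_cong_minus[of "- t - \<gamma>" "t + \<gamma>"] f_cong_minus[of "- t - 2 * \<gamma>" "t + 2 * \<gamma>"]
    by auto
  then have "dress (- x - \<gamma>) m (- t) (\<lambda>c d y. crossed x (- t) (\<lambda>c d. Y' c d y) c d) True
      (\<not> p) (\<not> q) =
      crossed x (- (t + \<gamma>)) (dress x m (- t) Y' True) (\<not> p) (\<not> q)"
    using dress_crossed_up[of "- t" x m Y'] by simp
  moreover have "crossed x (- t) (\<lambda>c d. Y' c d y) c d = crossed x t (\<lambda>c d. Y c d (\<not> y)) (\<not> c) (\<not> d)"
      for c d y
    using crossed_flip[of x t "\<lambda>c d. Y c d (\<not> y)" "\<not> c" "\<not> d"] by (simp add: Y'_def)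
  moreover have "dress x m (- t) Y' True = (\<lambda>p q. dress x m t Y False (\<not> p) (\<not> q))"
    using dress_flip[of x m t Y False "\<not> p" "\<not> q" for p q] by (simp add: Y'_def[abs_def] fun_eq_iff)
  ultimately show ?thesis
    using False crossed_flip[of x "t + \<gamma>" "dress x m t Y False" p q]
      dress_flip[of "- x - \<gamma>" m t "\<lambda>c d y. crossed x t (\<lambda>c d. Y c d y) c d" False p q] by simp
qed

theorem block_crossing:
  assumes "nonsingular (Suc (length js))" "distinct (a # js)"
  shows "f (2 * x) * block js a p q (- x - \<gamma>) \<Phi> \<sigma> =
    crossed x (dyn (set js) \<sigma>) (\<lambda>p q. block js a p q x \<Phi> \<sigma>) p q"
  using assms
proof (induction js arbitrary: \<Phi> p q)
  case Nil
  then have "f \<theta> \<noteq> 0" unfolding nonsingular_def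
    by (metis abs_0 add.right_neutral mult_zero_left of_int_0 of_nat_0_le_iff)
  then show ?case
    using K_crossing[of \<theta> x \<zeta> p]
    by (auto simp: block_Nil crossed_def left_diff_distrib simp flip: mult.assoc)
next
  case (Cons j js)
  define t where "t = dyn (set js) \<sigma>"
  define Y where "Y c d y = block js a c d x (\<lambda>\<sigma>. \<Phi> (\<sigma>(j := y))) \<sigma>" for c d y
  have nonzero: "f t \<noteq> 0" "f (t - \<gamma>) \<noteq> 0" "f (t + \<gamma>) \<noteq> 0" "f (t - 2 * \<gamma>) \<noteq> 0" "f (t + 2 * \<gamma>) \<noteq> 0"
    using nonsingular_dyn[OF Cons.prems(1), of "set js" 0 t \<sigma>]
      nonsingular_dyn[OF Cons.prems(1), of "set js" "- 1" "t - \<gamma>" \<sigma>]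
      nonsingular_dyn[OF Cons.prems(1), of "set js" 1 "t + \<gamma>" \<sigma>]
      nonsingular_dyn[OF Cons.prems(1), of "set js" "- 2" "t - 2 * \<gamma>" \<sigma>]
      nonsingular_dyn[OF Cons.prems(1), of "set js" 2 "t + 2 * \<gamma>" \<sigma>]
      card_length[of js] by (simp_all add: t_def)
  have "f (2 * x) * block (j # js) a p q (- x - \<gamma>) \<Phi> \<sigma> = dress (- x - \<gamma>) (\<mu> j) t
      (\<lambda>c d y. f (2 * x) * block js a c d (- x - \<gamma>) (\<lambda>\<sigma>. \<Phi> (\<sigma>(j := y))) \<sigma>) (\<sigma> j) p q"
    unfolding block_Cons[OF Cons.prems(2)] t_def[symmetric]
    by (simp add: dress_def sum_distrib_left mult_ac)
  also have "\<dots> = dress (- x - \<gamma>) (\<mu> j) t (\<lambda>c d y. crossed x t (\<lambda>c d. Y c d y) c d) (\<sigma> j) p q"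
    using Cons.IH Cons.prems by (simp add: Y_def t_def nonsingular_mono[OF Cons.prems(1)])
  also have "\<dots> = crossed x (t - \<gamma> * of_int (h (\<sigma> j))) (dress x (\<mu> j) t Y (\<sigma> j)) p q"
    by (rule dress_crossed[OF nonzero])
  also have "\<dots> = crossed x (dyn (set (j # js)) \<sigma>) (\<lambda>p q. block (j # js) a p q x \<Phi> \<sigma>) p q"
    unfolding block_Cons[OF Cons.prems(2)] using Cons.prems(2)
    by (simp add: t_def Y_def[abs_def] algebra_simps)
  finally show ?case .
qed

section \<open>The reference states\<close>

definition vac :: "nat list \<Rightarrow> ket" where
  "vac js \<sigma> = (if \<forall>j\<in>set js. \<sigma> j then 1 else 0)"

definition vac_weight :: "nat list \<Rightarrow> complex \<Rightarrow> complex" where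
  "vac_weight js x = (\<Prod>j\<in>set js. f (x - \<mu> j + \<gamma>) * f (x + \<mu> j + \<gamma>))"

lemma vac_weight_Cons [simp]:
  "j \<notin> set js \<Longrightarrow> vac_weight (j # js) x = wa (x - \<mu> j) * wa (x + \<mu> j) * vac_weight js x"
  by (simp add: vac_weight_def wa_def)

lemma vac_upd: "j \<notin> set js \<Longrightarrow> vac (j # js) (\<sigma>(j := y)) = (if y then vac js \<sigma> else 0)"
  by (auto simp: vac_def)

lemma block_FT_vac: "distinct (a # js) \<Longrightarrow> block js a False True x (vac js) \<sigma> = 0"
proof (induction js)
  case Nil
  then show ?case by (simp add: block_Nil)
next
  case (Cons j js)
  then show ?case
    by (cases "\<sigma> j")
      (simp_all add: block_Cons dress_def vac_upd block_zero UNIV_bool R_entries R_ice)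
qed

lemma block_TT_vac:
  "distinct (a # js) \<Longrightarrow> block js a True True x (vac js) \<sigma> = K True x * vac_weight js x * vac js \<sigma>"
proof (induction js)
  case Nil
  then show ?case by (simp add: block_Nil vac_weight_def)
next
  case (Cons j js)
  then have "vac (j # js) \<sigma> = (if \<sigma> j then vac js \<sigma> else 0)"
    using vac_upd[of j js \<sigma> "\<sigma> j"] by simp
  with Cons show ?case
    by (cases "\<sigma> j")
      (simp_all add: block_Cons dress_def vac_upd block_zero block_FT_vac UNIV_bool R_entries R_ice)
qed

lemma block_FT_down: "distinct (a # js) \<Longrightarrow> \<forall>j\<in>set js. \<not> \<sigma> j \<Longrightarrow> block js a False True x \<Phi> \<sigma> = 0"
proof (induction js arbitrary: \<Phi>)
  case Nil
  then show ?case by (simp add: block_Nil)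
next
  case (Cons j js)
  then show ?case by (simp add: block_Cons dress_def UNIV_bool R_entries R_ice)
qed

lemma block_FF_down:
  "distinct (a # js) \<Longrightarrow> \<forall>j\<in>set js. \<not> \<sigma> j \<Longrightarrow>
    block js a False False x \<Phi> \<sigma> = K False x * vac_weight js x * \<Phi> \<sigma>"
proof (induction js arbitrary: \<Phi>)
  case Nil
  then show ?case by (simp add: block_Nil vac_weight_def)
next
  case (Cons j js)
  then show ?case
    by (simp add: block_Cons dress_def block_FT_down UNIV_bool R_entries R_ice fun_upd_idem)
qed

definition down_eig :: "nat list \<Rightarrow> complex \<Rightarrow> complex" where
  "down_eig js x = (let t = \<theta> + of_nat (length js) * \<gamma> in
     (wc True (2 * x + \<gamma>) t * (K False x * vac_weight js x)
      + f (2 * x) * (K False (- x - \<gamma>) * vac_weight js (- x - \<gamma>))) / wb True (2 * x + \<gamma>) t)"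

lemma block_TT_down:
  assumes "nonsingular (Suc (length js))" "distinct (a # js)" "f (2 * x + \<gamma>) \<noteq> 0"
    and down: "\<forall>j\<in>set js. \<not> \<sigma> j"
  shows "block js a True True x \<Phi> \<sigma> = down_eig js x * \<Phi> \<sigma>"
proof -
  define t where "t = \<theta> + of_nat (length js) * \<gamma>"
  have "wt (set js) \<sigma> = - int (length js)"
    using down assms(2) by (simp add: wt_def distinct_card)
  then have dyn: "dyn (set js) \<sigma> = t" by (simp add: t_def)
  then have "f t \<noteq> 0" "f (t - \<gamma>) \<noteq> 0"
    using nonsingular_dyn[OF assms(1), of "set js" 0 t \<sigma>]
      nonsingular_dyn[OF assms(1), of "set js" "- 1" "t - \<gamma>" \<sigma>]
      card_length[of js] by (simp_all)
  then have "wb True (2 * x + \<gamma>) t \<noteq> 0"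
    using assms(3) by (simp add: weights)
  moreover have "f (2 * x) * block js a False False (- x - \<gamma>) \<Phi> \<sigma> =
      wb True (2 * x + \<gamma>) t * block js a True True x \<Phi> \<sigma>
      - wc True (2 * x + \<gamma>) t * block js a False False x \<Phi> \<sigma>"
    unfolding block_crossing[OF assms(1,2)] dyn by (simp add: crossed_def)
  ultimately show ?thesis
    unfolding block_FF_down[OF assms(2) down] down_eig_def Let_def t_def[symmetric]
    by (simp add: field_simps)
qed

section \<open>Exchange relations and the off-shell Bethe expansion\<close>

definition wanted :: "complex \<Rightarrow> complex \<Rightarrow> complex" where
  "wanted u v = f (v - u + \<gamma>) * f (v + u) / (f (v - u) * f (v + u + \<gamma>))"

definition unwanted :: "complex \<Rightarrow> complex \<Rightarrow> complex \<Rightarrow> complex" where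
  "unwanted e u v = f \<gamma> * f (e + \<gamma> + v - u) / (f (2 * v + \<gamma>) * f (u - v) * f (e + \<gamma>))"

lemma wanted_crossed:
  "wanted (- u - \<gamma>) v = f (u - v + \<gamma>) * f (u + v + 2 * \<gamma>) / (f (u - v) * f (u + v + \<gamma>))"
proof -
  have "f (v - (- u - \<gamma>) + \<gamma>) = f (u + v + 2 * \<gamma>)" "f (v + (- u - \<gamma>)) = - f (u - v + \<gamma>)"
    "f (v - (- u - \<gamma>)) = f (u + v + \<gamma>)" "f (v + (- u - \<gamma>) + \<gamma>) = - f (u - v)"
    by (rule f_cong f_cong_minus; simp)+
  then show ?thesis by (simp add: wanted_def mult.commute)
qed

lemma unwanted_crossed:
  "unwanted e u (- v - \<gamma>) = - (f \<gamma> * f (e - v - u) / (f (2 * v + \<gamma>) * f (v + u + \<gamma>) * f (e + \<gamma>)))"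
proof -
  have "f (e + \<gamma> + (- v - \<gamma>) - u) = f (e - v - u)" "f (2 * (- v - \<gamma>) + \<gamma>) = - f (2 * v + \<gamma>)"
    "f (u - (- v - \<gamma>)) = f (v + u + \<gamma>)"
    by (rule f_cong f_cong_minus; simp)+
  then show ?thesis by (simp add: unwanted_def)
qed

text \<open>
  The two ways of moving \<open>A\<close> past two \<open>B\<close>'s agree: this makes the coefficients of the unwanted terms
  independent of the order in which \<open>A\<close> meets the \<open>B\<close>'s.
\<close>

lemma unwanted_recursion:
  assumes "f (e + \<gamma>) \<noteq> 0" "f e \<noteq> 0" "f (e - \<gamma>) \<noteq> 0" "f (2 * v + \<gamma>) \<noteq> 0"
    "f (v + u + \<gamma>) \<noteq> 0" "f (v + w + \<gamma>) \<noteq> 0" "f (v - w) \<noteq> 0" "f (v - u) \<noteq> 0" "f (u - w) \<noteq> 0"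
    "f (2 * w + \<gamma>) \<noteq> 0"
  shows "wanted u v * unwanted (e - 2 * \<gamma>) u w
      + f (2 * v) * unwanted e u v * unwanted (e - 2 * \<gamma>) v w
      - f (2 * v + 2 * \<gamma>) * unwanted e u (- v - \<gamma>) * unwanted (e - 2 * \<gamma>) (- v - \<gamma>) w =
    unwanted e u w * wanted w v"
proof -
  have signs: "f (u - v) = - f (v - u)" "f (- v - \<gamma> - w) = - f (v + w + \<gamma>)"
    by (rule f_cong_minus; simp)+
  have arguments: "e - 2 * \<gamma> + \<gamma> = e - \<gamma>" "e - \<gamma> + w - (- v - \<gamma>) = e + v + w"
    by simp_all
  have "f (v + w + \<gamma>) * f (v + u) * f (e - \<gamma> + w - u) * f e
      = f (e + v + w) * - f (e - v - u - \<gamma>) * - f (u - w) * f \<gamma>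
      + f (e - \<gamma>) * f (e + w - u) * f (v + u + \<gamma>) * f (v + w)"
    by (intro three_term[of "v + w + \<gamma>" "v + u" "e - \<gamma> + w - u" "e" "e + v + w"]
      f_cong f_cong_minus)
      (simp_all add: algebra_simps)
  moreover have "f (v + w + \<gamma>) * f (2 * v) * f (e - \<gamma> + w - v) * f e
      = f (e + v + w) * - f (e - 2 * v - \<gamma>) * - f (v - w) * f \<gamma>
      + f (e - \<gamma>) * f (e + w - v) * f (2 * v + \<gamma>) * f (v + w)"
    by (intro three_term[of "v + w + \<gamma>" "2 * v" "e - \<gamma> + w - v" "e" "e + v + w"]
      f_cong f_cong_minus)
      (simp_all add: algebra_simps)
  moreover have "f (v - u) * f (2 * v + 2 * \<gamma>) * f (e - v - u) * f e
      = f (e + \<gamma> + v - u) * - f (e - 2 * v - \<gamma>) * - f (v + u + \<gamma>) * - f \<gamma>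
      + f (e + \<gamma>) * f (e - v - u - \<gamma>) * f (2 * v + \<gamma>) * f (v - u + \<gamma>)"
    by (intro three_term[of "v - u" "2 * v + 2 * \<gamma>" "e - v - u" "e" "e + \<gamma> + v - u"]
      f_cong f_cong_minus)
      (simp_all add: algebra_simps)
  moreover have "f (v - u) * f (v - w + \<gamma>) * f (e + \<gamma> + w - u) * f e
      = f (e + \<gamma> + v - u) * - f (e + w - v) * - f (u - w) * - f \<gamma>
      + f (e + \<gamma>) * f (e + w - u) * f (v - w) * f (v - u + \<gamma>)"
    by (intro three_term[of "v - u" "v - w + \<gamma>" "e + \<gamma> + w - u" "e" "e + \<gamma> + v - u"]
      f_cong f_cong_minus)
      (simp_all add: algebra_simps)
  ultimately show ?thesis
    using assms unfolding unwanted_crossed unfolding wanted_def unwanted_def arguments signs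
    by (simp add: divide_simps) algebra
qed

abbreviation blockA :: "nat list \<Rightarrow> nat \<Rightarrow> complex \<Rightarrow> ket \<Rightarrow> ket" where
  "blockA js a \<equiv> block js a True True"

abbreviation blockB :: "nat list \<Rightarrow> nat \<Rightarrow> complex \<Rightarrow> ket \<Rightarrow> ket" where
  "blockB js a \<equiv> block js a True False"

definition regular :: "nat list \<Rightarrow> complex \<Rightarrow> bool" where
  "regular js u \<longleftrightarrow> invertible_at js u \<and> invertible_at js (- u - \<gamma>) \<and>
     f (2 * u) \<noteq> 0 \<and> f (2 * u + \<gamma>) \<noteq> 0 \<and> f (2 * u + 2 * \<gamma>) \<noteq> 0"

definition separated :: "complex \<Rightarrow> complex \<Rightarrow> bool" where
  "separated u v \<longleftrightarrow> f (v - u) \<noteq> 0 \<and> f (v - u + \<gamma>) \<noteq> 0 \<and> f (v - u - \<gamma>) \<noteq> 0 \<and>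
     f (v + u) \<noteq> 0 \<and> f (v + u + \<gamma>) \<noteq> 0 \<and> f (v + u + 2 * \<gamma>) \<noteq> 0"

lemma regular_crossed: "regular js (- u - \<gamma>) \<longleftrightarrow> regular js u"
proof -
  have "f (2 * (- u - \<gamma>)) = - f (2 * u + 2 * \<gamma>)" "f (2 * (- u - \<gamma>) + \<gamma>) = - f (2 * u + \<gamma>)"
    "f (2 * (- u - \<gamma>) + 2 * \<gamma>) = - f (2 * u)" "- (- u - \<gamma>) - \<gamma> = u"
    by (rule f_cong_minus; simp)+ simp
  then show ?thesis by (auto simp: regular_def)
qed

lemma separated_crossed: "separated (- u - \<gamma>) v \<longleftrightarrow> separated u v"
  by (auto simp: separated_def algebra_simps)

lemma separated_sym: "separated u v \<longleftrightarrow> separated v u"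
proof -
  have "f (v - u) = - f (u - v)" "f (v - u + \<gamma>) = - f (u - v - \<gamma>)" "f (v - u - \<gamma>) = - f (u - v + \<gamma>)"
    by (rule f_cong_minus; simp)+
  then show ?thesis by (auto simp: separated_def add.commute)
qed

lemma nonsingular_dyn_minus_2:
  assumes "nonsingular (length js + 3)" "e = dyn (set js) \<sigma> - \<gamma> * 2"
  shows "f (e + \<gamma>) \<noteq> 0" "f e \<noteq> 0" "f (e - \<gamma>) \<noteq> 0"
  using nonsingular_dyn[OF assms(1), of "set js" "- 1" "e + \<gamma>" \<sigma>]
    nonsingular_dyn[OF assms(1), of "set js" "- 2" e \<sigma>]
    nonsingular_dyn[OF assms(1), of "set js" "- 3" "e - \<gamma>" \<sigma>]
    card_length[of js] assms(2) by simp_all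

lemma blockB_commute:
  assumes chain: "nonsingular (length js + 3)" "distinct (a # js)"
    and spectral: "regular js u" "regular js v" "separated u v"
  shows "blockB js a u (blockB js a v \<Phi>) = blockB js a v (blockB js a u \<Phi>)"
proof (intro ext)
  fix \<sigma>
  define e where "e = dyn (set js) \<sigma> - \<gamma> * 2"
  have "f e \<noteq> 0" "f (e - \<gamma>) \<noteq> 0"
    using nonsingular_dyn_minus_2[OF chain(1) e_def] by simp_all
  then have "wa (v - u) * wb True (v + u) e \<noteq> 0"
    using spectral by (simp add: separated_def weights)
  moreover have "wa (v - u) * wb True (v + u) e * blockB js a v (blockB js a u \<Phi>) \<sigma> =
      wa (v - u) * wb True (v + u) e * blockB js a u (blockB js a v \<Phi>) \<sigma>"
    using reflection_algebra[of js a v u "e + \<gamma> * 2" \<sigma> True True False False \<Phi>] assms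
    by (simp add: UNIV_bool R_entries R_ice regular_def e_def nonsingular_mono[OF chain(1)] mult_ac)
  ultimately show "blockB js a u (blockB js a v \<Phi>) \<sigma> = blockB js a v (blockB js a u \<Phi>) \<sigma>"
    by simp
qed

lemma blockA_blockB_reflection:
  assumes "nonsingular (length js)" "distinct (a # js)"
    and "invertible_at js u" "invertible_at js v" and "e = dyn (set js) \<sigma> - \<gamma> * 2"
  shows "wa (v - u) * wb True (v + u) e * blockB js a v (blockA js a u \<Phi>) \<sigma> =
    wb True (v + u) e * wc False (v - u) e * blockB js a u (blockA js a v \<Phi>) \<sigma> +
    wa (v + u) * wb True (v - u) e * blockA js a u (blockB js a v \<Phi>) \<sigma> +
    wc True (v + u) e * wb True (v - u) e * blockB js a u (block js a False False v \<Phi>) \<sigma>"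
  using reflection_algebra[of js a v u "e + \<gamma> * 2" \<sigma> True True False True \<Phi>] assms
  by (simp add: UNIV_bool R_entries R_ice add_ac)

lemma wanted_weights:
  assumes "f e \<noteq> 0" "f (v + u + \<gamma>) \<noteq> 0" "f (v - u) \<noteq> 0"
  shows "wa (v - u) * wb True (v + u) e = wa (v + u) * wb True (v - u) e * wanted u v"
  using assms by (simp add: weights wanted_def divide_simps)

lemma unwanted_crossed_weights:
  assumes "f e \<noteq> 0" "f (e + \<gamma>) \<noteq> 0" "f (2 * v + \<gamma>) \<noteq> 0" "f (v + u + \<gamma>) \<noteq> 0"
  shows "wc True (v + u) e * wb True (v - u) e =
    - (wa (v + u) * wb True (v - u) e * unwanted e u (- v - \<gamma>) * wb False (2 * v + \<gamma>) e)"
proof -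
  have "f (e - (v + u)) = f (e - v - u)" by (rule f_cong) simp
  then show ?thesis using assms by (simp add: weights unwanted_crossed divide_simps)
qed

lemma unwanted_weights:
  assumes "f e \<noteq> 0" "f (e + \<gamma>) \<noteq> 0" "f (2 * v + \<gamma>) \<noteq> 0" "f (v - u) \<noteq> 0"
  shows "wb True (v + u) e * wc False (v - u) e * wb False (2 * v + \<gamma>) e
      + wc True (v + u) e * wb True (v - u) e * wc False (2 * v + \<gamma>) e =
    - (wa (v + u) * wb True (v - u) e * f (2 * v) * unwanted e u v * wb False (2 * v + \<gamma>) e)"
proof -
  have "f (v + u) * f (2 * v + \<gamma>) * f (e + \<gamma>) * f (e + (v - u))
      = f (e + (2 * v + \<gamma>)) * - f (e - (v + u)) * - f (v - u) * - f \<gamma>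
      + f (e + \<gamma> + v - u) * f e * f (2 * v) * f (v + u + \<gamma>)"
    by (intro three_term[of "v + u" "2 * v + \<gamma>" "e + \<gamma>" "e + (v - u)" "e + (2 * v + \<gamma>)"]
        f_cong f_cong_minus) (simp_all add: algebra_simps)
  moreover have "f (u - v) = - f (v - u)" by (rule f_cong_minus) simp
  ultimately show ?thesis
    using assms by (simp add: weights unwanted_def divide_simps) algebra
qed

lemma blockB_blockA_crossed:
  assumes chain: "nonsingular (Suc (length js))" "distinct (a # js)"
    and e_eq: "e = dyn (set js) \<sigma> - \<gamma> * 2"
  shows "f (2 * v) * blockB js a u (blockA js a (- v - \<gamma>) \<Phi>) \<sigma> =
    wb False (2 * v + \<gamma>) e * blockB js a u (block js a False False v \<Phi>) \<sigma>
    - wc False (2 * v + \<gamma>) e * blockB js a u (blockA js a v \<Phi>) \<sigma>"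
proof -
  have outside: "a \<notin> set js" using chain by simp
  have "f (2 * v) * blockB js a u (blockA js a (- v - \<gamma>) \<Phi>) \<sigma> =
      blockB js a u (\<lambda>\<sigma>. f (2 * v) * blockA js a (- v - \<gamma>) \<Phi> \<sigma>) \<sigma>"
    by (simp add: block_cmult[OF outside])
  also have "\<dots> =
      blockB js a u (\<lambda>\<sigma>. wb False (2 * v + \<gamma>) (dyn (set js) \<sigma>) * block js a False False v \<Phi> \<sigma>
        - wc False (2 * v + \<gamma>) (dyn (set js) \<sigma>) * blockA js a v \<Phi> \<sigma>) \<sigma>"
    unfolding block_crossing[OF chain] by (simp add: crossed_def)
  also have "\<dots> = wb False (2 * v + \<gamma>) e * blockB js a u (block js a False False v \<Phi>) \<sigma>
      - wc False (2 * v + \<gamma>) e * blockB js a u (blockA js a v \<Phi>) \<sigma>"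
    using block_dyn[OF outside, where p = True and q = False and F = "wb False (2 * v + \<gamma>)"]
      block_dyn[OF outside, where p = True and q = False and F = "wc False (2 * v + \<gamma>)"]
    by (simp add: block_diff[OF outside] e_eq)
  finally show ?thesis .
qed

lemma blockA_blockB_exchange:
  assumes chain: "nonsingular (length js + 3)" "distinct (a # js)"
    and spectral: "regular js u" "regular js v" "separated u v"
    and e_eq: "e = dyn (set js) \<sigma> - \<gamma> * 2"
  shows "blockA js a u (blockB js a v \<Phi>) \<sigma> = wanted u v * blockB js a v (blockA js a u \<Phi>) \<sigma>
    + f (2 * v) * (unwanted e u v * blockB js a u (blockA js a v \<Phi>) \<sigma>
      + unwanted e u (- v - \<gamma>) * blockB js a u (blockA js a (- v - \<gamma>) \<Phi>) \<sigma>)"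
proof -
  define c where "c = wa (v + u) * wb True (v - u) e"
  let ?b = "wb False (2 * v + \<gamma>) e"
  have nonzero: "f e \<noteq> 0" "f (e - \<gamma>) \<noteq> 0" "f (e + \<gamma>) \<noteq> 0"
      "f (2 * v + \<gamma>) \<noteq> 0" "f (v - u) \<noteq> 0" "f (v + u + \<gamma>) \<noteq> 0"
    using nonsingular_dyn_minus_2[OF chain(1) e_eq] spectral
    by (simp_all add: regular_def separated_def)
  have "wa (v - u) * wb True (v + u) e = c * wanted u v"
    "wc True (v + u) e * wb True (v - u) e = - (c * unwanted e u (- v - \<gamma>) * ?b)"
    "wb True (v + u) e * wc False (v - u) e * ?b
        + wc True (v + u) e * wb True (v - u) e * wc False (2 * v + \<gamma>) e =
      - (c * f (2 * v) * unwanted e u v * ?b)"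
    unfolding c_def using nonzero
    by (intro wanted_weights unwanted_crossed_weights unwanted_weights; simp)+
  moreover have "f (2 * v) * blockB js a u (blockA js a (- v - \<gamma>) \<Phi>) \<sigma> =
      ?b * blockB js a u (block js a False False v \<Phi>) \<sigma>
        - wc False (2 * v + \<gamma>) e * blockB js a u (blockA js a v \<Phi>) \<sigma>"
    using chain nonsingular_mono[OF chain(1)] e_eq by (intro blockB_blockA_crossed) auto
  moreover have "wa (v - u) * wb True (v + u) e * blockB js a v (blockA js a u \<Phi>) \<sigma> =
      wb True (v + u) e * wc False (v - u) e * blockB js a u (blockA js a v \<Phi>) \<sigma> +
      c * blockA js a u (blockB js a v \<Phi>) \<sigma> +
      wc True (v + u) e * wb True (v - u) e * blockB js a u (block js a False False v \<Phi>) \<sigma>"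
    unfolding c_def using chain nonsingular_mono[OF chain(1)] spectral e_eq
    by (intro blockA_blockB_reflection) (auto simp: regular_def)
  ultimately have "c * ?b * blockA js a u (blockB js a v \<Phi>) \<sigma> =
      c * ?b * (wanted u v * blockB js a v (blockA js a u \<Phi>) \<sigma>
        + f (2 * v) * (unwanted e u v * blockB js a u (blockA js a v \<Phi>) \<sigma>
          + unwanted e u (- v - \<gamma>) * blockB js a u (blockA js a (- v - \<gamma>) \<Phi>) \<sigma>))"
    by algebra
  moreover have "c * ?b \<noteq> 0"
    using nonzero by (simp add: c_def weights)
  ultimately show ?thesis by simp
qed

definition bethe_coef :: "(complex \<Rightarrow> complex) \<Rightarrow> complex \<Rightarrow> complex \<Rightarrow> complex \<Rightarrow> complex list \<Rightarrow>
    complex" where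
  "bethe_coef \<Lambda> e u w ws = f (2 * w) *
     (unwanted e u w * (\<Lambda> w * prod_list (map (wanted w) ws))
      + unwanted e u (- w - \<gamma>) * (\<Lambda> (- w - \<gamma>) * prod_list (map (wanted (- w - \<gamma>)) ws)))"

lemma bethe_coef_Cons:
  assumes "f (e + \<gamma>) \<noteq> 0" "f e \<noteq> 0" "f (e - \<gamma>) \<noteq> 0"
    and "regular js v" "regular js w" "separated u v" "separated u w" "separated v w"
  shows "wanted u v * bethe_coef \<Lambda> (e - 2 * \<gamma>) u w ws
      + f (2 * v) * unwanted e u v * bethe_coef \<Lambda> (e - 2 * \<gamma>) v w ws
      - f (2 * v + 2 * \<gamma>) * unwanted e u (- v - \<gamma>) * bethe_coef \<Lambda> (e - 2 * \<gamma>) (- v - \<gamma>) w ws =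
    bethe_coef \<Lambda> e u w (v # ws)"
proof -
  have recursion: "wanted u v * unwanted (e - 2 * \<gamma>) u x
      + f (2 * v) * unwanted e u v * unwanted (e - 2 * \<gamma>) v x
      - f (2 * v + 2 * \<gamma>) * unwanted e u (- v - \<gamma>) * unwanted (e - 2 * \<gamma>) (- v - \<gamma>) x =
    unwanted e u x * wanted x v" if "regular js x" "separated x u" "separated x v" for x
    using that assms separated_sym[of u v]
    by (intro unwanted_recursion) (auto simp: regular_def separated_def add.commute)
  have "regular js w" "separated w u" "separated w v"
    and "regular js (- w - \<gamma>)" "separated (- w - \<gamma>) u" "separated (- w - \<gamma>) v"
    using assms by (simp_all add: regular_crossed separated_crossed separated_sym[of w])
  note recursion[OF this(1-3)] recursion[OF this(4-6)]
  then show ?thesis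
    unfolding bethe_coef_def list.map prod_list.Cons by algebra
qed

lemma blockB_linear:
  assumes "a \<notin> set js"
  shows "blockB js a y (\<lambda>\<sigma>. c * S \<sigma> + (\<Sum>k\<in>I. C k (dyn (set js) \<sigma>) * T k \<sigma>)) \<sigma> =
    c * blockB js a y S \<sigma> + (\<Sum>k\<in>I. C k (dyn (set js) \<sigma> - \<gamma> * 2) * blockB js a y (T k) \<sigma>)"
  using block_dyn[OF assms, of True False y "C k" "T k" \<sigma> for k]
  by (simp add: block_add block_cmult[OF assms] block_sum)

lemma blockB_blockB_crossed:
  assumes "nonsingular (Suc (length js))" "distinct (a # js)"
  shows "f (2 * v) * blockB js a u (blockB js a (- v - \<gamma>) \<Phi>) \<sigma> =
    - f (2 * v + 2 * \<gamma>) * blockB js a u (blockB js a v \<Phi>) \<sigma>"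
proof -
  have outside: "a \<notin> set js" using assms by simp
  have "f (2 * v) * blockB js a u (blockB js a (- v - \<gamma>) \<Phi>) \<sigma> =
      blockB js a u (\<lambda>\<sigma>. f (2 * v) * blockB js a (- v - \<gamma>) \<Phi> \<sigma>) \<sigma>"
    by (simp add: block_cmult[OF outside])
  also have "\<dots> = blockB js a u (\<lambda>\<sigma>. - f (2 * v + 2 * \<gamma>) * blockB js a v \<Phi> \<sigma>) \<sigma>"
    unfolding block_crossing[OF assms] by (simp add: crossed_def wa_def add.assoc)
  also have "\<dots> = - f (2 * v + 2 * \<gamma>) * blockB js a u (blockB js a v \<Phi>) \<sigma>"
    by (simp only: block_cmult[OF outside])
  finally show ?thesis .
qed

lemma blockA_expansion_step:
  assumes chain: "nonsingular (length js + 3)" "distinct (a # js)"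
    and spectral: "regular js u" "regular js v" "separated u v"
    and expansion: "\<And>x \<tau>. x \<in> {u, v, - v - \<gamma>} \<Longrightarrow> blockA js a x S \<tau> =
      P x * S \<tau> + (\<Sum>k\<in>I. C x k (dyn (set js) \<tau> - \<gamma> * 2) * blockB js a x (T k) \<tau>)"
    and e_eq: "e = dyn (set js) \<sigma> - \<gamma> * 2"
  shows "blockA js a u (blockB js a v S) \<sigma> = wanted u v * P u * blockB js a v S \<sigma>
    + f (2 * v) * (unwanted e u v * P v + unwanted e u (- v - \<gamma>) * P (- v - \<gamma>)) * blockB js a u S \<sigma>
    + (\<Sum>k\<in>I. (wanted u v * C u k (e - \<gamma> * 2) + f (2 * v) * unwanted e u v * C v k (e - \<gamma> * 2)
        - f (2 * v + 2 * \<gamma>) * unwanted e u (- v - \<gamma>) * C (- v - \<gamma>) k (e - \<gamma> * 2))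
      * blockB js a u (blockB js a v (T k)) \<sigma>)"
proof -
  define Y where "Y k = blockB js a u (blockB js a v (T k)) \<sigma>" for k
  define Q where "Q x = (\<Sum>k\<in>I. C x k (e - \<gamma> * 2) * Y k)" for x
  have swap: "blockB js a v (blockB js a u (T k)) \<sigma> = Y k" for k
    unfolding Y_def using blockB_commute[OF chain spectral] by simp
  have cross: "f (2 * v) * blockB js a u (blockB js a (- v - \<gamma>) (T k)) \<sigma> =
      - f (2 * v + 2 * \<gamma>) * Y k" for k
    unfolding Y_def using chain by (intro blockB_blockB_crossed) (auto intro: nonsingular_mono)
  have push: "blockB js a y (blockA js a x S) \<sigma> =
      P x * blockB js a y S \<sigma> + (\<Sum>k\<in>I. C x k (e - \<gamma> * 2) * blockB js a y (blockB js a x (T k)) \<sigma>)"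
    if "x \<in> {u, v, - v - \<gamma>}" for x y
  proof -
    have "blockA js a x S = (\<lambda>\<tau>. P x * S \<tau> +
        (\<Sum>k\<in>I. C x k (dyn (set js) \<tau> - \<gamma> * 2) * blockB js a x (T k) \<tau>))"
      using expansion[OF that] by blast
    then show ?thesis
      using chain(2) blockB_linear[where C = "\<lambda>k t. C x k (t - \<gamma> * 2)"] by (simp add: e_eq)
  qed
  have "blockB js a v (blockA js a u S) \<sigma> = P u * blockB js a v S \<sigma> + Q u"
    "blockB js a u (blockA js a v S) \<sigma> = P v * blockB js a u S \<sigma> + Q v"
    by (simp_all add: push swap Q_def flip: Y_def)
  moreover have "f (2 * v) * blockB js a u (blockA js a (- v - \<gamma>) S) \<sigma> =
      f (2 * v) * P (- v - \<gamma>) * blockB js a u S \<sigma> - f (2 * v + 2 * \<gamma>) * Q (- v - \<gamma>)"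
    by (simp add: push Q_def distrib_left sum_distrib_left mult.left_commute[of "f (2 * v)"] cross
      sum_negf)
      (simp add: mult.left_commute)
  moreover have "blockA js a u (blockB js a v S) \<sigma> = wanted u v * blockB js a v (blockA js a u S) \<sigma>
    + f (2 * v) * (unwanted e u v * blockB js a u (blockA js a v S) \<sigma>
      + unwanted e u (- v - \<gamma>) * blockB js a u (blockA js a (- v - \<gamma>) S) \<sigma>)"
    using chain spectral e_eq by (rule blockA_blockB_exchange)
  ultimately have "blockA js a u (blockB js a v S) \<sigma> = wanted u v * P u * blockB js a v S \<sigma>
    + f (2 * v) * (unwanted e u v * P v + unwanted e u (- v - \<gamma>) * P (- v - \<gamma>)) * blockB js a u S \<sigma>
    + (wanted u v * Q u + f (2 * v) * unwanted e u v * Q v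
        - f (2 * v + 2 * \<gamma>) * unwanted e u (- v - \<gamma>) * Q (- v - \<gamma>))"
    by algebra
  then show ?thesis
    by (simp add: Q_def Y_def sum_distrib_left sum.distrib sum_subtractf left_diff_distrib
      distrib_right mult.assoc)
qed

theorem bethe_expansion:
  fixes lam :: "'i \<Rightarrow> complex"
  assumes eig: "\<And>x \<sigma>. blockA js a x \<Phi> \<sigma> = \<Lambda> x * \<Phi> \<sigma>"
    and chain: "nonsingular (length js + 3)" "distinct (a # js)"
    and "distinct is" "sorted_wrt separated (u # map lam is)"
      "\<forall>v\<in>set (u # map lam is). regular js v"
  shows "blockA js a u (foldr (blockB js a) (map lam is) \<Phi>) \<sigma> =
    \<Lambda> u * prod_list (map (wanted u) (map lam is)) * foldr (blockB js a) (map lam is) \<Phi> \<sigma>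
    + (\<Sum>k\<in>set is. bethe_coef \<Lambda> (dyn (set js) \<sigma> - \<gamma> * 2) u (lam k) (map lam (remove1 k is))
        * blockB js a u (foldr (blockB js a) (map lam (remove1 k is)) \<Phi>) \<sigma>)"
  using assms(4-)
proof (induction "is" arbitrary: u \<sigma>)
  case Nil
  then show ?case by (simp add: eig)
next
  case (Cons i "is")
  define v where "v = lam i"
  define e where "e = dyn (set js) \<sigma> - \<gamma> * 2"
  let ?S = "\<lambda>is. foldr (blockB js a) (map lam is) \<Phi>"
  let ?C = "\<lambda>x k e. bethe_coef \<Lambda> e x (lam k) (map lam (remove1 k is))"
  let ?P = "\<lambda>x. \<Lambda> x * prod_list (map (wanted x) (map lam is))"
  let ?Y = "\<lambda>k. blockB js a u (blockB js a v (?S (remove1 k is))) \<sigma>"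
  have spectral: "regular js u" "regular js v" "separated u v"
    and others: "\<And>k. k \<in> set is \<Longrightarrow> regular js (lam k) \<and> separated u (lam k) \<and> separated v (lam k)"
    using Cons.prems by (auto simp: v_def)
  have "blockA js a x (?S is) \<tau> = ?P x * ?S is \<tau> +
      (\<Sum>k\<in>set is. ?C x k (dyn (set js) \<tau> - \<gamma> * 2) * blockB js a x (?S (remove1 k is)) \<tau>)"
    if "x \<in> {u, v, - v - \<gamma>}" for x \<tau>
    using that Cons.prems others spectral
    by (intro Cons.IH) (auto simp: regular_crossed separated_crossed)
  then have "blockA js a u (blockB js a v (?S is)) \<sigma> = wanted u v * ?P u * blockB js a v (?S is) \<sigma>
    + f (2 * v) * (unwanted e u v * ?P v + unwanted e u (- v - \<gamma>) * ?P (- v - \<gamma>)) *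
      blockB js a u (?S is) \<sigma>
    + (\<Sum>k\<in>set is. (wanted u v * ?C u k (e - \<gamma> * 2) + f (2 * v) * unwanted e u v * ?C v k (e - \<gamma> * 2)
        - f (2 * v + 2 * \<gamma>) * unwanted e u (- v - \<gamma>) * ?C (- v - \<gamma>) k (e - \<gamma> * 2)) * ?Y k)"
    by (intro blockA_expansion_step chain spectral e_def)
  also have "\<dots> = wanted u v * ?P u * blockB js a v (?S is) \<sigma>
    + bethe_coef \<Lambda> e u v (map lam is) * blockB js a u (?S is) \<sigma>
    + (\<Sum>k\<in>set is. bethe_coef \<Lambda> e u (lam k) (v # map lam (remove1 k is)) * ?Y k)"
    using others
      bethe_coef_Cons[OF nonsingular_dyn_minus_2[OF chain(1) e_def] spectral(2) _ spectral(3)]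
    by (simp add: mult.commute[of \<gamma> 2] bethe_coef_def[of _ _ _ v])
  also have "(\<Sum>k\<in>set is. bethe_coef \<Lambda> e u (lam k) (v # map lam (remove1 k is)) * ?Y k) =
      (\<Sum>k\<in>set is.
        bethe_coef \<Lambda> e u (lam k) (map lam (remove1 k (i # is))) *
          blockB js a u (?S (remove1 k (i # is))) \<sigma>)"
    using Cons.prems(1) by (intro sum.cong) (auto simp: v_def)
  finally show ?case
    using Cons.prems(1) by (simp add: v_def e_def algebra_simps)
qed

abbreviation up_eig :: "nat list \<Rightarrow> complex \<Rightarrow> complex" where
  "up_eig js x \<equiv> K True x * vac_weight js x"

definition partition_ket :: "nat list \<Rightarrow> nat \<Rightarrow> complex list \<Rightarrow> ket" where
  "partition_ket js a vs = foldr (blockB js a) vs (vac js)"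

theorem functional_relation:
  fixes lam :: "'i \<Rightarrow> complex"
  assumes "nonsingular (length js + 3)" "distinct (a # js)" "\<forall>j\<in>set js. \<not> \<sigma> j"
    and "distinct is" "sorted_wrt separated (u # map lam is)"
      "\<forall>v\<in>set (u # map lam is). regular js v"
  shows "(down_eig js u - up_eig js u * prod_list (map (wanted u) (map lam is))) *
      partition_ket js a (map lam is) \<sigma>
    = (\<Sum>k\<in>set is.
      bethe_coef (up_eig js) (\<theta> + (of_nat (length js) - 2) * \<gamma>) u (lam k) (map lam (remove1 k is))
        * partition_ket js a (u # map lam (remove1 k is)) \<sigma>)"
proof -
  have "wt (set js) \<sigma> = - int (length js)"
    using assms(2,3) by (simp add: wt_def distinct_card)
  then have e: "dyn (set js) \<sigma> - \<gamma> * 2 = \<theta> + (of_nat (length js) - 2) * \<gamma>"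
    by (simp add: algebra_simps)
  have "blockA js a u (partition_ket js a (map lam is)) \<sigma> =
      down_eig js u * partition_ket js a (map lam is) \<sigma>"
    using assms by (intro block_TT_down) (auto simp: regular_def intro: nonsingular_mono)
  moreover have "blockA js a x (vac js) \<sigma> = up_eig js x * vac js \<sigma>" for x \<sigma>
    using assms(2) by (rule block_TT_vac)
  ultimately show ?thesis
    using bethe_expansion[of js a "vac js" "up_eig js" "is" u lam \<sigma>] assms unfolding e
    by (simp add: partition_ket_def left_diff_distrib)
qed

end

section \<open>Matrices and operators on kets\<close>

definition fop_apply :: "nat \<Rightarrow> fop \<Rightarrow> (bool \<times> bool list \<Rightarrow> complex) \<Rightarrow> bool \<times> bool list \<Rightarrow>
    complex" where
  "fop_apply L Op \<psi> s = (\<Sum>s'\<in>fstates L. Op s s' * \<psi> s')"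

definition ket_of :: "nat \<Rightarrow> (bool \<times> bool list \<Rightarrow> complex) \<Rightarrow> ket" where
  "ket_of L \<psi> \<sigma> = \<psi> (\<sigma> 0, map \<sigma> [1..<Suc L])"

definition represents :: "nat \<Rightarrow> fop \<Rightarrow> (ket \<Rightarrow> ket) \<Rightarrow> bool" where
  "represents L Op F \<longleftrightarrow> (\<forall>\<psi>. ket_of L (fop_apply L Op \<psi>) = F (ket_of L \<psi>))"

lemma finite_fstates: "finite (fstates L)"
  using finite_lists_length_eq[of "UNIV :: bool set" L] by (simp add: fstates_def)

lemma represents_opid: "represents L opid (\<lambda>\<Psi>. \<Psi>)"
proof -
  have "fop_apply L opid \<psi> s = \<psi> s" if "s \<in> fstates L" for \<psi> s
    using that finite_fstates
    by (simp add: fop_apply_def opid_def if_distrib[of "\<lambda>c. c * _"] cong: if_cong)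
  then show ?thesis
    by (simp add: represents_def ket_of_def fun_eq_iff fstates_def)
qed

lemma represents_opmul:
  assumes "represents L O1 F1" "represents L O2 F2"
  shows "represents L (opmul L O1 O2) (F1 \<circ> F2)"
proof -
  have "fop_apply L (opmul L O1 O2) \<psi> s = fop_apply L O1 (fop_apply L O2 \<psi>) s" for \<psi> s
    unfolding fop_apply_def opmul_def sum_distrib_left sum_distrib_right
    by (subst sum.swap) (simp add: mult.assoc)
  then have "fop_apply L (opmul L O1 O2) \<psi> = fop_apply L O1 (fop_apply L O2 \<psi>)" for \<psi>
    by (rule ext)
  then show ?thesis using assms by (simp add: represents_def)
qed

lemma represents_foldr:
  assumes "\<And>j. j \<in> set js \<Longrightarrow> represents L (A j) (F j)"
  shows "represents L (foldr (opmul L) (map A js) opid) (foldr F js)"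
  using assms
proof (induction js)
  case Nil
  then show ?case using represents_opid by simp
next
  case (Cons j js)
  then show ?case using represents_opmul[of L "A j" "F j"] by (simp add: o_def)
qed

lemma map_upd_sites:
  assumes "1 \<le> j" "j \<le> L"
  shows "map (\<sigma>(j := y)) [1..<Suc L] = (map \<sigma> [1..<Suc L])[j - 1 := y]"
  using assms by (intro nth_equalityI) (auto simp: nth_list_update simp del: upt_Suc)

lemma sum_fstates_site:
  fixes G :: "bool \<times> bool list \<Rightarrow> complex"
  assumes xs: "length xs = L" "i < L"
    and zero: "\<And>b ys. length ys = L \<Longrightarrow> \<not> (\<forall>k<L. k \<noteq> i \<longrightarrow> xs ! k = ys ! k) \<Longrightarrow> G (b, ys) = 0"
  shows "(\<Sum>s\<in>fstates L. G s) = (\<Sum>b\<in>UNIV. \<Sum>y\<in>UNIV. G (b, xs[i := y]))"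
proof -
  let ?g = "\<lambda>(b, y). (b, xs[i := y])"
  have "G s = 0" if "s \<in> fstates L - range ?g" for s
  proof -
    obtain b ys where s_eq: "s = (b, ys)" "length ys = L" using \<open>s \<in> _\<close> by (auto simp: fstates_def)
    have "ys = xs[i := ys ! i]" if "\<forall>k<L. k \<noteq> i \<longrightarrow> xs ! k = ys ! k"
      using that s_eq xs by (intro nth_equalityI) (auto simp: nth_list_update)
    then show ?thesis
      using zero[of ys b] s_eq \<open>s \<in> _\<close> by (metis (no_types, lifting) DiffD2 case_prod_conv rangeI)
  qed
  then have "(\<Sum>s\<in>fstates L. G s) = (\<Sum>s\<in>range ?g. G s)"
    using finite_fstates xs by (intro sum.mono_neutral_right) (auto simp: fstates_def)
  also have "\<dots> = (\<Sum>z\<in>UNIV. G (?g z))"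
  proof -
    have "inj ?g"
    proof (rule injI)
      fix z z' assume "?g z = ?g z'"
      then have "fst z = fst z'" "xs[i := snd z] ! i = xs[i := snd z'] ! i"
        by (simp_all add: case_prod_unfold)
      then show "z = z'" using xs by (simp add: prod_eq_iff)
    qed
    then show ?thesis by (subst sum.reindex) (simp_all add: o_def)
  qed
  also have "\<dots> = (\<Sum>b\<in>UNIV. \<Sum>y\<in>UNIV. G (b, xs[i := y]))"
    by (simp add: sum.cartesian_product case_prod_unfold)
  finally show ?thesis .
qed

context sos
begin

lemma spin_sum_sites:
  assumes "1 \<le> j"
  shows "spin_sum (map \<sigma> [1..<Suc L]) j = of_int (wt {Suc j..<Suc L} \<sigma>)"
proof -
  have "spin_sum (map \<sigma> [1..<Suc L]) j = (\<Sum>k\<in>{j..<L}. of_int (h (\<sigma> (Suc k))))"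
    unfolding spin_sum_def by (intro sum.cong) (auto simp: h_def nth_append simp del: upt_Suc)
  then show ?thesis
    by (simp only: wt_def of_int_sum sum.shift_bounds_Suc_ivl)
qed

lemma represents_R_leg:
  assumes j: "1 \<le> j" "j \<le> L"
  shows "represents L (R0j L \<tau> \<gamma> x \<theta> j) (R_leg 0 j {Suc j..<Suc L} x)"
    and "represents L (Rj0 L \<tau> \<gamma> x \<theta> j) (R_leg j 0 {Suc j..<Suc L} x)"
proof -
  have "ket_of L (fop_apply L (R0j L \<tau> \<gamma> x \<theta> j) \<psi>) \<sigma> = R_leg 0 j {Suc j..<Suc L} x (ket_of L \<psi>) \<sigma> \<and>
    ket_of L (fop_apply L (Rj0 L \<tau> \<gamma> x \<theta> j) \<psi>) \<sigma> =
      R_leg j 0 {Suc j..<Suc L} x (ket_of L \<psi>) \<sigma>" for \<psi> \<sigma>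
  proof -
    let ?xs = "map \<sigma> [1..<Suc L]"
    have sites: "length ?xs = L" "j - 1 < L" "?xs ! (j - 1) = \<sigma> j"
      using j by (simp_all del: upt_Suc)
    have upd: "ket_of L \<psi> (\<sigma>(0 := b, j := y)) = \<psi> (b, ?xs[j - 1 := y])" for b y
    proof -
      have "map (\<sigma>(0 := b)) [1..<Suc L] = ?xs" by simp
      then show ?thesis using j map_upd_sites[OF j, of "\<sigma>(0 := b)"]
        by (simp add: ket_of_def del: upt_Suc)
    qed
    have spins: "spin_sum (?xs[j - 1 := y]) j = of_int (wt {Suc j..<Suc L} \<sigma>)" for y
      unfolding map_upd_sites[OF j, symmetric] spin_sum_sites[OF j(1)] by simp
    have "ket_of L (fop_apply L (R0j L \<tau> \<gamma> x \<theta> j) \<psi>) \<sigma> = (\<Sum>b\<in>UNIV. \<Sum>y\<in>UNIV.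
        R0j L \<tau> \<gamma> x \<theta> j (\<sigma> 0, ?xs) (b, ?xs[j - 1 := y]) * \<psi> (b, ?xs[j - 1 := y]))"
      unfolding ket_of_def fop_apply_def
      by (rule sum_fstates_site[OF sites(1,2)]) (auto simp: R0j_def)
    moreover have "ket_of L (fop_apply L (Rj0 L \<tau> \<gamma> x \<theta> j) \<psi>) \<sigma> = (\<Sum>b\<in>UNIV. \<Sum>y\<in>UNIV.
        Rj0 L \<tau> \<gamma> x \<theta> j (\<sigma> 0, ?xs) (b, ?xs[j - 1 := y]) * \<psi> (b, ?xs[j - 1 := y]))"
      unfolding ket_of_def fop_apply_def
      by (rule sum_fstates_site[OF sites(1,2)]) (auto simp: Rj0_def)
    ultimately show ?thesis
      using sites upd spins j
      by (simp add: R0j_def Rj0_def R_leg_def fun_upd_twist[of j 0] UNIV_bool del: upt_Suc)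
  qed
  then show "represents L (R0j L \<tau> \<gamma> x \<theta> j) (R_leg 0 j {Suc j..<Suc L} x)"
    "represents L (Rj0 L \<tau> \<gamma> x \<theta> j) (R_leg j 0 {Suc j..<Suc L} x)"
    by (simp_all add: represents_def fun_eq_iff)
qed

lemma represents_Kop:
  assumes "f (\<theta> + \<zeta> + x) \<noteq> 0"
  shows "represents L (Kop \<tau> \<zeta> x \<theta>) (\<lambda>\<Psi> \<sigma>. K (\<sigma> 0) x * \<Psi> \<sigma> / f (\<theta> + \<zeta> + x))"
proof -
  have "fop_apply L (Kop \<tau> \<zeta> x \<theta>) \<psi> s = K (fst s) x * \<psi> s / f (\<theta> + \<zeta> + x)"
      if "s \<in> fstates L" for \<psi> s
  proof -
    have "fop_apply L (Kop \<tau> \<zeta> x \<theta>) \<psi> s =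
        (\<Sum>s'\<in>fstates L. if s' = s then Kop \<tau> \<zeta> x \<theta> s s * \<psi> s else 0)"
      unfolding fop_apply_def by (intro sum.cong) (auto simp: Kop_def split: prod.splits)
    then show ?thesis
      using assms that finite_fstates by (simp add: Kop_def K_weight_simps case_prod_unfold)
  qed
  then show ?thesis by (simp add: represents_def ket_of_def fstates_def fun_eq_iff)
qed

lemma foldr_R_leg_eq_mon:
  assumes "k \<le> Suc L"
  shows "foldr (\<lambda>j. R_leg 0 j {Suc j..<Suc L} (x - \<mu> j)) [k..<Suc L] (\<lambda>\<sigma>. K (\<sigma> 0) x *
      foldr (\<lambda>j. R_leg j 0 {Suc j..<Suc L} (x + \<mu> j)) (rev [k..<Suc L]) \<Psi> \<sigma> / c) =
    (\<lambda>\<sigma>. mon [k..<Suc L] 0 x \<Psi> \<sigma> / c)"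
  using assms
proof (induction k arbitrary: \<Psi> rule: inc_induct)
  case base
  show ?case by simp
next
  case (step k)
  have "[k..<Suc L] = k # [Suc k..<Suc L]" using step.hyps by (simp add: upt_conv_Cons del: upt_Suc)
  moreover have "R_leg 0 k S y (\<lambda>\<sigma>. \<Phi> \<sigma> / c) = (\<lambda>\<sigma>. R_leg 0 k S y \<Phi> \<sigma> / c)" for S y \<Phi>
    using R_leg_cmult[of 0 k S y "1 / c" \<Phi>] by simp
  ultimately show ?case
    using step.IH by (simp del: upt_Suc)
qed

lemma represents_dmon:
  assumes "f (\<theta> + \<zeta> + x) \<noteq> 0"
  shows "represents L (dmon L \<tau> \<gamma> \<theta> \<zeta> \<mu> x) (\<lambda>\<Psi> \<sigma>. mon [1..<Suc L] 0 x \<Psi> \<sigma> / f (\<theta> + \<zeta> + x))"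
proof -
  let ?F = "\<lambda>j. R_leg 0 j {Suc j..<Suc L} (x - \<mu> j)"
    and ?G = "\<lambda>j. R_leg j 0 {Suc j..<Suc L} (x + \<mu> j)"
  have "represents L (Tmon L \<tau> \<gamma> \<mu> x \<theta>) (foldr ?F [1..<Suc L])"
    unfolding Tmon_def by (intro represents_foldr represents_R_leg) auto
  moreover have "represents L (Tbar L \<tau> \<gamma> \<mu> x \<theta>) (foldr ?G (rev [1..<Suc L]))"
    unfolding Tbar_def by (intro represents_foldr represents_R_leg) auto
  ultimately have "represents L (dmon L \<tau> \<gamma> \<theta> \<zeta> \<mu> x) (foldr ?F [1..<Suc L] \<circ>
      ((\<lambda>\<Psi> \<sigma>. K (\<sigma> 0) x * \<Psi> \<sigma> / f (\<theta> + \<zeta> + x)) \<circ> foldr ?G (rev [1..<Suc L])))"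
    unfolding dmon_def by (intro represents_opmul represents_Kop assms)
  then show ?thesis
    using foldr_R_leg_eq_mon[of 1 L x] by (simp add: o_def del: upt_Suc)
qed

lemma sum_Bop_eq_blockB:
  assumes "f (\<theta> + \<zeta> + x) \<noteq> 0"
  shows "f (\<theta> + \<zeta> + x) *
      (\<Sum>zs\<in>{zs. length zs = L}. Bop L \<tau> \<gamma> \<theta> \<zeta> \<mu> x (map \<sigma> [1..<Suc L]) zs * \<phi> zs) =
    blockB [1..<Suc L] 0 x (\<lambda>\<sigma>. \<phi> (map \<sigma> [1..<Suc L])) \<sigma>"
proof -
  define \<psi> where "\<psi> = (\<lambda>(b, zs). if b = False then \<phi> zs else 0)"
  have ket: "ket_of L \<psi> = (\<lambda>\<sigma>'. if \<sigma>' 0 = False then \<phi> (map (\<sigma>'(0 := \<sigma> 0)) [1..<Suc L]) else 0)"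
    by (simp add: ket_of_def[abs_def] \<psi>_def del: upt_Suc cong: if_cong)
  have "(\<Sum>zs\<in>{zs. length zs = L}. Bop L \<tau> \<gamma> \<theta> \<zeta> \<mu> x (map \<sigma> [1..<Suc L]) zs * \<phi> zs) =
      ket_of L (fop_apply L (dmon L \<tau> \<gamma> \<theta> \<zeta> \<mu> x) \<psi>) (\<sigma>(0 := True))"
    unfolding ket_of_def fop_apply_def fstates_def sum.cartesian_product'
    by (simp add: UNIV_bool Bop_def \<psi>_def del: upt_Suc)
  also have "\<dots> = mon [1..<Suc L] 0 x (ket_of L \<psi>) (\<sigma>(0 := True)) / f (\<theta> + \<zeta> + x)"
    using represents_dmon[OF assms] by (simp only: represents_def)
  also have "\<dots> = blockB [1..<Suc L] 0 x (\<lambda>\<sigma>. \<phi> (map \<sigma> [1..<Suc L])) \<sigma> / f (\<theta> + \<zeta> + x)"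
    unfolding ket block_def ..
  finally show ?thesis using assms by simp
qed

lemma Zpf_eq_partition_ket:
  assumes "\<forall>x\<in>set xs. f (\<theta> + \<zeta> + x) \<noteq> 0"
  shows "(\<Prod>x\<leftarrow>xs. f (\<theta> + \<zeta> + x)) * Zpf L \<tau> \<gamma> \<theta> \<zeta> \<mu> xs = partition_ket [1..<Suc L] 0 xs (\<lambda>_. False)"
proof -
  define z where "z xs zs = foldr (wmul L) (map (Bop L \<tau> \<gamma> \<theta> \<zeta> \<mu>) xs) wid zs (replicate L True)"
      for xs zs
  have "(\<lambda>\<sigma>. (\<Prod>x\<leftarrow>xs. f (\<theta> + \<zeta> + x)) * z xs (map \<sigma> [1..<Suc L])) = partition_ket [1..<Suc L] 0 xs"
    using assms
  proof (induction xs)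
    case Nil
    have "map \<sigma> js = replicate (length js) True \<longleftrightarrow> (\<forall>j\<in>set js. \<sigma> j)" for \<sigma> :: "nat \<Rightarrow> bool" and js
      by (induction js) auto
    from this[of _ "[1..<Suc L]"] show ?case
      by (simp add: z_def wid_def partition_ket_def vac_def fun_eq_iff del: upt_Suc)
  next
    case (Cons x xs)
    have "z (x # xs) zs = (\<Sum>zs'\<in>{zs. length zs = L}. Bop L \<tau> \<gamma> \<theta> \<zeta> \<mu> x zs zs' * z xs zs')" for zs
      by (simp add: z_def wmul_def)
    moreover have "(\<lambda>\<sigma>. (\<Prod>x\<leftarrow>xs. f (\<theta> + \<zeta> + x)) * z xs (map \<sigma> [1..<Suc L])) =
        partition_ket [1..<Suc L] 0 xs"
      using Cons by simp
    ultimately show ?case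
      using Cons.prems sum_Bop_eq_blockB[of x L _ "\<lambda>zs. (\<Prod>x\<leftarrow>xs. f (\<theta> + \<zeta> + x)) * z xs zs"]
      by (simp add: partition_ket_def sum_distrib_left mult_ac del: upt_Suc)
  qed
  from fun_cong[OF this, of "\<lambda>_. False"] show ?thesis
    by (simp add: Zpf_def z_def map_replicate_const del: upt_Suc)
qed

lemma vac_weight_sites:
  "vac_weight [1..<Suc L] x = (\<Prod>j\<in>{1..L}. f (x - \<mu> j + \<gamma>) * f (x + \<mu> j + \<gamma>))"
  by (simp add: vac_weight_def atLeastLessThanSuc_atLeastAtMost del: upt_Suc)

lemma vac_weight_sites_crossed:
  "vac_weight [1..<Suc L] (- x - \<gamma>) = (\<Prod>j\<in>{1..L}. f (x - \<mu> j) * f (x + \<mu> j))"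
proof -
  have "f (- x - \<gamma> - m + \<gamma>) * f (- x - \<gamma> + m + \<gamma>) = f (x - m) * f (x + m)" for m
    using f_cong_minus[of "- x - \<gamma> - m + \<gamma>" "x + m"] f_cong_minus[of "- x - \<gamma> + m + \<gamma>" "x - m"]
    by (simp add: mult.commute)
  then show ?thesis unfolding vac_weight_sites by simp
qed

lemma K_crossed:
  "K True (- x - \<gamma>) = f (\<zeta> - x - \<gamma>) * f (\<theta> + \<zeta> + x + \<gamma>)"
  "K False (- x - \<gamma>) = f (\<zeta> + x + \<gamma>) * f (\<theta> + \<zeta> - x - \<gamma>)"
  by (simp_all add: K_weight_simps algebra_simps)

lemma LamA_eq_up_eig:
  assumes "f (\<theta> + \<zeta> + x) \<noteq> 0"
  shows "f (\<theta> + \<zeta> + x) * LamA L \<tau> \<gamma> \<theta> \<zeta> \<mu> x = up_eig [1..<Suc L] x"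
  using assms unfolding LamA_def vac_weight_sites K_weight_simps by simp

lemma LamD_eq_up_eig_crossed:
  assumes "f (\<theta> + \<zeta> + x) \<noteq> 0"
  shows "f (\<theta> + \<zeta> + x) * LamD L \<tau> \<gamma> \<theta> \<zeta> \<mu> x =
    f (2 * x) * f (\<theta> - of_nat L * \<gamma>) / (f (2 * x + \<gamma>) * f (\<theta> - (of_nat L - 1) * \<gamma>))
      * up_eig [1..<Suc L] (- x - \<gamma>)"
  using assms unfolding LamD_def vac_weight_sites_crossed K_crossed by (simp add: mult_ac)

lemma LamAbar_eq_down_eig:
  assumes "f (\<theta> + \<zeta> + x) \<noteq> 0" "f (\<theta> + of_nat L * \<gamma>) \<noteq> 0"
  shows "f (\<theta> + \<zeta> + x) * LamAbar L \<tau> \<gamma> \<theta> \<zeta> \<mu> x = down_eig [1..<Suc L] x"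
proof -
  define t where "t = \<theta> + of_nat L * \<gamma>"
  have shifts: "\<theta> + (of_nat L - 1) * \<gamma> = t - \<gamma>" "t - \<gamma> - 2 * x = t - (2 * x + \<gamma>)"
    by (simp_all add: t_def algebra_simps)
  have length: "of_nat (length [1..<Suc L]) = (of_nat L :: complex)"
    by simp
  have "f t \<noteq> 0" using assms by (simp add: t_def)
  then show ?thesis
    using assms(1) unfolding LamAbar_def down_eig_def Let_def K_crossed vac_weight_sites_crossed
    unfolding vac_weight_sites length shifts t_def[symmetric] weights K_weight_simps
    by (simp add: distrib_left add_divide_distrib mult_ac)
qed

lemma Mcoef_0_eq:
  assumes "f (\<theta> + \<zeta> + lam 0) \<noteq> 0" "f (\<theta> + of_nat L * \<gamma>) \<noteq> 0"
  shows "f (\<theta> + \<zeta> + lam 0) * Mcoef L \<tau> \<gamma> \<theta> \<zeta> \<mu> lam 0 = down_eig [1..<Suc L] (lam 0)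
    - up_eig [1..<Suc L] (lam 0) * prod_list (map (wanted (lam 0)) (map lam [1..<Suc L]))"
proof -
  have "prod_list (map (wanted (lam 0)) (map lam [1..<Suc L])) =
      (\<Prod>j\<in>{1..L}. wanted (lam 0) (lam j))"
    using prod.distinct_set_conv_list[of "[1..<Suc L]" "\<lambda>j. wanted (lam 0) (lam j)"]
    by (simp add: o_def atLeastLessThanSuc_atLeastAtMost del: upt_Suc)
  then show ?thesis
    unfolding Mcoef_def LamA_eq_up_eig[OF assms(1), symmetric]
      LamAbar_eq_down_eig[OF assms, symmetric] wanted_def
    by (simp add: algebra_simps del: upt_Suc)
qed

lemma Mcoef_eq_bethe_coef:
  assumes i: "i \<in> {1..L}" and normalization: "f (\<theta> + \<zeta> + lam i) \<noteq> 0"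
    and "f (\<theta> - (of_nat L - 1) * \<gamma>) \<noteq> 0" "f (\<theta> - of_nat L * \<gamma>) \<noteq> 0"
  shows "f (\<theta> + \<zeta> + lam i) * Mcoef L \<tau> \<gamma> \<theta> \<zeta> \<mu> lam i =
    - bethe_coef (up_eig [1..<Suc L]) (\<theta> + (of_nat L - 2) * \<gamma>) (lam 0) (lam i)
      (map lam (remove1 i [1..<Suc L]))"
proof -
  define w e N where "w = lam i" and "e = \<theta> + (of_nat L - 2) * \<gamma>" and "N = f (\<theta> + \<zeta> + w)"
  have shift: "\<theta> + (of_nat L - 1) * \<gamma> = e + \<gamma>" by (simp add: e_def algebra_simps)
  define P where "P x = prod_list (map (wanted x) (map lam (remove1 i [1..<Suc L])))" for x
  have product: "P x = (\<Prod>j\<in>{1..L} - {i}. wanted x (lam j))" for x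
    using prod.distinct_set_conv_list[of "remove1 i [1..<Suc L]" "\<lambda>j. wanted x (lam j)"]
    by (simp add: P_def o_def atLeastLessThanSuc_atLeastAtMost del: upt_Suc)
  have sign: "f (lam 0 - w) = - f (w - lam 0)" by (rule f_cong_minus) simp
  have "N * Mcoef L \<tau> \<gamma> \<theta> \<zeta> \<mu> lam i =
     f (2 * w) * f \<gamma> * f (e + \<gamma> + w - lam 0) / (f (2 * w + \<gamma>) * f (w - lam 0) * f (e + \<gamma>)) *
       (N * LamA L \<tau> \<gamma> \<theta> \<zeta> \<mu> w) * P w +
     f \<gamma> * f (e - w - lam 0) * f (\<theta> - (of_nat L - 1) * \<gamma>) /
         (f (w + lam 0 + \<gamma>) * f (e + \<gamma>) * f (\<theta> - of_nat L * \<gamma>)) *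
       (N * LamD L \<tau> \<gamma> \<theta> \<zeta> \<mu> w) * P (- w - \<gamma>)"
    using i unfolding Mcoef_def product wanted_crossed
    unfolding wanted_def w_def[symmetric] shift e_def[symmetric]
    by (simp add: distrib_left mult_ac)
  also have "\<dots> = - (f (2 * w) * (unwanted e (lam 0) w * (up_eig [1..<Suc L] w * P w)
      + unwanted e (lam 0) (- w - \<gamma>) * (up_eig [1..<Suc L] (- w - \<gamma>) * P (- w - \<gamma>))))"
    using assms
    unfolding N_def w_def[symmetric] LamA_eq_up_eig[of w, OF normalization[folded w_def]]
      LamD_eq_up_eig_crossed[of w, OF normalization[folded w_def]]
      unwanted_crossed unfolding unwanted_def sign
    by (simp add: algebra_simps del: upt_Suc)
  finally show ?thesis
    by (simp only: bethe_coef_def P_def w_def e_def N_def)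
qed

end

definition omit :: "nat \<Rightarrow> nat \<Rightarrow> nat list" where
  "omit L \<nu> = filter (\<lambda>k. k \<noteq> \<nu>) [0..<Suc L]"

definition reflecting_sum :: "nat \<Rightarrow> complex \<Rightarrow> complex \<Rightarrow> complex \<Rightarrow> complex \<Rightarrow> (nat \<Rightarrow> complex) \<Rightarrow>
    (nat \<Rightarrow> complex) \<Rightarrow> complex" where
  "reflecting_sum L \<tau> \<gamma> \<theta> \<zeta> \<mu> lam =
     (\<Sum>\<nu>=0..L. Mcoef L \<tau> \<gamma> \<theta> \<zeta> \<mu> lam \<nu> * Zpf L \<tau> \<gamma> \<theta> \<zeta> \<mu> (map lam (omit L \<nu>)))"

lemma set_omit: "set (omit L \<nu>) = {0..L} - {\<nu>}"
  and distinct_omit: "distinct (omit L \<nu>)"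
  by (auto simp: omit_def simp del: upt_Suc)

lemma omit_eq_remove1: "omit L \<nu> = remove1 \<nu> (0 # [1..<Suc L])"
proof -
  have "omit L \<nu> = remove1 \<nu> [0..<Suc L]"
    unfolding omit_def distinct_remove1_removeAll[OF distinct_upt] removeAll_filter_not_eq
    by (rule filter_cong) auto
  then show ?thesis by (simp only: upt_conv_Cons zero_less_Suc One_nat_def)
qed

lemma omit_0: "omit L 0 = [1..<Suc L]"
  by (simp add: omit_eq_remove1)

lemma omit_pos: "\<nu> \<in> {1..L} \<Longrightarrow> omit L \<nu> = 0 # remove1 \<nu> [1..<Suc L]"
  by (simp add: omit_eq_remove1 del: upt_Suc)

context sos
begin

lemma normalized_reflecting_sum:
  assumes "\<And>k. k \<le> L \<Longrightarrow> f (\<theta> + \<zeta> + lam k) \<noteq> 0"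
  shows "(\<Prod>k\<in>{0..L}. f (\<theta> + \<zeta> + lam k)) * reflecting_sum L \<tau> \<gamma> \<theta> \<zeta> \<mu> lam =
    (\<Sum>\<nu>=0..L. f (\<theta> + \<zeta> + lam \<nu>) * Mcoef L \<tau> \<gamma> \<theta> \<zeta> \<mu> lam \<nu> *
      partition_ket [1..<Suc L] 0 (map lam (omit L \<nu>)) (\<lambda>_. False))"
  unfolding reflecting_sum_def sum_distrib_left
proof (rule sum.cong[OF refl])
  fix \<nu> assume \<nu>: "\<nu> \<in> {0..L}"
  let ?N = "\<lambda>k. f (\<theta> + \<zeta> + lam k)" and ?vs = "map lam (omit L \<nu>)"
  have "(\<Prod>k\<in>{0..L}. ?N k) = ?N \<nu> * (\<Prod>k\<in>{0..L} - {\<nu>}. ?N k)"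
    using \<nu> by (intro prod.remove) auto
  moreover have "(\<Prod>k\<in>{0..L} - {\<nu>}. ?N k) = prod_list (map ?N (omit L \<nu>))"
    using prod.distinct_set_conv_list[OF distinct_omit, of ?N L \<nu>] by (simp add: set_omit)
  moreover have "prod_list (map ?N (omit L \<nu>)) * Zpf L \<tau> \<gamma> \<theta> \<zeta> \<mu> ?vs =
      partition_ket [1..<Suc L] 0 ?vs (\<lambda>_. False)"
    using Zpf_eq_partition_ket[of ?vs L] assms by (simp add: set_omit o_def del: upt_Suc)
  ultimately show "(\<Prod>k\<in>{0..L}. ?N k) * (Mcoef L \<tau> \<gamma> \<theta> \<zeta> \<mu> lam \<nu> * Zpf L \<tau> \<gamma> \<theta> \<zeta> \<mu> ?vs) =
      ?N \<nu> * Mcoef L \<tau> \<gamma> \<theta> \<zeta> \<mu> lam \<nu> * partition_ket [1..<Suc L] 0 ?vs (\<lambda>_. False)"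
    by algebra
qed

lemma reflecting_sum_eq_0_generic:
  assumes nonsingular: "nonsingular (L + 3)"
    and normalizations: "\<And>k. k \<le> L \<Longrightarrow> f (\<theta> + \<zeta> + lam k) \<noteq> 0"
    and regular: "\<And>k. k \<le> L \<Longrightarrow> regular [1..<Suc L] (lam k)"
    and separated: "\<And>i j. i < j \<Longrightarrow> j \<le> L \<Longrightarrow> separated (lam i) (lam j)"
  shows "reflecting_sum L \<tau> \<gamma> \<theta> \<zeta> \<mu> lam = 0"
proof -
  let ?js = "[1..<Suc L]"
  define Z where "Z ks = partition_ket ?js 0 (map lam ks) (\<lambda>_. False)" for ks
  define M where "M \<nu> = f (\<theta> + \<zeta> + lam \<nu>) * Mcoef L \<tau> \<gamma> \<theta> \<zeta> \<mu> lam \<nu>" for \<nu>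
  have nonzero: "f (\<theta> + of_nat L * \<gamma>) \<noteq> 0" "f (\<theta> - (of_nat L - 1) * \<gamma>) \<noteq> 0"
      "f (\<theta> - of_nat L * \<gamma>) \<noteq> 0"
    using nonsingular[unfolded nonsingular_def, THEN spec, of "int L"]
      nonsingular[unfolded nonsingular_def, THEN spec, of "1 - int L"]
      nonsingular[unfolded nonsingular_def, THEN spec, of "- int L"]
    by (simp_all add: algebra_simps)
  have "M i =
      - bethe_coef (up_eig ?js) (\<theta> + (of_nat L - 2) * \<gamma>) (lam 0) (lam i) (map lam (remove1 i ?js))"
    if "i \<in> {1..L}" for i
    unfolding M_def using normalizations nonzero that by (intro Mcoef_eq_bethe_coef) auto
  moreover have "M 0 = down_eig ?js (lam 0) -
      up_eig ?js (lam 0) * prod_list (map (wanted (lam 0)) (map lam ?js))"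
    unfolding M_def using normalizations nonzero by (intro Mcoef_0_eq) auto
  moreover have "sorted_wrt separated (lam 0 # map lam ?js)"
    using separated
    by (auto simp: sorted_wrt_map less_Suc_eq_le simp del: upt_Suc
        intro!: sorted_wrt_mono_rel[OF _ sorted_wrt_upt])
  moreover have "\<forall>v\<in>set (lam 0 # map lam ?js). regular ?js v"
    using regular by (auto simp: less_Suc_eq_le simp del: upt_Suc)
  ultimately have "M 0 * Z ?js + (\<Sum>i\<in>{1..L}. M i * Z (0 # remove1 i ?js)) = 0"
    using functional_relation[of ?js 0 "\<lambda>_. False" ?js "lam 0" lam] nonsingular
    by (simp add: Z_def sum_negf atLeastLessThanSuc_atLeastAtMost del: upt_Suc)
  moreover have "(\<Sum>\<nu>=0..L. M \<nu> * Z (omit L \<nu>)) =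
      M 0 * Z ?js + (\<Sum>i\<in>{1..L}. M i * Z (0 # remove1 i ?js))"
    by (simp add: sum.atLeast_Suc_atMost omit_0 omit_pos del: upt_Suc)
  ultimately show ?thesis
    using normalized_reflecting_sum[of L lam] normalizations by (simp add: M_def Z_def)
qed

end

section \<open>Removing the genericity assumptions\<close>

lemma tendsto_if_const:
  "(c \<Longrightarrow> (g \<longlongrightarrow> g0) F) \<Longrightarrow> (\<not> c \<Longrightarrow> (k \<longlongrightarrow> k0) F) \<Longrightarrow>
    ((\<lambda>t. if c then g t else k t) \<longlongrightarrow> (if c then g0 else k0)) F"
  by (cases c) auto

definition op_tendsto :: "nat \<Rightarrow> ('a \<Rightarrow> fop) \<Rightarrow> fop \<Rightarrow> 'a filter \<Rightarrow> bool" where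
  "op_tendsto L Op Op0 F \<longleftrightarrow>
     (\<forall>out\<in>fstates L. \<forall>inp\<in>fstates L. ((\<lambda>t. Op t out inp) \<longlongrightarrow> Op0 out inp) F)"

lemma op_tendsto_opmul:
  "op_tendsto L O1 O1' F \<Longrightarrow> op_tendsto L O2 O2' F \<Longrightarrow>
    op_tendsto L (\<lambda>t. opmul L (O1 t) (O2 t)) (opmul L O1' O2') F"
  unfolding op_tendsto_def opmul_def by (auto intro!: tendsto_intros)

lemma op_tendsto_foldr:
  assumes "\<And>j. op_tendsto L (\<lambda>t. G t j) (G0 j) F"
  shows "op_tendsto L (\<lambda>t. foldr (opmul L) (map (G t) js) opid)
      (foldr (opmul L) (map G0 js) opid) F"
proof (induction js)
  case Nil
  then show ?case by (simp add: op_tendsto_def)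
next
  case (Cons j js)
  then show ?case using op_tendsto_opmul[OF assms] by simp
qed

context sos
begin

lemma eventually_f_nonzero:
  assumes "f x0 \<noteq> 0" and deriv: "(g has_field_derivative d) (at t0)" and "d \<noteq> 0"
  shows "\<forall>\<^sub>F t in at t0. f (g t) \<noteq> 0"
proof -
  have "\<forall>\<^sub>F t in at t0. (g t - g t0) / (t - t0) \<noteq> 0"
    using deriv assms(3) unfolding has_field_derivative_iff by (rule tendsto_imp_eventually_ne)
  then have "\<forall>\<^sub>F t in at t0. g t \<noteq> g t0"
    by eventually_elim auto
  then have "filterlim g (at (g t0)) (at t0)"
    using DERIV_isCont[OF deriv] by (simp add: filterlim_at isCont_def eventually_mono)
  moreover have "\<forall>\<^sub>F x in at (g t0). f x \<noteq> 0"
    using assms(1) non_zero_neighbour_alt[OF thf_holomorphic_on[OF Im_pos] open_UNIV connected_UNIV,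
        of "g t0" x0]
    by simp
  ultimately show ?thesis
    by (rule eventually_compose_filterlim[rotated])
qed

lemma eventually_regular:
  assumes "f x0 \<noteq> 0" "(g has_field_derivative d) (at t0)" "d \<noteq> 0"
  shows "\<forall>\<^sub>F t in at t0. regular js (g t)"
  unfolding regular_def invertible_at_def
  by (intro eventually_conj eventually_ball_finite ballI eventually_f_nonzero[OF assms(1)];
      ((rule DERIV_const assms(2) DERIV_add DERIV_diff DERIV_minus DERIV_cmult)+)?)
    (use assms(3) in simp_all)

lemma eventually_separated:
  assumes "f x0 \<noteq> 0" "(g has_field_derivative d) (at t0)" "(k has_field_derivative e) (at t0)"
    and "d \<noteq> e" "d + e \<noteq> 0"
  shows "\<forall>\<^sub>F t in at t0. separated (g t) (k t)"
  unfolding separated_def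
  by (intro eventually_conj eventually_f_nonzero[OF assms(1)];
      ((rule DERIV_const assms(2,3) DERIV_add DERIV_diff DERIV_minus DERIV_cmult)+)?)
    (use assms(4,5) in \<open>simp_all add: add.commute\<close>)

text \<open>
  The slopes are positive and distinct, so that every argument that must avoid the zeros of \<open>f\<close>
  moves along the line.
\<close>

lemma eventually_reflecting_sum_eq_0:
  assumes "f x0 \<noteq> 0"
  shows "\<forall>\<^sub>F t in at 0. reflecting_sum L \<tau> \<gamma> (\<theta> + t) \<zeta> \<mu> (\<lambda>k. lam k + of_nat (Suc k) * t) = 0"
proof -
  define lam_t where "lam_t t k = lam k + of_nat (Suc k) * t" for t k
  note nonzero = eventually_f_nonzero[OF assms]
  have deriv: "((\<lambda>t. lam_t t k) has_field_derivative of_nat (Suc k)) (at 0)" for k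
    unfolding lam_t_def by (rule derivative_eq_intros refl)+ simp
  have of_nat_nonzero: "of_nat m \<noteq> (0 :: complex)" if "m > 0" for m
    using that by simp
  have "\<forall>\<^sub>F t in at 0. \<forall>k\<in>{- int (L + 3)..int (L + 3)}. f (\<theta> + t + of_int k * \<gamma>) \<noteq> 0"
    by (intro eventually_ball_finite ballI nonzero[of _ 1]) (auto intro!: derivative_eq_intros)
  moreover have "\<forall>\<^sub>F t in at 0. \<forall>k\<in>{..L}. f (\<theta> + t + \<zeta> + lam_t t k) \<noteq> 0"
  proof (intro eventually_ball_finite ballI finite_atMost)
    fix k
    have "((\<lambda>t. \<theta> + t + \<zeta> + lam_t t k) has_field_derivative of_nat (k + 2)) (at 0)"
      by (auto intro!: derivative_eq_intros deriv)
    then show "\<forall>\<^sub>F t in at 0. f (\<theta> + t + \<zeta> + lam_t t k) \<noteq> 0"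
      by (rule nonzero) (rule of_nat_nonzero, simp)
  qed
  moreover have "\<forall>\<^sub>F t in at 0. \<forall>k\<in>{..L}. regular [1..<Suc L] (lam_t t k)"
    by (intro eventually_ball_finite ballI eventually_regular[OF assms deriv] of_nat_nonzero) auto
  moreover have "\<forall>\<^sub>F t in at 0. \<forall>j\<in>{..L}. \<forall>i\<in>{..<j}. separated (lam_t t i) (lam_t t j)"
    by (intro eventually_ball_finite ballI eventually_separated[OF assms deriv deriv])
      (auto simp flip: of_nat_add simp del: of_nat_Suc)
  ultimately show ?thesis
  proof eventually_elim
    case (elim t)
    then show ?case
      unfolding lam_t_def[symmetric]
      by (intro sos.reflecting_sum_eq_0_generic[OF sos_axioms])
        (auto simp: sos.nonsingular_def[OF sos_axioms] abs_le_iff minus_le_iff simp del: upt_Suc)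
  qed
qed

lemma tendsto_f:
  assumes "(g \<longlongrightarrow> a) F"
  shows "((\<lambda>t. f (g t)) \<longlongrightarrow> f a) F"
proof -
  have "isCont f a"
    using holomorphic_on_imp_continuous_on[OF thf_holomorphic_on[OF Im_pos]]
    by (simp add: continuous_on_eq_continuous_at)
  then show ?thesis
    using assms by (rule isCont_tendsto_compose)
qed

lemma tendsto_Rent:
  assumes "(l \<longlongrightarrow> l0) F" "(th \<longlongrightarrow> th0) F" "f th0 \<noteq> 0"
  shows "((\<lambda>t. Rent \<tau> \<gamma> (l t) (th t) a b c d) \<longlongrightarrow> Rent \<tau> \<gamma> l0 th0 a b c d) F"
  unfolding Rent_def
  by (cases a; cases b; cases c; cases d) (auto intro!: tendsto_intros tendsto_f assms)

lemma nonsingular_spin_sum: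
  assumes "nonsingular (length ys)"
  shows "f (\<theta> - \<gamma> * spin_sum ys j) \<noteq> 0"
proof -
  define k where "k = (\<Sum>i\<in>{j..<length ys}. if ys ! i then 1 else - 1 :: int)"
  have "\<bar>k\<bar> \<le> (\<Sum>i\<in>{j..<length ys}. \<bar>if ys ! i then 1 else - 1\<bar>)"
    unfolding k_def by (rule sum_abs)
  also have "\<dots> = (\<Sum>i\<in>{j..<length ys}. 1)" by (rule sum.cong) auto
  also have "\<dots> \<le> int (length ys)" by simp
  finally have "f (\<theta> + of_int (- k) * \<gamma>) \<noteq> 0"
    using assms unfolding nonsingular_def by (metis abs_minus_cancel)
  moreover have "spin_sum ys j = of_int k"
    by (auto simp: spin_sum_def k_def intro!: sum.cong)
  ultimately show ?thesis by (simp add: mult.commute)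
qed

context
  fixes th l :: "'a \<Rightarrow> complex" and l0 :: complex and F :: "'a filter"
  assumes th: "(th \<longlongrightarrow> \<theta>) F" and l: "(l \<longlongrightarrow> l0) F"
begin

lemma op_tendsto_R:
  assumes "nonsingular L"
  shows "op_tendsto L (\<lambda>t. R0j L \<tau> \<gamma> (l t + c) (th t) j) (R0j L \<tau> \<gamma> (l0 + c) \<theta> j) F"
    and "op_tendsto L (\<lambda>t. Rj0 L \<tau> \<gamma> (l t + c) (th t) j) (Rj0 L \<tau> \<gamma> (l0 + c) \<theta> j) F"
  using assms
  unfolding op_tendsto_def fstates_def R0j_def Rj0_def Ball_def split_paired_All split_conv
  by (safe intro!: tendsto_if_const tendsto_Rent tendsto_intros th l nonsingular_spin_sum) simp_all

lemma op_tendsto_Kop: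
  assumes "f (\<theta> + \<zeta> + l0) \<noteq> 0"
  shows "op_tendsto L (\<lambda>t. Kop \<tau> \<zeta> (l t) (th t)) (Kop \<tau> \<zeta> l0 \<theta>) F"
  unfolding op_tendsto_def fstates_def Kop_def
  by (auto intro!: tendsto_if_const tendsto_f tendsto_intros th l assms)

lemma tendsto_Bop:
  assumes "nonsingular L" "f (\<theta> + \<zeta> + l0) \<noteq> 0" "length xs = L" "length ys = L"
  shows "((\<lambda>t. Bop L \<tau> \<gamma> (th t) \<zeta> \<mu> (l t) xs ys) \<longlongrightarrow> Bop L \<tau> \<gamma> \<theta> \<zeta> \<mu> l0 xs ys) F"
proof -
  have "op_tendsto L (\<lambda>t. dmon L \<tau> \<gamma> (th t) \<zeta> \<mu> (l t)) (dmon L \<tau> \<gamma> \<theta> \<zeta> \<mu> l0) F"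
    unfolding dmon_def Tmon_def Tbar_def diff_conv_add_uminus
    by (intro op_tendsto_opmul op_tendsto_foldr op_tendsto_R op_tendsto_Kop assms)
  then show ?thesis
    using assms(3,4) unfolding op_tendsto_def Bop_def fstates_def by auto
qed

end

lemma tendsto_Zpf:
  assumes "nonsingular L" and "\<forall>k\<in>set ks. f (\<theta> + \<zeta> + lam k) \<noteq> 0"
    and th: "(th \<longlongrightarrow> \<theta>) F" and lam_t: "\<And>k. ((\<lambda>t. lam_t t k) \<longlongrightarrow> lam k) F"
  shows "((\<lambda>t. Zpf L \<tau> \<gamma> (th t) \<zeta> \<mu> (map (lam_t t) ks)) \<longlongrightarrow> Zpf L \<tau> \<gamma> \<theta> \<zeta> \<mu> (map lam ks)) F"
proof -
  have "length xs = L \<Longrightarrow>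
    ((\<lambda>t. foldr (wmul L) (map (Bop L \<tau> \<gamma> (th t) \<zeta> \<mu>) (map (lam_t t) ks)) wid xs zs) \<longlongrightarrow>
      foldr (wmul L) (map (Bop L \<tau> \<gamma> \<theta> \<zeta> \<mu>) (map lam ks)) wid xs zs) F" for xs zs
    using assms(2)
  proof (induction ks arbitrary: xs)
    case Nil
    then show ?case by simp
  next
    case (Cons k ks)
    then show ?case
      unfolding list.map foldr.simps o_def wmul_def
      by (intro tendsto_sum tendsto_mult tendsto_Bop[OF th lam_t] assms(1)) auto
  qed
  then show ?thesis unfolding Zpf_def by simp
qed

lemma tendsto_Mcoef:
  assumes "nonsingular L" and "L \<ge> 1" and "\<nu> \<le> L"
    and differences: "\<forall>k\<le>L. \<forall>l\<le>L. k \<noteq> l \<longrightarrow> f (lam k - lam l) \<noteq> 0"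
    and sums: "\<forall>k\<le>L. \<forall>l\<le>L. f (lam k + lam l + \<gamma>) \<noteq> 0"
    and normalizations: "\<forall>k\<le>L. f (\<theta> + \<zeta> + lam k) \<noteq> 0"
    and th: "(th \<longlongrightarrow> \<theta>) F" and lam_t: "\<And>k. ((\<lambda>t. lam_t t k) \<longlongrightarrow> lam k) F"
  shows "((\<lambda>t. Mcoef L \<tau> \<gamma> (th t) \<zeta> \<mu> (lam_t t) \<nu>) \<longlongrightarrow> Mcoef L \<tau> \<gamma> \<theta> \<zeta> \<mu> lam \<nu>) F"
proof -
  have shifts: "f (\<theta> + (of_nat L - 1) * \<gamma>) \<noteq> 0" "f (\<theta> - (of_nat L - 1) * \<gamma>) \<noteq> 0"
      "f (\<theta> - of_nat L * \<gamma>) \<noteq> 0"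
    using assms(2) assms(1)[unfolded nonsingular_def, THEN spec, of "int L - 1"]
      assms(1)[unfolded nonsingular_def, THEN spec, of "- (int L - 1)"]
      assms(1)[unfolded nonsingular_def, THEN spec, of "- int L"] by (auto simp: algebra_simps)
  have double: "f (2 * lam k + \<gamma>) \<noteq> 0" if "k \<le> L" for k
    using sums[rule_format, OF that that] by (simp only: mult_2 not_False_eq_True)
  note nonzero = shifts double differences[rule_format] sums[rule_format]
    normalizations[rule_format]
  show ?thesis
  proof (cases "\<nu> = 0")
    case True
    show ?thesis
      unfolding Mcoef_def if_P[OF True] LamAbar_def LamA_def
      by (intro tendsto_intros tendsto_f th lam_t) (simp_all add: nonzero)
  next
    case False
    show ?thesis
      unfolding Mcoef_def if_not_P[OF False] LamD_def LamA_def
      by (intro tendsto_intros tendsto_f th lam_t) (use assms(3) False in \<open>auto simp: nonzero\<close>)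
  qed
qed

end

theorem theorem3p1:
  fixes \<tau> \<gamma> \<theta> \<zeta> :: complex and \<mu> lam :: "nat \<Rightarrow> complex" and L :: nat
  assumes "Im \<tau> > 0" and "L \<ge> 1"
    and "\<forall>k\<le>L. \<forall>l\<le>L. k \<noteq> l \<longrightarrow> thf \<tau> (lam k - lam l) \<noteq> 0"
    and "\<forall>k\<le>L. \<forall>l\<le>L. thf \<tau> (lam k + lam l + \<gamma>) \<noteq> 0"
    and "\<forall>k\<le>L. thf \<tau> (\<theta> + \<zeta> + lam k) \<noteq> 0"
    and "\<forall>k::int. \<bar>k\<bar> \<le> int L \<longrightarrow> thf \<tau> (\<theta> + of_int k * \<gamma>) \<noteq> 0"
  shows "(\<Sum>\<nu>=0..L. Mcoef L \<tau> \<gamma> \<theta> \<zeta> \<mu> lam \<nu>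
            * Zpf L \<tau> \<gamma> \<theta> \<zeta> \<mu> (map lam (filter (\<lambda>k. k \<noteq> \<nu>) [0..<Suc L]))) = 0"
proof -
  interpret sos \<tau> \<gamma> \<theta> \<zeta> \<mu> by unfold_locales (rule assms(1))
  have nonsingular: "nonsingular L"
    using assms(6) unfolding nonsingular_def .
  have limits: "((\<lambda>t. \<theta> + t) \<longlongrightarrow> \<theta>) (at 0)" "((\<lambda>t. lam k + of_nat (Suc k) * t) \<longlongrightarrow> lam k) (at 0)" for k
    by (auto intro!: tendsto_eq_intros)
  have "((\<lambda>t. reflecting_sum L \<tau> \<gamma> (\<theta> + t) \<zeta> \<mu> (\<lambda>k. lam k + of_nat (Suc k) * t))
      \<longlongrightarrow> reflecting_sum L \<tau> \<gamma> \<theta> \<zeta> \<mu> lam) (at 0)"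
    unfolding reflecting_sum_def using assms
    by (intro tendsto_sum tendsto_mult tendsto_Mcoef tendsto_Zpf limits nonsingular)
      (auto simp: set_omit)
  moreover have
    "\<forall>\<^sub>F t in at 0. reflecting_sum L \<tau> \<gamma> (\<theta> + t) \<zeta> \<mu> (\<lambda>k. lam k + of_nat (Suc k) * t) = 0"
    using assms(5) by (intro eventually_reflecting_sum_eq_0) auto
  ultimately have "((\<lambda>_. 0) \<longlongrightarrow> reflecting_sum L \<tau> \<gamma> \<theta> \<zeta> \<mu> lam) (at (0 :: complex))"
    by (rule Lim_transform_eventually)
  then show ?thesis
    by (simp add: tendsto_const_iff reflecting_sum_def omit_def)
qed

end
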